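(* Let $X^N=(X_0^N,\dots,X_d^N)$ be the Markov process described in the context and $\rho=\lambda/\mu$. Under the condition $d\beta\mu<\lambda$ and if $X^N(0)=(0,\ldots,0,F_N)$, the sequence of processes $\big(X_0^N(N^{d-1}t)/N,\ t\ge0\big)$ converges in distribution as $N\to\infty$ to $(\Phi(t))$ where, for $t\geq 0$, $\Phi(t)$ is the unique solution $y\in[0,\beta]$ of the equation $$\left(1-\frac{y}{\beta}\right)^{\rho/d}e^y=\exp\left(-\lambda\frac{(d-1)!}{\rho^{d-1}}\,t\right).$$
   Context: Model. Fix real numbers $\lambda,\mu>0$ and an integer $d\ge 2$. For each integer $N\ge1$ let $F_N\in\mathbb{N}$, and assume there are $\beta>0$ and $\gamma\ge 0$ with $\lim_{N\to\infty}(F_N-N\beta)/\sqrt N=\gamma$. The process $X^N(t)=(X^N_0(t),\dots,X^N_d(t))$ is the continuous-time Markov jump process on $\{x=(x_0,\dots,x_d)\in\mathbb{N}^{d+1}:\sum_i x_i=F_N\}$ with the following transitions ($e_0,\dots,e_d$ are the unit vectors): (loss) for $1\le k\le d$, $x\to x-e_k+e_{k-1}$ at rate $\mu k x_k$; (duplication) for $1\le k\le d-1$, $x\to x-e_k+e_{k+1}$ at rate $\lambda N$ if $x_k>0$ and $x_i=0$ for all $1\le i<k$, and at rate $0$ otherwise. Convergence in distribution of processes (to a continuous limit) is understood on the space of càdlàg functions with the topology of uniform convergence on compact sets. *)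

theory Defs
  imports "HOL-Probability.Probability"
begin

section \<open>Finite-state Markov jump processes\<close>

definition cadlag :: "(real \<Rightarrow> 'b::topological_space) \<Rightarrow> bool" where
  "cadlag f \<longleftrightarrow>
     (\<forall>t\<ge>0. (f \<longlongrightarrow> f t) (at_right t)) \<and> (\<forall>t>0. \<exists>l. (f \<longlongrightarrow> l) (at_left t))"

definition generator :: "'s set \<Rightarrow> ('s \<Rightarrow> 's \<Rightarrow> real) \<Rightarrow> 's \<Rightarrow> 's \<Rightarrow> real" where
  "generator S q x y = (if x = y then - (\<Sum>z\<in>S - {x}. q x z) else q x y)"

text \<open>For finite \<open>S\<close> these conditions determine \<open>P\<close> on \<open>S\<close>: it is the matrix
  exponential \<open>P t = exp (t Q)\<close> with \<open>Q = generator S q\<close>.\<close>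

definition transition_semigroup ::
  "'s set \<Rightarrow> ('s \<Rightarrow> 's \<Rightarrow> real) \<Rightarrow> (real \<Rightarrow> 's \<Rightarrow> 's \<Rightarrow> real) \<Rightarrow> bool" where
  "transition_semigroup S q P \<longleftrightarrow>
     (\<forall>t\<ge>0. \<forall>x\<in>S. \<forall>y\<in>S. 0 \<le> P t x y) \<and>
     (\<forall>t\<ge>0. \<forall>x\<in>S. (\<Sum>y\<in>S. P t x y) = 1) \<and>
     (\<forall>x\<in>S. \<forall>y\<in>S. P 0 x y = of_bool (x = y)) \<and>
     (\<forall>s\<ge>0. \<forall>t\<ge>0. \<forall>x\<in>S. \<forall>y\<in>S. P (s + t) x y = (\<Sum>z\<in>S. P s x z * P t z y)) \<and>
     (\<forall>x\<in>S. \<forall>y\<in>S. ((\<lambda>h. (P h x y - of_bool (x = y)) / h) \<longlongrightarrow> generator S q x y) (at_right 0))"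

definition markov_jump_process ::
  "'a measure \<Rightarrow> 's::topological_space set \<Rightarrow> ('s \<Rightarrow> 's \<Rightarrow> real) \<Rightarrow> (real \<Rightarrow> 'a \<Rightarrow> 's) \<Rightarrow> bool" where
  "markov_jump_process M S q X \<longleftrightarrow>
     prob_space M \<and> finite S \<and>
     (\<forall>t\<ge>0. X t \<in> M \<rightarrow>\<^sub>M count_space S) \<and>
     (\<forall>\<omega>\<in>space M. cadlag (\<lambda>t. X t \<omega>)) \<and>
     (\<exists>P. transition_semigroup S q P \<and>
        (\<forall>n (\<tau>::nat \<Rightarrow> real) x.
           0 \<le> \<tau> 0 \<and> (\<forall>i<n. \<tau> i < \<tau> (Suc i)) \<and> (\<forall>i\<le>n. x i \<in> S) \<longrightarrow>
           measure M {\<omega>\<in>space M. \<forall>i\<le>n. X (\<tau> i) \<omega> = x i} =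
             measure M {\<omega>\<in>space M. X (\<tau> 0) \<omega> = x 0} *
             (\<Prod>i<n. P (\<tau> (Suc i) - \<tau> i) (x i) (x (Suc i)))))"

section \<open>The storage model\<close>

text \<open>A vector \<open>(x\<^sub>0, \<dots>, x\<^sub>d)\<close> is a function on \<open>nat\<close> vanishing beyond \<open>d\<close>.\<close>

definition states :: "nat \<Rightarrow> nat \<Rightarrow> (nat \<Rightarrow> nat) set" where
  "states d n = {x. (\<forall>i>d. x i = 0) \<and> (\<Sum>i\<le>d. x i) = n}"

text \<open>\<open>x - e\<^sub>k + e\<^sub>j\<close>, meant for \<open>k \<noteq> j\<close> and \<open>x k > 0\<close>.\<close>

definition move :: "nat \<Rightarrow> nat \<Rightarrow> (nat \<Rightarrow> nat) \<Rightarrow> nat \<Rightarrow> nat" where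
  "move k j x = x(k := x k - 1, j := x j + 1)"

text \<open>The truncated subtraction in \<open>move\<close> is harmless: both rates vanish when \<open>x k = 0\<close>.\<close>

definition jump_rate :: "real \<Rightarrow> real \<Rightarrow> nat \<Rightarrow> nat \<Rightarrow> (nat \<Rightarrow> nat) \<Rightarrow> (nat \<Rightarrow> nat) \<Rightarrow> real" where
  "jump_rate lam \<mu> d N x y =
     (\<Sum>k\<in>{1..d}. (if y = move k (k - 1) x then \<mu> * real k * real (x k) else 0)) +
     (\<Sum>k\<in>{1..<d}. (if y = move k (k + 1) x \<and> x k > 0 \<and> (\<forall>i\<in>{1..<k}. x i = 0)
                    then lam * real N else 0))"

section \<open>Convergence in distribution, uniformly on compact sets\<close>

text \<open>Paths on \<open>[0, \<infinity>)\<close> are represented by extensional functions on \<open>{0..}\<close>.\<close>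

definition cadlag_paths :: "(real \<Rightarrow> real) set" where
  "cadlag_paths = {f \<in> extensional {0..}. cadlag f}"

definition cadlag_measure_space :: "(real \<Rightarrow> real) measure" where
  "cadlag_measure_space = restrict_space (\<Pi>\<^sub>M t\<in>{0..}. borel) cadlag_paths"

lemma space_cadlag_measure_space [simp]: "space cadlag_measure_space = cadlag_paths"
  by (auto simp: cadlag_measure_space_def space_restrict_space space_PiM cadlag_paths_def PiE_def)

definition ucc_neighbourhood :: "(real \<Rightarrow> real) \<Rightarrow> real \<Rightarrow> real \<Rightarrow> (real \<Rightarrow> real) set" where
  "ucc_neighbourhood f T \<delta> = {g \<in> cadlag_paths. \<forall>s\<in>{0..T}. \<bar>g s - f s\<bar> < \<delta>}"

definition ucc_topology :: "(real \<Rightarrow> real) topology" where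
  "ucc_topology = topology (\<lambda>U. U \<subseteq> cadlag_paths \<and>
     (\<forall>f\<in>U. \<exists>T. \<exists>\<delta>>0. ucc_neighbourhood f T \<delta> \<subseteq> U))"

lemma openin_ucc_topology:
  "openin ucc_topology U \<longleftrightarrow> U \<subseteq> cadlag_paths \<and>
     (\<forall>f\<in>U. \<exists>T. \<exists>\<delta>>0. ucc_neighbourhood f T \<delta> \<subseteq> U)"
proof -
  let ?P = "\<lambda>U. U \<subseteq> cadlag_paths \<and> (\<forall>f\<in>U. \<exists>T. \<exists>\<delta>>0. ucc_neighbourhood f T \<delta> \<subseteq> U)"
  have "istopology ?P"
    unfolding istopology_def
  proof (intro conjI allI impI)
    fix U V assume U: "?P U" and V: "?P V"
    show "U \<inter> V \<subseteq> cadlag_paths" using U by blast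
    show "\<forall>f\<in>U \<inter> V. \<exists>T. \<exists>\<delta>>0. ucc_neighbourhood f T \<delta> \<subseteq> U \<inter> V"
    proof
      fix f assume f: "f \<in> U \<inter> V"
      obtain T1 d1 where 1: "d1 > 0" "ucc_neighbourhood f T1 d1 \<subseteq> U" using U f by blast
      obtain T2 d2 where 2: "d2 > 0" "ucc_neighbourhood f T2 d2 \<subseteq> V" using V f by blast
      have "ucc_neighbourhood f (max T1 T2) (min d1 d2) \<subseteq>
          ucc_neighbourhood f T1 d1 \<inter> ucc_neighbourhood f T2 d2"
        by (auto simp: ucc_neighbourhood_def)
      then have "ucc_neighbourhood f (max T1 T2) (min d1 d2) \<subseteq> U \<inter> V"
        using 1(2) 2(2) by blast
      then show "\<exists>T. \<exists>\<delta>>0. ucc_neighbourhood f T \<delta> \<subseteq> U \<inter> V"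
        using 1(1) 2(1) by (metis min_less_iff_conj)
    qed
  next
    fix K assume K: "\<forall>U\<in>K. ?P U"
    then show "\<Union>K \<subseteq> cadlag_paths" by blast
    show "\<forall>f\<in>\<Union>K. \<exists>T. \<exists>\<delta>>0. ucc_neighbourhood f T \<delta> \<subseteq> \<Union>K"
      using K by (meson Union_iff Union_upper subset_trans)
  qed
  then show ?thesis by (simp add: ucc_topology_def topology_inverse')
qed

lemma topspace_ucc_topology [simp]: "topspace ucc_topology = cadlag_paths"
proof -
  have "openin ucc_topology cadlag_paths"
    unfolding openin_ucc_topology by (auto simp: ucc_neighbourhood_def intro: exI[of _ "1::real"])
  then show ?thesis
    by (metis openin_subset openin_topspace openin_ucc_topology subset_antisym)
qed

definition process_law :: "'a measure \<Rightarrow> (real \<Rightarrow> 'a \<Rightarrow> real) \<Rightarrow> (real \<Rightarrow> real) measure" where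
  "process_law M Y = distr M cadlag_measure_space (\<lambda>\<omega>. \<lambda>t\<in>{0..}. Y t \<omega>)"

text \<open>Under the topology of uniform convergence on compact sets the cadlag functions are not
  separable, and the law of a jump process is in general not defined on all Borel sets.
  As usual, laws live on the sigma-algebra generated by the coordinate projections and the test
  functions are the bounded continuous functions that are measurable for it.\<close>

definition ucc_weak_conv :: "(nat \<Rightarrow> (real \<Rightarrow> real) measure) \<Rightarrow> (real \<Rightarrow> real) measure \<Rightarrow> bool" where
  "ucc_weak_conv L L' \<longleftrightarrow>
     (\<forall>H. continuous_map ucc_topology euclideanreal H \<and>
          H \<in> borel_measurable cadlag_measure_space \<and> bounded (H ` cadlag_paths) \<longrightarrow>
          (\<lambda>N. integral\<^sup>L (L N) H) \<longlonglongrightarrow> integral\<^sup>L L' H)"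

definition limit_equation :: "real \<Rightarrow> real \<Rightarrow> real \<Rightarrow> nat \<Rightarrow> real \<Rightarrow> real \<Rightarrow> bool" where
  "limit_equation lam \<rho> \<beta> d t y \<longleftrightarrow>
     (1 - y / \<beta>) powr (\<rho> / real d) * exp y = exp (- lam * (fact (d - 1) / \<rho> ^ (d - 1)) * t)"

end

theory Submission
  imports Defs
begin

text \<open>The number of lost copies \<open>x 0\<close> never decreases and the limit is deterministic, continuous and
  monotone, so it suffices to prove \<open>L\<^sup>2\<close> convergence at every fixed time; everything is then expressed
  through the transition semigroup and Dynkin's formula.

  For \<open>1 \<le> k < d\<close> let \<open>U k = (\<Sum>i=1..k. (k + 1 - i) * x i)\<close>. Every duplication started in a class
  \<open>i \<le> k\<close> lowers \<open>U k\<close> by one, so \<open>U k\<close> behaves like a queue with server rate \<open>lam * N\<close>. The arrival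
  rate of \<open>U (d - 1)\<close> is at most \<open>d * \<beta> * \<mu> * N\<close>, hence it has exponential moments uniformly in time.
  Applying the generator to \<open>w (x 0) * ((U k)\<^sup>2 + U k)\<close> for a bounded weight \<open>w\<close> shows that, at time
  scale \<open>N ^ (d - 1)\<close>, \<open>lam * N * U k\<close> and \<open>\<mu> * (k + 1) * U (k + 1)\<close> have the same weighted time average
  for \<open>k < d - 1\<close>, and that \<open>(1 - \<theta>) * U (d - 1)\<close> averages to \<open>\<theta>\<close>, the load
  \<open>\<theta> = d * (\<beta> - y) / \<rho>\<close> at \<open>y = x 0 / N\<close>. Chaining these relations turns the loss rate \<open>\<mu> * x 1\<close> into a
  function of \<open>y\<close>. In the coordinate \<open>q\<close> with \<open>q' = 1 - \<theta>\<close> the drift is a multiple of \<open>\<theta>\<close>, so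
  only the averages of \<open>q\<close> and \<open>q\<^sup>2\<close> are needed, and since \<open>\<theta>\<close> decreases in \<open>y\<close> the mean square distance
  to the solution does not grow.\<close>

section \<open>Expectations under a finite transition semigroup\<close>

text \<open>The obstacle is that the loss rate \<open>mu * x 1\<close> is not a function of
  \<open>x 0\<close>, and that \<open>U k\<close> averages to at most a multiple of
  \<open>1 / N ^ (d - 1 - k)\<close>: each level needs its own rescaling, and errors must be
  compared with these averages instead of being bounded pointwise. The quadratic is chosen because
  \<open>(U\<^sup>2 + U) / 2\<close> has increments \<open>U + 1\<close> upwards and
  \<open>- U\<close> downwards; the latter vanishes at \<open>U = 0\<close>, so the busy indicator
  of the server disappears and no stationary law of the fast classes has to be identified. The
  weight \<open>w (x 0)\<close> keeps the relations usable while \<open>x 0\<close> moves.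

  The last relation seems to require division by \<open>1 - \<theta>\<close>. Testing with
  \<open>g\<close> such that \<open>g' = v * (1 - \<theta>)\<close> avoids it; \<open>v = 1\<close>
  and \<open>v = 2 * q\<close> give the two moments. The rate in the limiting equation is
  \<open>mu\<close> times the product of the ratios \<open>mu * (k + 1) / lam\<close> for
  \<open>1 \<le> k \<le> d - 2\<close>.

  The condition \<open>d * \<beta> * \<mu> < lam\<close> says that the load is below one at
  \<open>y = 0\<close>. It is used as a negative drift for exponential moments, as strict
  monotonicity of the limiting equation, and as a positive lower bound on \<open>q'\<close>.\<close>

locale jump_semigroup =
  fixes S :: "'s set" and q :: "'s \<Rightarrow> 's \<Rightarrow> real" and P :: "real \<Rightarrow> 's \<Rightarrow> 's \<Rightarrow> real"
  assumes finite_S: "finite S" and semigroup: "transition_semigroup S q P"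
begin

definition E :: "'s \<Rightarrow> real \<Rightarrow> ('s \<Rightarrow> real) \<Rightarrow> real" where
  "E x t f = (\<Sum>y\<in>S. P t x y * f y)"

text \<open>The summand at \<open>y = x\<close> vanishes, so the diagonal of \<open>q\<close> does
  not enter; \<open>generator_sum\<close> matches this with the action of
  \<open>generator\<close>.\<close>

definition Q :: "('s \<Rightarrow> real) \<Rightarrow> 's \<Rightarrow> real" where
  "Q f x = (\<Sum>y\<in>S. q x y * (f y - f x))"

lemma P_nonneg: "0 \<le> t \<Longrightarrow> x \<in> S \<Longrightarrow> y \<in> S \<Longrightarrow> 0 \<le> P t x y"
  and P_sum: "0 \<le> t \<Longrightarrow> x \<in> S \<Longrightarrow> (\<Sum>y\<in>S. P t x y) = 1"
  and P_zero: "x \<in> S \<Longrightarrow> y \<in> S \<Longrightarrow> P 0 x y = of_bool (x = y)"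
  and P_add: "0 \<le> s \<Longrightarrow> 0 \<le> t \<Longrightarrow> x \<in> S \<Longrightarrow> y \<in> S \<Longrightarrow> P (s + t) x y = (\<Sum>z\<in>S. P s x z * P t z y)"
  and P_deriv0: "x \<in> S \<Longrightarrow> y \<in> S \<Longrightarrow>
    ((\<lambda>h. (P h x y - of_bool (x = y)) / h) \<longlongrightarrow> generator S q x y) (at_right 0)"
  using semigroup unfolding transition_semigroup_def by blast+

lemma P_le_1:
  assumes "0 \<le> t" "x \<in> S" "y \<in> S"
  shows "P t x y \<le> 1"
proof -
  have "P t x y \<le> (\<Sum>y\<in>S. P t x y)"
    using assms finite_S P_nonneg by (intro member_le_sum) auto
  then show ?thesis using P_sum assms by simp
qed

lemma generator_sum:
  assumes "x \<in> S"
  shows "(\<Sum>y\<in>S. generator S q x y * f y) = Q f x"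
proof -
  have "(\<Sum>y\<in>S. generator S q x y * f y)
      = generator S q x x * f x + (\<Sum>y\<in>S - {x}. generator S q x y * f y)"
    using assms finite_S by (simp add: sum.remove)
  also have "(\<Sum>y\<in>S - {x}. generator S q x y * f y) = (\<Sum>y\<in>S - {x}. q x y * f y)"
    by (intro sum.cong) (auto simp: generator_def)
  also have "generator S q x x * f x + \<dots> = (\<Sum>y\<in>S - {x}. q x y * (f y - f x))"
    by (simp add: generator_def sum_distrib_right right_diff_distrib sum_subtractf)
  also have "\<dots> = Q f x"
    unfolding Q_def using assms finite_S by (simp add: sum.remove)
  finally show ?thesis .
qed

lemma E_0:
  assumes "x \<in> S" shows "E x 0 f = f x"
proof -
  have "E x 0 f = (\<Sum>y\<in>S. if x = y then f y else 0)"
    unfolding E_def using assms by (intro sum.cong) (auto simp: P_zero)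
  then show ?thesis using assms finite_S by simp
qed

lemma E_add: "E x t (\<lambda>y. f y + g y) = E x t f + E x t g"
  by (simp add: E_def distrib_left sum.distrib)

lemma E_diff: "E x t (\<lambda>y. f y - g y) = E x t f - E x t g"
  by (simp add: E_def right_diff_distrib sum_subtractf)

lemma E_cmult: "E x t (\<lambda>y. c * f y) = c * E x t f"
  by (simp add: E_def sum_distrib_left mult.left_commute)

lemma E_const: "0 \<le> t \<Longrightarrow> x \<in> S \<Longrightarrow> E x t (\<lambda>y. c) = c"
  by (simp add: E_def P_sum flip: sum_distrib_right)

lemma E_cong: "(\<And>y. y \<in> S \<Longrightarrow> f y = g y) \<Longrightarrow> E x t f = E x t g"
  by (simp add: E_def)

lemma E_mono:
  assumes "0 \<le> t" "x \<in> S" "\<And>y. y \<in> S \<Longrightarrow> f y \<le> g y"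
  shows "E x t f \<le> E x t g"
  unfolding E_def using assms by (intro sum_mono mult_left_mono) (auto simp: P_nonneg)

lemma E_abs_le:
  assumes "0 \<le> t" "x \<in> S" "\<And>y. y \<in> S \<Longrightarrow> \<bar>f y\<bar> \<le> g y"
  shows "\<bar>E x t f\<bar> \<le> E x t g"
proof -
  have "E x t f \<le> E x t g" using assms by (intro E_mono) (auto simp: abs_le_iff)
  moreover have "E x t (\<lambda>y. (-1) * f y) \<le> E x t g"
    using assms by (intro E_mono) (auto simp: abs_le_iff)
  ultimately show ?thesis unfolding E_cmult by linarith
qed

section \<open>The forward equation\<close>

lemma P_increment:
  assumes "0 \<le> s" "0 \<le> h" "x \<in> S" "y \<in> S"
  shows "P (s + h) x y - P s x y = (\<Sum>z\<in>S. P s x z * (P h z y - of_bool (z = y)))"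
proof -
  have "P s x y = (\<Sum>z\<in>S. P s x z * of_bool (z = y))"
    using assms finite_S by (simp add: of_bool_def if_distrib cong: if_cong)
  then show ?thesis using assms by (simp add: P_add right_diff_distrib sum_subtractf)
qed

text \<open>Starting from the earlier of the two times treats left and right quotients alike, so the
  right derivative at \<open>0\<close> suffices. The price is the moving factor
  \<open>P (min s t)\<close>, which is why continuity comes before differentiability.\<close>

lemma P_diff_quotient:
  assumes "0 \<le> s" "0 \<le> t" "s \<noteq> t" "x \<in> S" "y \<in> S"
  shows "(P s x y - P t x y) / (s - t)
    = (\<Sum>z\<in>S. P (min s t) x z * ((P \<bar>s - t\<bar> z y - of_bool (z = y)) / \<bar>s - t\<bar>))"
proof (cases "s < t")
  case True
  then have "P t x y - P s x y = (\<Sum>z\<in>S. P s x z * (P (t - s) z y - of_bool (z = y)))"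
    using P_increment[of s "t - s" x y] assms by simp
  moreover have "(P s x y - P t x y) / (s - t) = (P t x y - P s x y) / (t - s)"
    by (metis minus_diff_eq minus_divide_divide)
  ultimately show ?thesis using True by (simp add: sum_divide_distrib)
next
  case False
  then have "P s x y - P t x y = (\<Sum>z\<in>S. P t x z * (P (s - t) z y - of_bool (z = y)))"
    using P_increment[of t "s - t" x y] assms by simp
  then show ?thesis using False assms by (simp add: sum_divide_distrib)
qed

lemma filterlim_abs_diff_at_right:
  fixes t :: real
  shows "filterlim (\<lambda>s. \<bar>s - t\<bar>) (at_right 0) (at t within A)"
proof -
  have "((\<lambda>s. \<bar>s - t\<bar>) \<longlongrightarrow> \<bar>t - t\<bar>) (at t within A)"
    by (intro tendsto_intros)
  moreover have "eventually (\<lambda>s. \<bar>s - t\<bar> \<in> {0<..}) (at t within A)"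
    by (auto simp: eventually_at_filter)
  ultimately show ?thesis by (simp add: filterlim_at)
qed

lemma P_difference_tendsto:
  assumes "x \<in> S" "y \<in> S"
  shows "((\<lambda>h. P h x y - of_bool (x = y)) \<longlongrightarrow> 0) (at_right 0)"
proof -
  have "((\<lambda>h. (P h x y - of_bool (x = y)) / h * h) \<longlongrightarrow> generator S q x y * 0) (at_right 0)"
    by (intro tendsto_mult P_deriv0 assms tendsto_ident_at)
  moreover have "eventually (\<lambda>h. (P h x y - of_bool (x = y)) / h * h = P h x y - of_bool (x = y))
      (at_right (0::real))"
    by (auto simp: eventually_at_filter)
  ultimately show ?thesis by (simp add: Lim_transform_eventually)
qed

lemma P_continuous:
  assumes "0 \<le> t" "x \<in> S" "y \<in> S"
  shows "((\<lambda>s. P s x y) \<longlongrightarrow> P t x y) (at t within {0..})"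
proof -
  have "((\<lambda>s. \<Sum>z\<in>S. \<bar>P \<bar>s - t\<bar> z y - of_bool (z = y)\<bar>) \<longlongrightarrow> (\<Sum>z\<in>S. \<bar>0\<bar>)) (at t within {0..})"
    by (intro tendsto_sum tendsto_rabs
      filterlim_compose[OF P_difference_tendsto filterlim_abs_diff_at_right] assms)
  then have lim: "((\<lambda>s. \<Sum>z\<in>S. \<bar>P \<bar>s - t\<bar> z y - of_bool (z = y)\<bar>) \<longlongrightarrow> 0) (at t within {0..})"
    by simp
  have le: "\<bar>P s x y - P t x y\<bar> \<le> (\<Sum>z\<in>S. \<bar>P \<bar>s - t\<bar> z y - of_bool (z = y)\<bar>)"
    if "0 \<le> s" "s \<noteq> t" for s
  proof -
    have "P s x y - P t x y = (s - t) * ((P s x y - P t x y) / (s - t))" using that by simp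
    also have "\<dots> = (s - t) *
        (\<Sum>z\<in>S. P (min s t) x z * ((P \<bar>s - t\<bar> z y - of_bool (z = y)) / \<bar>s - t\<bar>))"
      using P_diff_quotient[of s t x y] that assms by simp
    also have "\<bar>\<dots>\<bar> = \<bar>\<Sum>z\<in>S. P (min s t) x z * (P \<bar>s - t\<bar> z y - of_bool (z = y))\<bar>"
      using that by (simp add: abs_mult flip: sum_divide_distrib)
    also have "\<dots> \<le> (\<Sum>z\<in>S. \<bar>P (min s t) x z * (P \<bar>s - t\<bar> z y - of_bool (z = y))\<bar>)"
      by (rule sum_abs)
    also have "\<dots> \<le> (\<Sum>z\<in>S. \<bar>P \<bar>s - t\<bar> z y - of_bool (z = y)\<bar>)"
      using that assms P_nonneg[of "min s t" x] P_le_1[of "min s t" x]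
      by (intro sum_mono) (auto simp: abs_mult intro!: mult_left_le_one_le)
    finally show ?thesis .
  qed
  show ?thesis
  proof (rule LIM_zero_cancel, rule Lim_null_comparison[OF _ lim])
    show "\<forall>\<^sub>F s in at t within {0..}. norm (P s x y - P t x y)
        \<le> (\<Sum>z\<in>S. \<bar>P \<bar>s - t\<bar> z y - of_bool (z = y)\<bar>)"
      using le by (auto simp: eventually_at_filter)
  qed
qed

text \<open>Kolmogorov's forward equation: in the quotient of \<open>P_diff_quotient\<close> the
  first factor converges by continuity and the second by \<open>P_deriv0\<close>.\<close>

lemma P_has_derivative:
  assumes "0 \<le> t" "x \<in> S" "y \<in> S"
  shows "((\<lambda>s. P s x y) has_real_derivative (\<Sum>z\<in>S. P t x z * generator S q z y)) (at t within {0..})"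
  unfolding has_field_derivative_iff
proof (rule Lim_transform_eventually)
  have min: "((\<lambda>s. P (min s t) x z) \<longlongrightarrow> P t x z) (at t within {0..})" if "z \<in> S" for z
  proof (rule LIM_zero_cancel, rule Lim_null_comparison)
    show "\<forall>\<^sub>F s in at t within {0..}. norm (P (min s t) x z - P t x z) \<le> \<bar>P s x z - P t x z\<bar>"
      by (intro always_eventually) (auto simp: min_def)
    show "((\<lambda>s. \<bar>P s x z - P t x z\<bar>) \<longlongrightarrow> 0) (at t within {0..})"
      using P_continuous[OF assms(1,2) that] by (simp add: LIM_zero tendsto_rabs_zero)
  qed
  show "((\<lambda>s. \<Sum>z\<in>S. P (min s t) x z * ((P \<bar>s - t\<bar> z y - of_bool (z = y)) / \<bar>s - t\<bar>)) \<longlongrightarrow>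
      (\<Sum>z\<in>S. P t x z * generator S q z y)) (at t within {0..})"
    by (intro tendsto_sum tendsto_mult min
      filterlim_compose[OF P_deriv0 filterlim_abs_diff_at_right] assms)
  show "\<forall>\<^sub>F s in at t within {0..}.
      (\<Sum>z\<in>S. P (min s t) x z * ((P \<bar>s - t\<bar> z y - of_bool (z = y)) / \<bar>s - t\<bar>))
      = (P s x y - P t x y) / (s - t)"
    using P_diff_quotient[of _ t x y] assms by (auto simp: eventually_at_filter)
qed

lemma E_has_derivative:
  assumes "0 \<le> t" "x \<in> S"
  shows "((\<lambda>s. E x s f) has_real_derivative E x t (Q f)) (at t within {0..})"
proof -
  have "((\<lambda>s. E x s f) has_real_derivative
      (\<Sum>y\<in>S. (\<Sum>z\<in>S. P t x z * generator S q z y) * f y)) (at t within {0..})"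
    unfolding E_def by (intro DERIV_sum DERIV_cmult_right P_has_derivative assms)
  also have "(\<Sum>y\<in>S. (\<Sum>z\<in>S. P t x z * generator S q z y) * f y)
      = (\<Sum>z\<in>S. P t x z * (\<Sum>y\<in>S. generator S q z y * f y))"
    unfolding sum_distrib_left sum_distrib_right
    by (subst sum.swap) (simp add: mult.assoc)
  also have "\<dots> = E x t (Q f)"
    by (simp add: E_def generator_sum)
  finally show ?thesis .
qed

lemma continuous_on_E:
  assumes "x \<in> S"
  shows "continuous_on {0..} (\<lambda>s. E x s f)"
  using E_has_derivative[OF _ assms] DERIV_continuous continuous_on_eq_continuous_within
  by (metis (no_types, lifting) atLeast_iff)

section \<open>Accelerated time: time integrals and Dynkin's formula\<close>

lemma E_has_derivative_scaled:
  assumes "0 \<le> t" "x \<in> S" "0 \<le> c"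
  shows "((\<lambda>s. E x (c * s) f) has_real_derivative c * E x (c * t) (Q f)) (at t within {0..})"
proof -
  have "((\<lambda>s. E x s f) has_real_derivative E x (c * t) (Q f)) (at (c * t) within (\<lambda>s. c * s) ` {0..})"
    by (rule DERIV_subset[OF E_has_derivative]) (use assms in auto)
  moreover have "((\<lambda>s. c * s) has_real_derivative c) (at t within {0..})"
    by (auto intro!: derivative_eq_intros)
  ultimately show ?thesis
    using DERIV_image_chain by (fastforce simp: o_def mult.commute)
qed

definition I :: "'s \<Rightarrow> real \<Rightarrow> real \<Rightarrow> ('s \<Rightarrow> real) \<Rightarrow> real" where
  "I x c t f = integral {0..t} (\<lambda>s. E x (c * s) f)"

lemma continuous_on_E_scaled:
  assumes "x \<in> S" "0 \<le> c" "A \<subseteq> {0..}"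
  shows "continuous_on A (\<lambda>s. E x (c * s) f)"
proof -
  have "continuous_on A ((\<lambda>s. E x s f) \<circ> (\<lambda>s. c * s))"
    using assms
    by (intro continuous_on_compose continuous_on_subset[OF continuous_on_E]) (auto intro!: continuous_intros)
  then show ?thesis by (simp add: o_def)
qed

lemma I_integrable:
  assumes "x \<in> S" "0 \<le> c"
  shows "(\<lambda>s. E x (c * s) f) integrable_on {0..t}"
  by (intro integrable_continuous_interval continuous_on_E_scaled assms) auto

lemma I_add:
  assumes "x \<in> S" "0 \<le> c"
  shows "I x c t (\<lambda>y. f y + g y) = I x c t f + I x c t g"
  unfolding I_def E_add by (intro integral_add I_integrable assms)

lemma I_diff:
  assumes "x \<in> S" "0 \<le> c"
  shows "I x c t (\<lambda>y. f y - g y) = I x c t f - I x c t g"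
  unfolding I_def E_diff by (intro integral_diff I_integrable assms)

lemma I_cmult: "I x c t (\<lambda>y. a * f y) = a * I x c t f"
  unfolding I_def E_cmult by simp

lemma I_cong: "(\<And>y. y \<in> S \<Longrightarrow> f y = g y) \<Longrightarrow> I x c t f = I x c t g"
  unfolding I_def using E_cong by metis

lemma I_mono:
  assumes "x \<in> S" "0 \<le> c" "\<And>y. y \<in> S \<Longrightarrow> f y \<le> g y"
  shows "I x c t f \<le> I x c t g"
  unfolding I_def by (intro integral_le I_integrable E_mono assms) (use assms in auto)

lemma I_abs_le:
  assumes "x \<in> S" "0 \<le> c" "\<And>y. y \<in> S \<Longrightarrow> \<bar>f y\<bar> \<le> g y"
  shows "\<bar>I x c t f\<bar> \<le> I x c t g"
proof -
  have "I x c t f \<le> I x c t g" using assms by (intro I_mono) (auto simp: abs_le_iff)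
  moreover have "I x c t (\<lambda>y. (-1) * f y) \<le> I x c t g"
    using assms by (intro I_mono) (auto simp: abs_le_iff)
  ultimately show ?thesis unfolding I_cmult by linarith
qed

lemma I_le_of_E_le:
  assumes "x \<in> S" "0 \<le> c" "0 \<le> t" "\<And>s. 0 \<le> s \<Longrightarrow> E x s f \<le> C"
  shows "I x c t f \<le> t * C"
proof -
  have "I x c t f \<le> integral {0..t} (\<lambda>s. C)"
    unfolding I_def by (intro integral_le I_integrable) (use assms in auto)
  then show ?thesis using assms by simp
qed

lemma dynkin:
  assumes "x \<in> S" "0 \<le> c" "0 \<le> t"
  shows "c * I x c t (Q f) = E x (c * t) f - f x"
proof -
  have "((\<lambda>s. c * E x (c * s) (Q f)) has_integral E x (c * t) f - E x (c * 0) f) {0..t}"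
    using assms
    by (intro fundamental_theorem_of_calculus)
      (auto simp: has_real_derivative_iff_has_vector_derivative[symmetric]
        intro!: DERIV_subset[OF E_has_derivative_scaled])
  then show ?thesis using assms by (simp add: I_def E_0 integral_unique flip: integral_mult_right)
qed

lemma I_has_derivative:
  assumes "x \<in> S" "0 \<le> c" "0 < t"
  shows "((\<lambda>s. I x c s f) has_real_derivative E x (c * t) f) (at t)"
proof -
  have "((\<lambda>s. I x c s f) has_real_derivative E x (c * t) f) (at t within {0..t+1})"
    unfolding I_def using assms
    by (intro integral_has_real_derivative continuous_on_E_scaled) auto
  moreover have "at t within {0..t+1} = at t"
    using assms by (intro at_within_interior) (auto simp: interior_atLeastAtMost_real)
  ultimately show ?thesis by simp
qed

lemma continuous_on_I:
  assumes "x \<in> S" "0 \<le> c"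
  shows "continuous_on {0..t} (\<lambda>s. I x c s f)"
  unfolding I_def by (intro indefinite_integral_continuous_1 I_integrable assms)

end

section \<open>The generator on weighted sums\<close>

definition weighted_sum :: "nat \<Rightarrow> (nat \<Rightarrow> nat) \<Rightarrow> nat" where
  "weighted_sum k x = (\<Sum>i=1..k. (k + 1 - i) * x i)"

text \<open>A loss in class \<open>j\<close> with \<open>2 \<le> j \<le> k + 1\<close> moves a copy
  to a class whose weight in \<open>weighted_sum k\<close> is larger by one, so
  \<open>mu * loss_sum k\<close> is the arrival rate of that queue. Class 1 is left out because its
  losses remove weight.\<close>

definition loss_sum :: "nat \<Rightarrow> (nat \<Rightarrow> nat) \<Rightarrow> nat" where
  "loss_sum k x = (\<Sum>j=2..k+1. j * x j)"

lemma sum_move: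
  fixes c :: "nat \<Rightarrow> real"
  assumes "k \<noteq> j" "k \<le> d" "j \<le> d" "0 < x k"
  shows "(\<Sum>i\<le>d. c i * real (move k j x i)) = (\<Sum>i\<le>d. c i * real (x i)) - c k + c j"
proof -
  have "(\<Sum>i\<le>d. c i * real (move k j x i))
      = (\<Sum>i\<le>d. c i * real (x i) - (if i = k then c i else 0) + (if i = j then c i else 0))"
    using assms by (intro sum.cong) (auto simp: move_def of_nat_diff algebra_simps)
  then show ?thesis using assms by (simp add: sum.distrib sum_subtractf)
qed

lemma move_in_states:
  assumes "x \<in> states d n" "k \<noteq> j" "k \<le> d" "j \<le> d" "0 < x k"
  shows "move k j x \<in> states d n"
proof -
  have "real (\<Sum>i\<le>d. move k j x i) = real n"
    using sum_move[where x=x, OF assms(2-5), of "\<lambda>_. 1"] assms(1)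
    by (simp add: states_def flip: of_nat_sum)
  moreover have "\<forall>i>d. move k j x i = 0"
    using assms unfolding states_def by (auto simp: move_def)
  ultimately show ?thesis unfolding states_def of_nat_eq_iff by blast
qed

lemma real_weighted_sum:
  assumes "k \<le> d"
  shows "real (weighted_sum k x) = (\<Sum>i\<le>d. (if i \<in> {1..k} then real (k + 1 - i) else 0) * real (x i))"
proof -
  have "(\<Sum>i\<le>d. (if i \<in> {1..k} then real (k + 1 - i) else 0) * real (x i))
     = (\<Sum>i\<in>{1..k}. real (k + 1 - i) * real (x i))"
    using assms by (intro sum.mono_neutral_cong_right) auto
  then show ?thesis by (simp add: weighted_sum_def)
qed

lemma weighted_sum_move:
  assumes "k \<le> d" "i \<noteq> j" "i \<le> d" "j \<le> d" "0 < x i"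
  shows "real (weighted_sum k (move i j x)) = real (weighted_sum k x)
     - (if i \<in> {1..k} then real (k + 1 - i) else 0) + (if j \<in> {1..k} then real (k + 1 - j) else 0)"
  unfolding real_weighted_sum[OF assms(1)] by (rule sum_move[where x=x, OF assms(2-5)])

lemma weighted_sum_pos_iff: "0 < weighted_sum k x \<longleftrightarrow> (\<exists>i\<in>{1..k}. 0 < x i)"
proof -
  have "weighted_sum k x = 0 \<longleftrightarrow> (\<forall>i\<in>{1..k}. x i = 0)"
    unfolding weighted_sum_def by (auto simp: sum_eq_0_iff)
  then show ?thesis by auto
qed

text \<open>At most one class is the first nonempty one, and there is one as soon as some class is
  nonempty. This merges the separate duplication clocks into a single server.\<close>

lemma sum_first_nonempty:
  fixes x :: "nat \<Rightarrow> nat"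
  shows "(\<Sum>j=1..k. of_bool (0 < x j \<and> (\<forall>i\<in>{1..<j}. x i = 0)) :: real)
    = of_bool (\<exists>i\<in>{1..k}. 0 < x i)"
proof (induction k)
  case (Suc k)
  have "{1..Suc k} = insert (Suc k) {1..k}" "{1..<Suc k} = {1..k}" by auto
  then show ?case using Suc by auto
qed simp

lemma weighted_sum_mono:
  assumes "k \<le> l" shows "weighted_sum k x \<le> weighted_sum l x"
  unfolding weighted_sum_def using assms
  by (intro order.trans[OF sum_mono sum_mono2[of "{1..l}" "{1..k}" "\<lambda>i. (l + 1 - i) * x i"]])
    (auto intro!: mult_right_mono)

lemma weighted_sum_1: "weighted_sum 1 x = x 1"
  by (simp add: weighted_sum_def)

lemma first_le_weighted_sum: "1 \<le> k \<Longrightarrow> k * x 1 \<le> weighted_sum k x"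
  unfolding weighted_sum_def using member_le_sum[of 1 "{1..k}" "\<lambda>i. (k + 1 - i) * x i"] by simp

lemma loss_sum_le: "loss_sum k x \<le> (k + 1) * weighted_sum (k + 1) x"
proof -
  have "loss_sum k x \<le> (\<Sum>j=2..k+1. (k + 1) * ((k + 2 - j) * x j))"
    unfolding loss_sum_def
  proof (intro sum_mono)
    fix j assume j: "j \<in> {2..k+1}"
    have "j * x j \<le> (k + 1) * (1 * x j)" using j by (intro mult_le_mono) auto
    also have "\<dots> \<le> (k + 1) * ((k + 2 - j) * x j)"
      using j by (intro mult_le_mono2 mult_le_mono1) auto
    finally show "j * x j \<le> (k + 1) * ((k + 2 - j) * x j)" .
  qed
  also have "\<dots> \<le> (\<Sum>j=1..k+1. (k + 1) * ((k + 2 - j) * x j))"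
    by (intro sum_mono2) auto
  also have "\<dots> = (k + 1) * weighted_sum (k + 1) x"
    unfolding weighted_sum_def sum_distrib_left by (intro sum.cong) auto
  finally show ?thesis .
qed

text \<open>Class \<open>k + 1\<close> has the factor \<open>k + 1\<close> on both sides; in the
  lower classes \<open>k + 2 - j \<le> (k + 2) * (k + 1 - j)\<close>, which is paid by
  \<open>weighted_sum k\<close>. Together with \<open>loss_sum_le\<close>, arrivals at level
  \<open>k\<close> are thus level \<open>k + 1\<close> up to a multiple of level
  \<open>k\<close>.\<close>

lemma weighted_sum_le_loss_sum:
  assumes "1 \<le> k"
  shows "(k + 1) * weighted_sum (k + 1) x \<le> loss_sum k x + (k + 1) * (k + 2) * weighted_sum k x"
proof -
  have split: "{1..k+1} = insert (k + 1) {1..k}" by auto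
  have "(k + 1) * weighted_sum (k + 1) x
      = (k + 1) * x (k + 1) + (\<Sum>j=1..k. (k + 1) * ((k + 2 - j) * x j))"
    unfolding weighted_sum_def split by (simp add: sum_distrib_left distrib_left)
  also have "(\<Sum>j=1..k. (k + 1) * ((k + 2 - j) * x j))
      \<le> (\<Sum>j=1..k. (k + 1) * (k + 2) * ((k + 1 - j) * x j))"
  proof (intro sum_mono)
    fix j assume j: "j \<in> {1..k}"
    then have "(k + 2 - j) \<le> (k + 2) * (k + 1 - j)"
      by (metis Suc_diff_le Suc_leI add_2_eq_Suc' atLeastAtMost_iff diff_le_self
        le_trans mult.commute mult_le_mono1 mult_1 zero_less_diff Suc_eq_plus1 less_Suc_eq_le One_nat_def)
    then have "(k + 1) * ((k + 2 - j) * x j) \<le> (k + 1) * ((k + 2) * (k + 1 - j) * x j)"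
      by (intro mult_le_mono) auto
    then show "(k + 1) * ((k + 2 - j) * x j) \<le> (k + 1) * (k + 2) * ((k + 1 - j) * x j)"
      by (simp only: mult.assoc)
  qed
  also have "\<dots> = (k + 1) * (k + 2) * weighted_sum k x"
    by (simp add: weighted_sum_def sum_distrib_left)
  also have "(k + 1) * x (k + 1) \<le> loss_sum k x"
    unfolding loss_sum_def using assms
    by (intro member_le_sum[of "k + 1" "{2..k+1}" "\<lambda>j. j * x j"]) auto
  finally show ?thesis by linarith
qed

lemma state_0_le:
  assumes "x \<in> states d n" shows "x 0 \<le> n"
  using assms member_le_sum[of 0 "{..d}" x] by (auto simp: states_def)

text \<open>A copy in class \<open>i \<ge> 1\<close> is counted \<open>i + (d - i) = d\<close>
  times. This closes the hierarchy: at the top level the arrival rate depends on \<open>x 0\<close>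
  alone, up to \<open>weighted_sum (d - 1)\<close> and \<open>x 1\<close>.\<close>

lemma loss_sum_balance:
  assumes "x \<in> states d n" "2 \<le> d"
  shows "loss_sum (d - 1) x + weighted_sum (d - 1) x + x 1 = d * (n - x 0)"
proof -
  have d: "d - 1 + 1 = d" using assms by simp
  have "{..d} = insert 0 {1..d}" by auto
  then have "(\<Sum>i=1..d. x i) = n - x 0"
    using assms(1) by (auto simp: states_def)
  then have "d * (n - x 0) = (\<Sum>i=1..d. d * x i)" by (simp only: sum_distrib_left flip: sum_distrib_left)
  also have "\<dots> = (\<Sum>i=1..d. i * x i + (d - i) * x i)"
    by (intro sum.cong) (auto simp flip: distrib_right)
  also have "\<dots> = (\<Sum>i=1..d. i * x i) + (\<Sum>i=1..d. (d - i) * x i)"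
    by (rule sum.distrib)
  also have "(\<Sum>i=1..d. (d - i) * x i) = (\<Sum>i=1..d-1. (d - i) * x i)"
    by (intro sum.mono_neutral_right) auto
  also have "\<dots> = weighted_sum (d - 1) x"
    unfolding weighted_sum_def d ..
  also have "(\<Sum>i=1..d. i * x i) = x 1 + loss_sum (d - 1) x"
  proof -
    have "{1..d} = insert 1 {2..d}" using assms by auto
    then show ?thesis unfolding loss_sum_def d by simp
  qed
  finally show ?thesis by simp
qed

locale storage = jump_semigroup "states d n" "jump_rate lam mu d N" P
  for lam mu :: real and d n N :: nat and P +
  assumes lam_pos: "0 < lam" and mu_pos: "0 < mu" and d_ge: "2 \<le> d" and N_pos: "1 \<le> N"
begin

abbreviation "S \<equiv> states d n"

text \<open>The alternative \<open>r = 0\<close> covers a move out of an empty class: truncated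
  subtraction takes its target out of the state space, but its rate is zero.\<close>

lemma sum_point_mass:
  assumes "finite A" "y \<in> A \<or> r = 0"
  shows "(\<Sum>w\<in>A. (if w = y then r else 0) * g w) = r * (g y :: real)"
proof -
  have "(\<Sum>w\<in>A. (if w = y then r else 0) * g w) = (\<Sum>w\<in>A. if w = y then r * g w else 0)"
    by (intro sum.cong) auto
  then show ?thesis using assms by auto
qed

lemma Q_eq_sum_moves:
  assumes x: "x \<in> S"
  shows "Q f x = (\<Sum>k=1..d. mu * real k * real (x k) * (f (move k (k - 1) x) - f x))
    + (\<Sum>k\<in>{1..<d}. (if 0 < x k \<and> (\<forall>i\<in>{1..<k}. x i = 0) then lam * real N else 0)
         * (f (move k (k + 1) x) - f x))"
proof -
  have "Q f x = (\<Sum>k=1..d. \<Sum>y\<in>S. (if y = move k (k - 1) x then mu * real k * real (x k) else 0) * (f y - f x))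
    + (\<Sum>k\<in>{1..<d}. \<Sum>y\<in>S. (if y = move k (k + 1) x then
          (if 0 < x k \<and> (\<forall>i\<in>{1..<k}. x i = 0) then lam * real N else 0) else 0) * (f y - f x))"
    unfolding Q_def jump_rate_def
    unfolding distrib_right sum_distrib_right sum.distrib
    by (intro arg_cong2[where f="(+)"]) (subst sum.swap, intro sum.cong refl, simp)+
  also have "(\<Sum>k=1..d. \<Sum>y\<in>S. (if y = move k (k - 1) x then mu * real k * real (x k) else 0) * (f y - f x))
     = (\<Sum>k=1..d. mu * real k * real (x k) * (f (move k (k - 1) x) - f x))"
    using x finite_S by (intro sum.cong refl sum_point_mass) (auto intro!: move_in_states)
  also have "(\<Sum>k\<in>{1..<d}. \<Sum>y\<in>S. (if y = move k (k + 1) x then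
          (if 0 < x k \<and> (\<forall>i\<in>{1..<k}. x i = 0) then lam * real N else 0) else 0) * (f y - f x))
     = (\<Sum>k\<in>{1..<d}. (if 0 < x k \<and> (\<forall>i\<in>{1..<k}. x i = 0) then lam * real N else 0)
         * (f (move k (k + 1) x) - f x))"
    using x finite_S by (intro sum.cong refl sum_point_mass) (auto intro!: move_in_states)
  finally show ?thesis .
qed

text \<open>The weights in \<open>weighted_sum k\<close> are chosen so that every duplication seen by \<open>weighted_sum k\<close>
  lowers it by one: the pair formed by it and \<open>x 0\<close> sees a single server of rate \<open>lam * N\<close>, busy
  exactly when \<open>weighted_sum k\<close> is positive.\<close>

lemma Q_weighted_sum:
  assumes x: "x \<in> S" and k: "1 \<le> k" "k \<le> d - 1"
  defines "u \<equiv> real (weighted_sum k x)"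
  shows "Q (\<lambda>x. \<phi> (x 0) (real (weighted_sum k x))) x =
    mu * real (x 1) * (\<phi> (x 0 + 1) (u - real k) - \<phi> (x 0) u)
    + mu * real (loss_sum k x) * (\<phi> (x 0) (u + 1) - \<phi> (x 0) u)
    + lam * real N * of_bool (0 < weighted_sum k x) * (\<phi> (x 0) (u - 1) - \<phi> (x 0) u)"
proof -
  let ?f = "\<lambda>x. \<phi> (x 0) (real (weighted_sum k x))"
  have kd: "k \<le> d" using k by simp
  \<comment> \<open>A loss in class 1 raises \<open>x 0\<close> and removes weight \<open>k\<close>;
    in classes \<open>2\<close> to \<open>k + 1\<close> it adds one unit, class \<open>k + 1\<close>
    itself having weight zero; higher classes are not seen.\<close>
  have loss: "mu * real j * real (x j) * (?f (move j (j - 1) x) - ?f x)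
    = (if j = 1 then mu * real (x 1) * (\<phi> (x 0 + 1) (u - real k) - \<phi> (x 0) u)
       else if j \<le> k + 1 then mu * real (j * x j) * (\<phi> (x 0) (u + 1) - \<phi> (x 0) u) else 0)"
    if j: "j \<in> {1..d}" for j
  proof (cases "x j = 0")
    case False
    then have "real (weighted_sum k (move j (j - 1) x)) = u
        - (if j \<in> {1..k} then real (k + 1 - j) else 0)
        + (if j - 1 \<in> {1..k} then real (k + 1 - (j - 1)) else 0)"
      unfolding u_def using j by (intro weighted_sum_move[OF kd]) auto
    then have "real (weighted_sum k (move j (j - 1) x)) =
      (if j = 1 then u - real k else if j \<le> k + 1 then u + 1 else u)"
      using j k by (auto simp: of_nat_diff)
    moreover have "move j (j - 1) x 0 = (if j = 1 then x 0 + 1 else x 0)"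
      using j by (auto simp: move_def)
    ultimately show ?thesis by (auto simp: u_def)
  qed auto
  have dup: "(if 0 < x j \<and> (\<forall>i\<in>{1..<j}. x i = 0) then lam * real N else 0)
         * (?f (move j (j + 1) x) - ?f x)
     = (if j \<le> k then of_bool (0 < x j \<and> (\<forall>i\<in>{1..<j}. x i = 0))
         * (lam * real N * (\<phi> (x 0) (u - 1) - \<phi> (x 0) u)) else 0)"
    if j: "j \<in> {1..<d}" for j
  proof (cases "x j = 0")
    case False
    then have "real (weighted_sum k (move j (j + 1) x)) = (if j \<le> k then u - 1 else u)"
      using weighted_sum_move[OF kd, of j "j + 1" x] j k unfolding u_def
      by (auto simp: of_nat_diff)
    moreover have "move j (j + 1) x 0 = x 0"
      using j by (auto simp: move_def)
    ultimately show ?thesis by (auto simp: u_def)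
  qed auto
  have "(\<Sum>j=1..d. mu * real j * real (x j) * (?f (move j (j - 1) x) - ?f x))
     = (\<Sum>j\<in>insert 1 {2..d}.
       (if j = 1 then mu * real (x 1) * (\<phi> (x 0 + 1) (u - real k) - \<phi> (x 0) u)
       else if j \<le> k + 1 then mu * real (j * x j) * (\<phi> (x 0) (u + 1) - \<phi> (x 0) u) else 0))"
    using d_ge by (intro sum.cong loss) auto
  also have "\<dots> = mu * real (x 1) * (\<phi> (x 0 + 1) (u - real k) - \<phi> (x 0) u)
      + (\<Sum>j=2..d. if j \<le> k + 1 then mu * real (j * x j) * (\<phi> (x 0) (u + 1) - \<phi> (x 0) u) else 0)"
    by (auto intro!: sum.cong)
  also have "(\<Sum>j=2..d. if j \<le> k + 1 then mu * real (j * x j) * (\<phi> (x 0) (u + 1) - \<phi> (x 0) u) else 0)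
     = (\<Sum>j=2..k+1. mu * real (j * x j) * (\<phi> (x 0) (u + 1) - \<phi> (x 0) u))"
    using k by (intro sum.mono_neutral_cong_right) auto
  also have "\<dots> = mu * real (loss_sum k x) * (\<phi> (x 0) (u + 1) - \<phi> (x 0) u)"
    unfolding loss_sum_def of_nat_sum sum_distrib_left sum_distrib_right ..
  finally have L: "(\<Sum>j=1..d. mu * real j * real (x j) * (?f (move j (j - 1) x) - ?f x))
     = mu * real (x 1) * (\<phi> (x 0 + 1) (u - real k) - \<phi> (x 0) u)
      + mu * real (loss_sum k x) * (\<phi> (x 0) (u + 1) - \<phi> (x 0) u)" .
  have "(\<Sum>j\<in>{1..<d}. (if 0 < x j \<and> (\<forall>i\<in>{1..<j}. x i = 0) then lam * real N else 0)
         * (?f (move j (j + 1) x) - ?f x))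
     = (\<Sum>j=1..k. of_bool (0 < x j \<and> (\<forall>i\<in>{1..<j}. x i = 0))
         * (lam * real N * (\<phi> (x 0) (u - 1) - \<phi> (x 0) u)))"
  proof (intro sum.mono_neutral_cong_right ballI)
    fix j assume "j \<in> {1..<d} - {1..k}"
    then show "(if 0 < x j \<and> (\<forall>i\<in>{1..<j}. x i = 0) then lam * real N else 0)
         * (?f (move j (j + 1) x) - ?f x) = 0"
      using dup[of j] by simp
  next
    fix j assume "j \<in> {1..k}"
    then have j: "j \<in> {1..<d}" "j \<le> k" using k d_ge by auto
    show "(if 0 < x j \<and> (\<forall>i\<in>{1..<j}. x i = 0) then lam * real N else 0)
         * (?f (move j (j + 1) x) - ?f x)
       = of_bool (0 < x j \<and> (\<forall>i\<in>{1..<j}. x i = 0))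
         * (lam * real N * (\<phi> (x 0) (u - 1) - \<phi> (x 0) u))"
      by (simp only: dup[OF j(1)] j(2) if_True)
  qed (use k in auto)
  also have "\<dots> = lam * real N * of_bool (0 < weighted_sum k x) * (\<phi> (x 0) (u - 1) - \<phi> (x 0) u)"
    unfolding sum_distrib_right[symmetric] sum_first_nonempty weighted_sum_pos_iff by simp
  finally show ?thesis unfolding Q_eq_sum_moves[OF x] L by simp
qed

end

section \<open>Moment bounds\<close>

text \<open>With the integrating factor, \<open>(m t - M) * exp (a * t)\<close> is nonincreasing, so
  \<open>M\<close> is a barrier that \<open>m\<close> cannot cross.\<close>

lemma gronwall_le:
  fixes m m' :: "real \<Rightarrow> real"
  assumes deriv: "\<And>t. 0 \<le> t \<Longrightarrow> (m has_real_derivative m' t) (at t within {0..})"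
    and le: "\<And>t. 0 \<le> t \<Longrightarrow> m' t \<le> a * (M - m t)"
    and init: "m 0 \<le> M" and t: "0 \<le> t"
  shows "m t \<le> M"
proof (cases "t = 0")
  case False
  let ?h = "\<lambda>t. (m t - M) * exp (a * t)"
  have dh: "(?h has_real_derivative (m' s + a * (m s - M)) * exp (a * s)) (at s within {0..})"
    if "0 \<le> s" for s
    using that by (auto intro!: derivative_eq_intros deriv simp: algebra_simps)
  have "?h t \<le> ?h 0"
  proof (rule DERIV_nonpos_imp_decreasing_open[where f = ?h and a = 0 and b = t])
    fix s assume s: "0 < s" "s < t"
    have "at s within {0..} = at s"
      using s by (intro at_within_interior) simp
    moreover have "(m' s + a * (m s - M)) * exp (a * s) \<le> 0"
      using le[of s] s by (intro mult_nonpos_nonneg) (auto simp: algebra_simps)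
    ultimately show "\<exists>y. (?h has_real_derivative y) (at s) \<and> y \<le> 0"
      using dh[of s] s by auto
  next
    have "continuous_on {0..} ?h"
      by (rule DERIV_continuous_on, rule dh) simp
    then show "continuous_on {0..t} ?h"
      by (rule continuous_on_subset) auto
  qed (use t in auto)
  then have "(m t - M) * exp (a * t) \<le> 0" using init by simp
  then show ?thesis by (simp add: mult_le_0_iff)
qed (use init in simp)

text \<open>Apply \<open>(1 + v / m) ^ m \<le> exp v\<close> to \<open>v = (1 + u) * ln z\<close>.
  One exponential moment then controls all polynomial ones.\<close>

lemma power_le_const_powr:
  fixes z u :: real
  assumes "1 < z" "0 \<le> u"
  shows "(1 + u) ^ m \<le> (real m / ln z) ^ m * z * z powr u"
proof (cases "m = 0")
  case True
  have "1 * 1 \<le> z * z powr u" using assms by (intro mult_mono ge_one_powr_ge_zero) auto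
  then show ?thesis using True by simp
next
  case False
  let ?v = "(1 + u) * ln z"
  have v: "0 \<le> ?v" using assms by simp
  have "(?v / real m) ^ m \<le> (1 + ?v / real m) ^ m"
    using v by (intro power_mono) auto
  also have "\<dots> \<le> exp ?v"
    using v False by (intro exp_ge_one_plus_x_over_n_power_n) auto
  also have "\<dots> = z * z powr u"
    using assms by (simp add: powr_def distrib_right exp_add)
  finally have "(real m / ln z) ^ m * (?v / real m) ^ m \<le> (real m / ln z) ^ m * (z * z powr u)"
    using assms by (intro mult_left_mono) auto
  moreover have "(real m / ln z) ^ m * (?v / real m) ^ m = (1 + u) ^ m"
    unfolding power_mult_distrib[symmetric] using assms False by simp
  ultimately show ?thesis by (simp add: mult.assoc)
qed

context storage
begin

lemma initial_state: "(\<lambda>i. if i = d then n else 0) \<in> S"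
  by (simp add: states_def)

abbreviation "x\<^sub>0 \<equiv> (\<lambda>i. if i = d then n else 0)"
abbreviation "EE \<equiv> E x\<^sub>0"
abbreviation "II \<equiv> I x\<^sub>0 (real N ^ (d - 1))"
abbreviation "W \<equiv> weighted_sum (d - 1)"

text \<open>The scaling makes every level of order one in time average, see \<open>I_u_le\<close>;
  at the top, \<open>u (d - 1)\<close> is \<open>W\<close>.\<close>

definition u :: "nat \<Rightarrow> (nat \<Rightarrow> nat) \<Rightarrow> real" where
  "u k x = real N ^ (d - 1 - k) * real (weighted_sum k x)"

lemma weighted_sum_initial: "k \<le> d - 1 \<Longrightarrow> weighted_sum k x\<^sub>0 = 0"
  using d_ge unfolding weighted_sum_def by (intro sum.neutral) auto

lemma Q_state_0:
  assumes "x \<in> S"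
  shows "Q (\<lambda>x. g (x 0)) x = mu * real (x 1) * (g (x 0 + 1) - g (x 0))"
  using Q_weighted_sum[OF assms, of 1 "\<lambda>n u. g n"] d_ge by simp

text \<open>Losses only raise \<open>y 0\<close>, so the indicator of \<open>y 0 < m\<close> has a
  nonpositive generator, and by Dynkin's formula its expectation stays at its initial value
  \<open>0\<close>. Monotone paths are derived from this.\<close>

lemma E_state_0_less:
  assumes "x \<in> S" "0 \<le> t" "m \<le> x 0"
  shows "E x t (\<lambda>y. of_bool (y 0 < m)) = 0"
proof -
  have "1 * I x 1 t (Q (\<lambda>y. of_bool (y 0 < m))) = E x (1 * t) (\<lambda>y. of_bool (y 0 < m)) - of_bool (x 0 < m)"
    using assms by (intro dynkin) auto
  \<comment> \<open>The zero function is written \<open>0 * 0\<close> so that \<open>I_cmult\<close>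
    and \<open>E_cmult\<close> can evaluate it.\<close>
  moreover have "I x 1 t (Q (\<lambda>y. of_bool (y 0 < m))) \<le> I x 1 t (\<lambda>y. 0 * 0)"
  proof (intro I_mono)
    fix y assume y: "y \<in> S"
    have "Q (\<lambda>y. of_bool (y 0 < m)) y
        = mu * real (y 1) * (of_bool (y 0 + 1 < m) - of_bool (y 0 < m))"
      by (rule Q_state_0[OF y])
    also have "\<dots> \<le> 0" using mu_pos by (auto simp: mult_le_0_iff)
    finally show "Q (\<lambda>y. of_bool (y 0 < m)) y \<le> 0 * 0" by simp
  qed (use assms in auto)
  moreover have "E x t (\<lambda>y. 0 * 0) \<le> E x t (\<lambda>y. of_bool (y 0 < m))"
    using assms by (intro E_mono) auto
  moreover have "I x 1 t (\<lambda>y. 0 * 0) = 0" "E x t (\<lambda>y. 0 * 0) = 0"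
    unfolding I_cmult E_cmult by auto
  ultimately show ?thesis using assms by simp
qed

lemma weighted_sum_le_W: "k \<le> d - 1 \<Longrightarrow> weighted_sum k x \<le> W x"
  by (rule weighted_sum_mono)

lemma W_le: "x \<in> S \<Longrightarrow> W x \<le> d * n"
proof -
  assume "x \<in> S"
  from loss_sum_balance[OF this d_ge] have "W x \<le> d * (n - x 0)" by simp
  also have "\<dots> \<le> d * n" by simp
  finally show ?thesis .
qed

lemma loss_sum_le_n:
  assumes "x \<in> S" shows "loss_sum (d - 1) x \<le> d * n"
proof -
  from loss_sum_balance[OF assms d_ge] have "loss_sum (d - 1) x \<le> d * (n - x 0)" by simp
  also have "\<dots> \<le> d * n" by simp
  finally show ?thesis .
qed

lemma first_le: "1 \<le> k \<Longrightarrow> x 1 \<le> weighted_sum k x"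
  using weighted_sum_mono[of 1 k x] weighted_sum_1[of x] by simp

lemma N_ge_1: "1 \<le> real N" and N_gt_0: "0 < real N" using N_pos by auto

lemma dynkin_II:
  assumes "0 \<le> t"
  shows "real N ^ (d - 1) * II t (Q f) = EE (real N ^ (d - 1) * t) f - f x\<^sub>0"
  using assms by (intro dynkin initial_state) auto

lemmas II_add = I_add[OF initial_state zero_le_power[OF of_nat_0_le_iff]]
  and II_diff = I_diff[OF initial_state zero_le_power[OF of_nat_0_le_iff]]
  and II_mono = I_mono[OF initial_state zero_le_power[OF of_nat_0_le_iff]]
  and II_abs_le = I_abs_le[OF initial_state zero_le_power[OF of_nat_0_le_iff]]

end

text \<open>\<open>b\<close> will lie slightly above \<beta>, as \<open>F N / N\<close> only tends
  to \<beta>; \<open>z\<close> is the base of the exponential moment, and \<open>stable\<close>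
  makes \<open>z powr W\<close> drift downwards.\<close>

locale stable_storage = storage lam mu d n N P for lam mu :: real and d n N :: nat and P +
  fixes b z :: real
  assumes n_le: "real n \<le> b * real N" and z_gt: "1 < z" and stable: "z * (mu * real d * b) < lam"
begin

text \<open>The value of \<open>z powr W\<close> at which the drift bound in
  \<open>E_powr_W_le\<close> changes sign.\<close>

definition "exp_moment_bound = lam / (lam - z * (mu * real d * b))"
definition "moment_bound m = (real m / ln z) ^ m * z * exp_moment_bound"
text \<open>The ratio of the geometric bounds in \<open>I_u_le\<close>: \<open>d * b\<close> pays
  for the end point in Dynkin's formula, the other two terms for the multiple of level
  \<open>k\<close> in the generator inequality.\<close>

definition "flow_bound = (real d * b + lam + 2 * mu * (real d)\<^sup>2) / mu"

lemma b_nonneg: "0 \<le> b"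
proof -
  have "0 \<le> b * real N" using n_le by (rule order.trans[rotated]) simp
  then show ?thesis using N_gt_0 by (simp add: zero_le_mult_iff)
qed

text \<open>A Foster-Lyapunov argument for a single-server queue: arrivals have rate at most
  \<open>mu * d * b * N\<close>, services have rate \<open>lam * N\<close>, and losses in class 1
  only lower \<open>W\<close>. The resulting bound depends neither on time nor on
  \<open>N\<close>.\<close>

lemma E_powr_W_le:
  assumes "0 \<le> t"
  shows "EE t (\<lambda>x. z powr real (W x)) \<le> exp_moment_bound"
proof -
  let ?r = "(z - 1) * (lam / z - mu * real d * b)"
  let ?f = "\<lambda>x. z powr real (W x)"
  have "mu * real d * b < lam / z" using z_gt stable by (simp add: pos_less_divide_eq mult_ac)
  then have r: "0 < ?r" using z_gt by simp
  have rM: "?r * exp_moment_bound = (1 - 1 / z) * lam"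
  proof -
    have "?r = (z - 1) * (lam - z * (mu * real d * b)) / z" using z_gt by (simp add: field_simps)
    then have "?r * exp_moment_bound = (z - 1) / z * lam" using stable by (simp add: exp_moment_bound_def)
    then show ?thesis using z_gt by (simp add: field_simps)
  qed
  have Qf: "Q ?f x \<le> real N * (?r * (exp_moment_bound - ?f x))" if x: "x \<in> S" for x
  proof -
    let ?u = "real (W x)"
    have "Q ?f x = mu * real (x 1) * (z powr (?u - real (d - 1)) - z powr ?u)
       + mu * real (loss_sum (d - 1) x) * (z powr (?u + 1) - z powr ?u)
       + lam * real N * of_bool (0 < W x) * (z powr (?u - 1) - z powr ?u)"
      using Q_weighted_sum[OF x, of "d - 1" "\<lambda>n u. z powr u"] d_ge by simp
    also have "mu * real (x 1) * (z powr (?u - real (d - 1)) - z powr ?u) \<le> 0"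
      using mu_pos z_gt by (intro mult_nonneg_nonpos) (auto intro!: powr_mono)
    also have "z powr (?u + 1) - z powr ?u = (z - 1) * z powr ?u"
      using z_gt by (simp add: powr_add algebra_simps)
    also have "mu * real (loss_sum (d - 1) x) * \<dots> \<le> mu * (real d * (b * real N)) * ((z - 1) * z powr ?u)"
    proof (intro mult_right_mono mult_left_mono)
      have "real (loss_sum (d - 1) x) \<le> real (d * n)"
        using loss_sum_le_n[OF x] of_nat_le_iff by blast
      also have "\<dots> \<le> real d * (b * real N)" using n_le by (auto intro!: mult_left_mono)
      finally show "real (loss_sum (d - 1) x) \<le> real d * (b * real N)" .
    qed (use mu_pos z_gt in auto)
    also have "lam * real N * of_bool (0 < W x) * (z powr (?u - 1) - z powr ?u)
       \<le> real N * ((1 - 1 / z) * lam) - real N * ((1 - 1 / z) * lam) * z powr ?u"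
    proof -
      have "z powr (?u - 1) - z powr ?u = - (1 - 1 / z) * z powr ?u"
        using z_gt by (simp add: powr_diff algebra_simps)
      moreover have "0 \<le> (1 - 1 / z) * lam * real N" using z_gt lam_pos by simp
      ultimately show ?thesis by (cases "W x = 0") (use z_gt in \<open>simp_all add: algebra_simps\<close>)
    qed
    finally have "Q ?f x \<le> mu * (real d * (b * real N)) * ((z - 1) * ?f x)
       + (real N * ((1 - 1 / z) * lam) - real N * ((1 - 1 / z) * lam) * ?f x)" by simp
    also have "\<dots> = real N * (?r * exp_moment_bound - ?r * ?f x)"
      unfolding rM using z_gt by (simp add: field_simps)
    finally show ?thesis by (simp add: right_diff_distrib)
  qed
  show ?thesis
  proof (rule gronwall_le[where m = "\<lambda>t. EE t ?f" and m' = "\<lambda>t. EE t (Q ?f)" and a = "real N * ?r"])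
    fix t :: real assume t: "0 \<le> t"
    show "((\<lambda>t. EE t ?f) has_real_derivative EE t (Q ?f)) (at t within {0..})"
      by (rule E_has_derivative[OF t initial_state])
    have "EE t (Q ?f) \<le> EE t (\<lambda>x. real N * (?r * (exp_moment_bound - ?f x)))"
      using Qf by (intro E_mono t initial_state)
    also have "\<dots> = real N * ?r * (exp_moment_bound - EE t ?f)"
      unfolding E_cmult E_diff E_const[OF t initial_state] by simp
    finally show "EE t (Q ?f) \<le> real N * ?r * (exp_moment_bound - EE t ?f)" .
  next
    have "EE 0 ?f = 1"
      using z_gt by (simp add: E_0[OF initial_state] weighted_sum_initial)
    moreover have "1 \<le> exp_moment_bound"
      using stable z_gt mu_pos b_nonneg by (simp add: exp_moment_bound_def divide_simps)
    ultimately show "EE 0 ?f \<le> exp_moment_bound" by simp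
  qed (rule assms)
qed

lemma exp_moment_bound_pos: "0 < exp_moment_bound" using stable lam_pos by (simp add: exp_moment_bound_def)

lemma moment_bound_nonneg: "0 \<le> moment_bound m"
  using exp_moment_bound_pos z_gt by (simp add: moment_bound_def)

lemma E_power_W_le:
  assumes "0 \<le> t"
  shows "EE t (\<lambda>x. (1 + real (W x)) ^ m) \<le> moment_bound m"
proof -
  have "EE t (\<lambda>x. (1 + real (W x)) ^ m) \<le> EE t (\<lambda>x. ((real m / ln z) ^ m * z) * z powr real (W x))"
    using assms z_gt by (intro E_mono initial_state power_le_const_powr) auto
  also have "\<dots> \<le> (real m / ln z) ^ m * z * exp_moment_bound"
    unfolding E_cmult using z_gt assms by (intro mult_left_mono E_powr_W_le) auto
  finally show ?thesis by (simp add: moment_bound_def)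
qed

lemma I_power_W_le:
  assumes "0 \<le> t" "t \<le> T"
  shows "II t (\<lambda>x. (1 + real (W x)) ^ m) \<le> T * moment_bound m"
proof -
  have "II t (\<lambda>x. (1 + real (W x)) ^ m) \<le> t * moment_bound m"
    using assms by (intro I_le_of_E_le E_power_W_le initial_state) auto
  also have "\<dots> \<le> T * moment_bound m" using assms moment_bound_nonneg by (intro mult_right_mono)
  finally show ?thesis .
qed

lemma flow_bound_ge_1: "1 \<le> flow_bound"
proof -
  have "mu * 1 \<le> real d * b + lam + 2 * mu * (real d)\<^sup>2"
  proof -
    have "1 \<le> (real d)\<^sup>2" using d_ge by simp
    then have "mu * 1 \<le> mu * (real d)\<^sup>2" using mu_pos by (intro mult_left_mono) auto
    moreover have "0 \<le> real d * b" using b_nonneg by simp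
    moreover have "0 \<le> mu * (real d)\<^sup>2" using mu_pos by simp
    ultimately show ?thesis using lam_pos by simp
  qed
  then show ?thesis using mu_pos by (simp add: flow_bound_def field_simps)
qed

text \<open>At level 1 the time integral of \<open>mu * x 1\<close> is the mean number of lost
  copies, at most \<open>n\<close>. For the induction step, the generator of
  \<open>weighted_sum k\<close> contains level \<open>k + 1\<close> as its arrival term, so Dynkin's
  formula bounds level \<open>k + 1\<close> by the end point and by \<open>N\<close> times level
  \<open>k\<close>.\<close>

lemma I_u_le:
  assumes "0 \<le> t" "1 \<le> k" "k \<le> d - 1"
  shows "II t (u k) \<le> flow_bound ^ k"
  using assms(2,3)
proof (induction k rule: nat_induct_at_least)
  case base
  let ?f = "\<lambda>x. real (x 0)"
  have "real N ^ (d - 1) * II t (Q ?f) = EE (real N ^ (d - 1) * t) ?f"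
    using dynkin_II[OF assms(1), of ?f] d_ge by simp
  also have "\<dots> \<le> EE (real N ^ (d - 1) * t) (\<lambda>x. real n)"
    using assms(1) state_0_le by (intro E_mono initial_state) auto
  also have "\<dots> \<le> b * real N" using n_le assms(1) by (simp add: E_const initial_state)
  finally have le: "real N ^ (d - 1) * II t (Q ?f) \<le> b * real N" .
  have "II t (Q ?f) = II t (\<lambda>x. mu * real (x 1))"
    using Q_state_0[of _ real] by (intro I_cong) simp
  also have "\<dots> = mu * II t (\<lambda>x. real (x 1))" by (rule I_cmult)
  finally have "real N * (mu * II t (u 1)) = real N ^ (d - 1) * II t (Q ?f)"
    using d_ge unfolding u_def weighted_sum_1 I_cmult
    by (simp flip: power_Suc add: power_eq_if)
  then have "mu * II t (u 1) \<le> b"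
    using le N_gt_0 by (metis mult.commute mult_le_cancel_left_pos)
  also have "b \<le> real d * b + lam + 2 * mu * (real d)\<^sup>2"
  proof -
    have "1 * b \<le> real d * b" using d_ge b_nonneg by (intro mult_right_mono) auto
    moreover have "0 \<le> mu * (real d)\<^sup>2" using mu_pos by simp
    ultimately show ?thesis using lam_pos by simp
  qed
  finally show ?case using mu_pos by (simp add: flow_bound_def field_simps)
next
  case (Suc k)
  let ?f = "\<lambda>x. real (weighted_sum k x)"
  let ?B = "lam + 2 * mu * (real d)\<^sup>2"
  define p where "p = d - 2 - k"
  have p: "d - 1 - k = Suc p" "d - 1 - Suc k = p" "d - 1 = p + (k + 1)"
    using Suc by (auto simp: p_def)
  have pw: "mu * real (weighted_sum (Suc k) x) \<le> Q ?f x + real N * ?B * ?f x" if x: "x \<in> S" for x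
  proof -
    have Q: "Q ?f x = mu * real (loss_sum k x) - mu * real (x 1) * real k
        - lam * real N * of_bool (0 < weighted_sum k x)"
      using Q_weighted_sum[OF x, of k "\<lambda>n u. u"] Suc by simp
    have "weighted_sum (Suc k) x \<le> (k + 1) * weighted_sum (k + 1) x" by simp
    also have "\<dots> \<le> loss_sum k x + (k + 1) * (k + 2) * weighted_sum k x"
      using Suc by (intro weighted_sum_le_loss_sum) auto
    also have "\<dots> \<le> loss_sum k x + d * d * weighted_sum k x"
      using Suc by (intro add_left_mono mult_le_mono) auto
    finally have 1: "mu * real (weighted_sum (Suc k) x) \<le> mu * (real (loss_sum k x) + (real d)\<^sup>2 * ?f x)"
      using mu_pos by (intro mult_left_mono) (auto simp: power2_eq_square simp flip: of_nat_mult of_nat_add)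
    have "x 1 * k \<le> weighted_sum k x"
      using first_le_weighted_sum[of k x] Suc by (simp add: mult.commute)
    then have "real (x 1) * real k \<le> ?f x" by (metis of_nat_le_iff of_nat_mult)
    also have "\<dots> \<le> (real d)\<^sup>2 * ?f x"
      using mult_right_mono[of 1 "(real d)\<^sup>2" "?f x"] d_ge by simp
    finally have 2: "mu * (real (x 1) * real k) \<le> mu * ((real d)\<^sup>2 * ?f x)"
      using mu_pos by (intro mult_left_mono) auto
    have 3: "lam * real N * of_bool (0 < weighted_sum k x) \<le> lam * real N * ?f x"
      using lam_pos by (intro mult_left_mono) auto
    have "1 * (mu * (real d)\<^sup>2 * ?f x) \<le> real N * (mu * (real d)\<^sup>2 * ?f x)"
      using N_ge_1 mu_pos by (intro mult_right_mono) auto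
    then show ?thesis using 1 2 3 unfolding Q by (simp add: algebra_simps)
  qed
  have Ef: "real N ^ (d - 1) * II t (Q ?f) = EE (real N ^ (d - 1) * t) ?f"
    using dynkin_II[OF assms(1), of ?f] Suc by (simp add: weighted_sum_initial)
  have "EE (real N ^ (d - 1) * t) (\<lambda>x. 0 * 0) \<le> EE (real N ^ (d - 1) * t) ?f"
    using assms(1) by (intro E_mono initial_state) auto
  then have "0 \<le> real N ^ (d - 1) * II t (Q ?f)" unfolding Ef E_cmult by simp
  \<comment> \<open>Nonnegativity allows the power \<open>N ^ (d - 1)\<close> to be lowered to
    \<open>N ^ Suc p\<close> below.\<close>
  then have I0: "0 \<le> II t (Q ?f)"
    using zero_less_power[OF N_gt_0, of "d - 1"] by (metis zero_le_mult_iff not_less)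
  have "EE (real N ^ (d - 1) * t) ?f \<le> EE (real N ^ (d - 1) * t) (\<lambda>x. real d * b * real N)"
  proof (intro E_mono initial_state)
    fix x assume x: "x \<in> S"
    have "weighted_sum k x \<le> d * n"
      using weighted_sum_le_W[of k x] W_le[OF x] Suc by simp
    then have "?f x \<le> real (d * n)" using of_nat_le_iff by blast
    also have "\<dots> \<le> real d * (b * real N)" using n_le by (auto intro!: mult_left_mono)
    finally show "?f x \<le> real d * b * real N" by simp
  qed (use assms in auto)
  also have "\<dots> = real d * b * real N" using assms(1) by (simp add: E_const initial_state)
  finally have "real N ^ (d - 1) * II t (Q ?f) \<le> real d * b * real N" unfolding Ef .
  moreover have "real N ^ (Suc p) * II t (Q ?f) \<le> real N ^ (d - 1) * II t (Q ?f)"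
    using N_ge_1 I0 p by (intro mult_right_mono power_increasing) auto
  ultimately have "real N * (real N ^ p * II t (Q ?f)) \<le> real N * (real d * b)"
    by (simp add: algebra_simps)
  then have db: "real N ^ p * II t (Q ?f) \<le> real d * b"
    using N_gt_0 by simp
  have "mu * II t (u (Suc k)) = real N ^ p * II t (\<lambda>x. mu * real (weighted_sum (Suc k) x))"
    unfolding u_def p I_cmult by simp
  also have "\<dots> \<le> real N ^ p * II t (\<lambda>x. Q ?f x + real N * ?B * ?f x)"
    by (intro mult_left_mono II_mono pw) auto
  also have "\<dots> = real N ^ p * II t (Q ?f) + ?B * II t (u k)"
    unfolding u_def p II_add I_cmult by (simp add: algebra_simps)
  also have "\<dots> \<le> real d * b + ?B * flow_bound ^ k"
    using Suc lam_pos mu_pos by (intro add_mono mult_left_mono db) auto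
  also have "\<dots> \<le> real d * b * flow_bound ^ k + ?B * flow_bound ^ k"
    using mult_left_mono[OF one_le_power[OF flow_bound_ge_1, of k], of "real d * b"] b_nonneg by simp
  also have "\<dots> = mu * flow_bound ^ Suc k"
  proof -
    have "mu * flow_bound = real d * b + ?B" using mu_pos by (simp add: flow_bound_def)
    then have "mu * flow_bound * flow_bound ^ k = (real d * b + ?B) * flow_bound ^ k" by simp
    then show ?thesis by (simp only: power_Suc mult.assoc distrib_right)
  qed
  finally show ?case using mu_pos by simp
qed

end

section \<open>Averaging through the classes\<close>

context stable_storage
begin

lemma inverse_N_le: "1 / real N \<le> 1 / sqrt (real N)"
proof -
  have "sqrt (real N) \<le> real N" using N_ge_1 by (intro real_le_lsqrt) (auto simp: power2_eq_square)
  then show ?thesis using N_gt_0 by (intro divide_left_mono) auto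
qed

text \<open>Either \<open>W\<close> is so small that \<open>(1 + W) ^ 3\<close> is beaten by \<open>sqrt N\<close>, or a high moment
  of \<open>W\<close> absorbs every power of \<open>N\<close>.\<close>

lemma I_cubic_weight_le:
  assumes t: "0 \<le> t" "t \<le> T"
    and v: "\<And>x. x \<in> S \<Longrightarrow> 0 \<le> v x" "\<And>x. x \<in> S \<Longrightarrow> v x \<le> 2 * real N ^ d * (1 + real (W x))"
  shows "II t (\<lambda>x. v x * (1 + real (W x)) ^ 3 / real N)
    \<le> (II t v + 2 * T * moment_bound (6 * d + 4)) / sqrt (real N)"
proof -
  have "II t (\<lambda>x. v x * (1 + real (W x)) ^ 3 / real N)
     \<le> II t (\<lambda>x. 1 / sqrt (real N) * v x + 2 / real N * (1 + real (W x)) ^ (6 * d + 4))"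
  proof (rule II_mono)
    fix x assume x: "x \<in> S"
    define y where "y = 1 + real (W x)"
    have y: "1 \<le> y" by (simp add: y_def)
    have v0: "0 \<le> v x" by (rule v(1)[OF x])
    have v1: "v x \<le> 2 * real N ^ d * y" using v(2)[OF x] by (simp add: y_def)
    show "v x * y ^ 3 / real N \<le> 1 / sqrt (real N) * v x + 2 / real N * y ^ (6 * d + 4)"
    proof (cases "y ^ 6 \<le> real N")
      case True
      then have "(y ^ 3)\<^sup>2 \<le> real N" by (simp flip: power_mult)
      then have "y ^ 3 \<le> sqrt (real N)" by (rule real_le_rsqrt)
      then have "v x * (y ^ 3 / real N) \<le> v x * (sqrt (real N) / real N)"
        using v0 by (intro mult_left_mono divide_right_mono) auto
      moreover have "sqrt (real N) / real N = 1 / sqrt (real N)"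
        using N_gt_0 by (simp add: real_div_sqrt field_simps)
      moreover have "0 \<le> 2 / real N * y ^ (6 * d + 4)" using y by simp
      ultimately show ?thesis by simp
    next
      case False
      \<comment> \<open>In the exponent \<open>6 * d + 4\<close>, \<open>6 * d\<close> comes from
        replacing \<open>N\<close> by \<open>y ^ 6\<close> and \<open>4\<close> from
        \<open>y * y ^ 3\<close>.\<close>
      then have "real N ^ d \<le> (y ^ 6) ^ d" by (intro power_mono) auto
      then have "2 * real N ^ d * y * y ^ 3 \<le> 2 * (y ^ 6) ^ d * y * y ^ 3"
        using y by (intro mult_right_mono mult_left_mono) auto
      also have "\<dots> = 2 * ((y ^ 6) ^ d * (y * y ^ 3))" by simp
      also have "y * y ^ 3 = y ^ 4" by (simp add: power_numeral_reduce)
      also have "(y ^ 6) ^ d * y ^ 4 = y ^ (6 * d + 4)" by (simp add: power_add power_mult)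
      finally have up: "2 * real N ^ d * y * y ^ 3 \<le> 2 * y ^ (6 * d + 4)" .
      have "v x * y ^ 3 \<le> 2 * real N ^ d * y * y ^ 3"
        using y by (intro mult_right_mono[OF v1]) auto
      then have "v x * y ^ 3 \<le> 2 * y ^ (6 * d + 4)" using up by linarith
      then have "v x * y ^ 3 / real N \<le> 2 * y ^ (6 * d + 4) / real N"
        by (intro divide_right_mono) auto
      moreover have "0 \<le> 1 / sqrt (real N) * v x" using v0 by simp
      ultimately show ?thesis by simp
    qed
  qed
  also have "\<dots> = 1 / sqrt (real N) * II t v
      + 2 * (1 / real N * II t (\<lambda>x. (1 + real (W x)) ^ (6 * d + 4)))"
    unfolding II_add I_cmult by simp
  also have "1 / real N * II t (\<lambda>x. (1 + real (W x)) ^ (6 * d + 4))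
      \<le> 1 / sqrt (real N) * (T * moment_bound (6 * d + 4))"
  proof -
    have "1 / real N * II t (\<lambda>x. (1 + real (W x)) ^ (6 * d + 4)) \<le> 1 / real N * (T * moment_bound (6 * d + 4))"
      using t by (intro mult_left_mono I_power_W_le) auto
    also have "\<dots> \<le> 1 / sqrt (real N) * (T * moment_bound (6 * d + 4))"
      using t moment_bound_nonneg by (intro mult_right_mono inverse_N_le mult_nonneg_nonneg) auto
    finally show ?thesis .
  qed
  finally show ?thesis by (simp add: add_divide_distrib)
qed

text \<open>By \<open>Q_weighted_sum\<close>, in the accelerated time scale the generator sends
  \<open>(weighted_sum k)\<^sup>2 + weighted_sum k\<close> to a combination of \<open>lam * u k\<close> and
  \<open>mu * (k + 1) * u (k + 1)\<close> up to negligible terms, with no indicator left. The corrector itself stays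
  small, so by Dynkin's formula the two have the same time average.\<close>

definition corrector :: "nat \<Rightarrow> (nat \<Rightarrow> real) \<Rightarrow> (nat \<Rightarrow> nat) \<Rightarrow> real" where
  "corrector k w x = w (x 0) * (((real (weighted_sum k x))\<^sup>2 + real (weighted_sum k x)) / 2)"

text \<open>It keeps \<open>x 0 + 1\<close> in the range where the weight \<open>w\<close> is
  bounded.\<close>

lemma first_pos_imp:
  assumes "x \<in> S" "0 < x 1" shows "x 0 + 1 \<le> n"
proof -
  have "(\<Sum>i\<in>{0, 1}. x i) \<le> (\<Sum>i\<le>d. x i)" using d_ge by (intro sum_mono2) auto
  then show ?thesis using assms by (simp add: states_def)
qed

text \<open>After arrivals and services have been evaluated exactly, only the losses in class 1
  remain. They change \<open>x 0\<close> and \<open>weighted_sum k\<close> together, so the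
  difference of weights is not exploited and \<open>w\<close> is bounded by \<open>K\<close> at both
  points.\<close>

lemma Q_corrector:
  assumes x: "x \<in> S" and k: "1 \<le> k" "k \<le> d - 1"
    and w: "\<And>i. i \<le> n \<Longrightarrow> \<bar>w i\<bar> \<le> K"
  shows "\<bar>Q (corrector k w) x - w (x 0) * (mu * real (loss_sum k x) * (real (weighted_sum k x) + 1)
      - lam * real N * real (weighted_sum k x))\<bar>
    \<le> K * mu * real (x 1) * (1 + real (weighted_sum k x))\<^sup>2"
proof -
  let ?u = "real (weighted_sum k x)"
  let ?R = "w (x 0 + 1) * (((?u - real k)\<^sup>2 + (?u - real k)) / 2) - w (x 0) * ((?u\<^sup>2 + ?u) / 2)"
  have K: "0 \<le> K" using w[of 0] by simp
  have "Q (corrector k w) x = mu * real (x 1) * ?R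
      + mu * real (loss_sum k x) * (w (x 0) * (((?u + 1)\<^sup>2 + (?u + 1)) / 2) - w (x 0) * ((?u\<^sup>2 + ?u) / 2))
      + lam * real N * of_bool (0 < weighted_sum k x)
         * (w (x 0) * (((?u - 1)\<^sup>2 + (?u - 1)) / 2) - w (x 0) * ((?u\<^sup>2 + ?u) / 2))"
    using Q_weighted_sum[OF x k, of "\<lambda>n u. w n * ((u\<^sup>2 + u) / 2)"] unfolding corrector_def by simp
  also have "w (x 0) * (((?u + 1)\<^sup>2 + (?u + 1)) / 2) - w (x 0) * ((?u\<^sup>2 + ?u) / 2) = w (x 0) * (?u + 1)"
    by (simp add: power2_eq_square field_simps)
  also have "w (x 0) * (((?u - 1)\<^sup>2 + (?u - 1)) / 2) - w (x 0) * ((?u\<^sup>2 + ?u) / 2) = - w (x 0) * ?u"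
    by (simp add: power2_eq_square field_simps)
  also have "lam * real N * of_bool (0 < weighted_sum k x) * (- w (x 0) * ?u) = lam * real N * (- w (x 0) * ?u)"
    by (cases "weighted_sum k x = 0") simp_all
  finally have eq: "Q (corrector k w) x - w (x 0) * (mu * real (loss_sum k x) * (?u + 1) - lam * real N * ?u)
     = mu * real (x 1) * ?R"
    by (simp add: algebra_simps)
  have "\<bar>mu * real (x 1) * ?R\<bar> \<le> mu * real (x 1) * (K * (1 + ?u)\<^sup>2)"
  proof (cases "x 1 = 0")
    case False
    \<comment> \<open>A copy in class 1 has weight \<open>k\<close>, hence
      \<open>weighted_sum k\<close> stays nonnegative after its loss and the quadratic does not
      grow.\<close>
    have "k \<le> k * x 1" using False by simp
    also have "\<dots> \<le> weighted_sum k x" by (rule first_le_weighted_sum[OF k(1)])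
    finally have ku: "real k \<le> ?u" by simp
    have sq: "(?u - real k)\<^sup>2 \<le> ?u\<^sup>2" using ku by (intro power_mono) auto
    have h: "0 \<le> ((?u - real k)\<^sup>2 + (?u - real k)) / 2"
        "((?u - real k)\<^sup>2 + (?u - real k)) / 2 \<le> (?u\<^sup>2 + ?u) / 2"
      using ku sq by (simp, intro divide_right_mono add_mono) auto
    have "\<bar>w (x 0 + 1) * (((?u - real k)\<^sup>2 + (?u - real k)) / 2)\<bar> \<le> K * ((?u\<^sup>2 + ?u) / 2)"
      unfolding abs_mult using w[OF first_pos_imp[OF x]] False h K
      by (intro mult_mono) auto
    moreover have "\<bar>w (x 0) * ((?u\<^sup>2 + ?u) / 2)\<bar> \<le> K * ((?u\<^sup>2 + ?u) / 2)"
      unfolding abs_mult using w[OF state_0_le[OF x]] K by (intro mult_mono) auto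
    ultimately have "\<bar>?R\<bar> \<le> K * (?u\<^sup>2 + ?u)" by argo
    also have "\<dots> \<le> K * (1 + ?u)\<^sup>2"
      using K by (intro mult_left_mono) (auto simp: power2_eq_square algebra_simps)
    finally have "mu * real (x 1) * \<bar>?R\<bar> \<le> mu * real (x 1) * (K * (1 + ?u)\<^sup>2)"
      using mu_pos by (intro mult_left_mono) auto
    then show ?thesis using mu_pos by (simp add: abs_mult)
  qed simp
  then show ?thesis unfolding eq by (simp add: mult_ac)
qed

text \<open>The end point in Dynkin's formula is bounded by a second moment of \<open>W\<close>.
  Because \<open>p < d - 1\<close>, a factor \<open>1 / N\<close> is left over, weakened to
  \<open>1 / sqrt N\<close> to match the other errors.\<close>

lemma I_Q_corrector_le:
  assumes t: "0 \<le> t" and k: "1 \<le> k" "k \<le> d - 1"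
    and w: "\<And>i. i \<le> n \<Longrightarrow> \<bar>w i\<bar> \<le> K" and p: "p < d - 1"
  shows "\<bar>real N ^ p * II t (Q (corrector k w))\<bar> \<le> K * moment_bound 2 / sqrt (real N)"
proof -
  have K: "0 \<le> K" using w[of 0] by simp
  have "real N ^ (d - 1) * II t (Q (corrector k w)) = EE (real N ^ (d - 1) * t) (corrector k w)"
    using dynkin_II[OF t, of "corrector k w"] k by (simp add: weighted_sum_initial corrector_def)
  also have "\<bar>\<dots>\<bar> \<le> EE (real N ^ (d - 1) * t) (\<lambda>x. K * (1 + real (W x))\<^sup>2)"
  proof (intro E_abs_le initial_state)
    fix x assume x: "x \<in> S"
    let ?u = "real (weighted_sum k x)"
    have uW: "?u \<le> real (W x)" using weighted_sum_le_W[OF k(2)] by simp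
    have "0 \<le> ?u\<^sup>2" "(1 + ?u)\<^sup>2 = 1 + 2 * ?u + ?u\<^sup>2" by (auto simp: power2_sum)
    then have "(?u\<^sup>2 + ?u) / 2 \<le> (1 + ?u)\<^sup>2" by simp
    also have "\<dots> \<le> (1 + real (W x))\<^sup>2" using uW by (intro power_mono) auto
    finally have "\<bar>(?u\<^sup>2 + ?u) / 2\<bar> \<le> (1 + real (W x))\<^sup>2" by simp
    then show "\<bar>corrector k w x\<bar> \<le> K * (1 + real (W x))\<^sup>2"
      unfolding corrector_def abs_mult
      by (intro mult_mono w[OF state_0_le[OF x]] K abs_ge_zero)
  qed (use t in auto)
  also have "\<dots> \<le> K * moment_bound 2"
    unfolding E_cmult using K t by (intro mult_left_mono E_power_W_le) auto
  finally have le: "real N ^ (d - 1) * \<bar>II t (Q (corrector k w))\<bar> \<le> K * moment_bound 2"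
    by (simp add: abs_mult)
  have "real N * (real N ^ p * \<bar>II t (Q (corrector k w))\<bar>)
      = real N ^ Suc p * \<bar>II t (Q (corrector k w))\<bar>" by simp
  also have "\<dots> \<le> real N ^ (d - 1) * \<bar>II t (Q (corrector k w))\<bar>"
    using p N_ge_1 by (intro mult_right_mono power_increasing) auto
  also note le
  finally have "real N ^ p * \<bar>II t (Q (corrector k w))\<bar> \<le> (K * moment_bound 2) * (1 / real N)"
    using N_gt_0 by (simp add: field_simps)
  also have "\<dots> \<le> (K * moment_bound 2) * (1 / sqrt (real N))"
    using K moment_bound_nonneg by (intro mult_left_mono inverse_N_le mult_nonneg_nonneg)
  finally show ?thesis by (simp add: abs_mult)
qed

text \<open>\<open>2 * flow_bound ^ d\<close> bounds the average of \<open>u 1 + u k\<close>; the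
  moment of order \<open>6 * d + 4\<close> comes from \<open>I_cubic_weight_le\<close> and
  \<open>moment_bound 2\<close> from the end point.\<close>

definition "chain_const T = mu * (real d)\<^sup>2 * (2 * flow_bound ^ d + 2 * T * moment_bound (6 * d + 4)) + moment_bound 2"

lemma u_le:
  assumes "1 \<le> k" "k \<le> d - 1"
  shows "u k x \<le> real N ^ d * (1 + real (W x))"
proof -
  have "real (weighted_sum k x) \<le> 1 + real (W x)"
    using weighted_sum_le_W[OF assms(2), of x] by simp
  then show ?thesis
    unfolding u_def using N_ge_1 by (intro mult_mono power_increasing) auto
qed

lemma u_nonneg: "0 \<le> u k x" by (simp add: u_def)

text \<open>With \<open>p = d - 2 - k\<close>, the factor \<open>N ^ p\<close> turns services into
  \<open>lam * u k\<close> and arrivals into \<open>mu * (k + 1) * u (k + 1)\<close>. The remainder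
  \<open>e\<close> is \<open>(u 1 + u k) / N\<close> times a power of \<open>1 + W\<close>, which is
  small only in time average.\<close>

lemma chain_step:
  assumes t: "0 \<le> t" "t \<le> T" and k: "1 \<le> k" "k \<le> d - 2"
    and w: "\<And>i. i \<le> n \<Longrightarrow> \<bar>w i\<bar> \<le> K"
  shows "\<bar>lam * II t (\<lambda>x. w (x 0) * u k x) - mu * real (k + 1) * II t (\<lambda>x. w (x 0) * u (k + 1) x)\<bar>
    \<le> K * chain_const T / sqrt (real N)"
proof -
  have K: "0 \<le> K" using w[of 0] by simp
  define p where "p = d - 2 - k"
  have p: "d - 1 - k = Suc p" "d - 1 - (k + 1) = p" "p < d - 1" "Suc p \<le> d - 2"
    using k by (auto simp: p_def)
  have kd: "k \<le> d - 1" "k + 1 \<le> d - 1" using k d_ge by auto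
  define e where "e = (\<lambda>x. real N ^ p * Q (corrector k w) x
     - (mu * real (k + 1) * (w (x 0) * u (k + 1) x) - lam * (w (x 0) * u k x)))"
  have e_le: "\<bar>e x\<bar> \<le> K * mu * (real d)\<^sup>2 * ((u 1 x + u k x) * (1 + real (W x)) ^ 3 / real N)"
    if x: "x \<in> S" for x
  proof -
    let ?u = "real (weighted_sum k x)" and ?u' = "real (weighted_sum (k + 1) x)"
    let ?a = "real (loss_sum k x)" and ?y = "1 + real (W x)"
    \<comment> \<open>\<open>D1\<close> holds the losses in class 1, \<open>D2\<close> the error of
      replacing arrivals by level \<open>k + 1\<close>.\<close>
    define D1 where "D1 = Q (corrector k w) x - w (x 0) * (mu * ?a * (?u + 1) - lam * real N * ?u)"
    define D2 where "D2 = ?a * (?u + 1) - real (k + 1) * ?u'"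
    have e_eq: "e x = real N ^ p * D1 + real N ^ p * (w (x 0) * mu * D2)"
      unfolding e_def u_def p D1_def D2_def by (simp add: algebra_simps)
    have uW: "?u \<le> real (W x)" "?u' \<le> real (W x)"
      using weighted_sum_le_W[OF kd(1)] weighted_sum_le_W[OF kd(2)] by auto
    have d1: "1 \<le> (real d)\<^sup>2" using d_ge by simp
    have y1: "1 \<le> ?y" by simp
    have "\<bar>D1\<bar> \<le> K * mu * real (x 1) * (1 + ?u)\<^sup>2"
      unfolding D1_def using x k kd w by (intro Q_corrector) auto
    also have "\<dots> \<le> K * mu * real (x 1) * ((real d)\<^sup>2 * ?y ^ 3)"
    proof -
      have "(1 + ?u)\<^sup>2 \<le> ?y\<^sup>2" using uW by (intro power_mono) auto
      also have "\<dots> \<le> ?y ^ 3" using y1 by (intro power_increasing) auto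
      also have "\<dots> \<le> (real d)\<^sup>2 * ?y ^ 3" using mult_right_mono[OF d1, of "?y ^ 3"] y1 by simp
      finally show ?thesis using K mu_pos by (intro mult_left_mono) auto
    qed
    finally have D1: "\<bar>D1\<bar> \<le> K * mu * (real d)\<^sup>2 * (real (x 1) * ?y ^ 3)" by (simp add: mult_ac)
    have "real N ^ p * real (x 1) * real N \<le> real N ^ (d - 2) * real (x 1)"
      using mult_right_mono[OF power_increasing[OF p(4) N_ge_1], of "real (x 1)"] by (simp add: mult_ac)
    also have "\<dots> = u 1 x" unfolding u_def weighted_sum_1 by (simp add: numeral_2_eq_2)
    finally have x1: "real N ^ p * real (x 1) \<le> u 1 x / real N"
      using N_gt_0 by (simp add: field_simps)
    have "\<bar>real N ^ p * D1\<bar> \<le> real N ^ p * (K * mu * (real d)\<^sup>2 * (real (x 1) * ?y ^ 3))"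
      unfolding abs_mult using D1 by (intro mult_mono) auto
    also have "\<dots> = K * mu * (real d)\<^sup>2 * (real N ^ p * real (x 1) * ?y ^ 3)" by (simp add: mult_ac)
    also have "\<dots> \<le> K * mu * (real d)\<^sup>2 * (u 1 x / real N * ?y ^ 3)"
      using K mu_pos x1 by (intro mult_left_mono mult_right_mono) auto
    finally have T1: "\<bar>real N ^ p * D1\<bar> \<le> K * mu * (real d)\<^sup>2 * (u 1 x / real N * ?y ^ 3)" .
    \<comment> \<open>Everything in \<open>D2\<close> has the size of level \<open>k\<close>: the
      product \<open>loss_sum k * weighted_sum k\<close> by \<open>loss_sum_le\<close>, the rest by
      \<open>weighted_sum_le_loss_sum\<close>.\<close>
    have "\<bar>D2\<bar> \<le> (real d)\<^sup>2 * (?u * ?y)"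
    proof -
      have "?a \<le> real ((k + 1) * weighted_sum (k + 1) x)" using loss_sum_le of_nat_le_iff by blast
      then have a: "?a \<le> real (k + 1) * ?u'" by (simp only: of_nat_mult)
      also have "\<dots> \<le> real d * real (W x)" using uW k by (intro mult_mono) auto
      also have "\<dots> \<le> (real d)\<^sup>2 * real (W x)"
        using d_ge by (intro mult_right_mono) (auto simp: power2_eq_square)
      finally have "?a * ?u \<le> (real d)\<^sup>2 * real (W x) * ?u" by (intro mult_right_mono) auto
      moreover have "0 \<le> (real d)\<^sup>2 * ?u" by simp
      moreover have "D2 = ?a * ?u + (?a - real (k + 1) * ?u')"
        "(real d)\<^sup>2 * (?u * ?y) = (real d)\<^sup>2 * ?u + (real d)\<^sup>2 * real (W x) * ?u"
        unfolding D2_def by (simp_all add: algebra_simps)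
      ultimately have up: "D2 \<le> (real d)\<^sup>2 * (?u * ?y)"
        using a by linarith
      have "(k + 1) * weighted_sum (k + 1) x \<le> loss_sum k x + (k + 1) * (k + 2) * weighted_sum k x"
        using k by (intro weighted_sum_le_loss_sum)
      also have "\<dots> \<le> loss_sum k x + d * d * weighted_sum k x"
        using k d_ge by (intro add_left_mono mult_le_mono) auto
      finally have "real ((k + 1) * weighted_sum (k + 1) x) \<le> real (loss_sum k x + d * d * weighted_sum k x)"
        using of_nat_le_iff by blast
      then have "real (k + 1) * ?u' \<le> ?a + (real d)\<^sup>2 * ?u"
        by (simp only: of_nat_mult of_nat_add power2_eq_square)
      moreover have "0 \<le> ?a * ?u" "0 \<le> (real d)\<^sup>2 * (?u * real (W x))" by auto
      moreover have "- D2 = (real (k + 1) * ?u' - ?a) - ?a * ?u"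
        "(real d)\<^sup>2 * (?u * ?y) = (real d)\<^sup>2 * ?u + (real d)\<^sup>2 * (?u * real (W x))"
        unfolding D2_def by (simp_all add: algebra_simps)
      ultimately have "- D2 \<le> (real d)\<^sup>2 * (?u * ?y)" by linarith
      with up show ?thesis by (simp add: abs_le_iff)
    qed
    then have "\<bar>real N ^ p * (w (x 0) * mu * D2)\<bar> \<le> real N ^ p * (K * mu * ((real d)\<^sup>2 * (?u * ?y)))"
      unfolding abs_mult using w[OF state_0_le[OF x]] mu_pos K by (intro mult_mono) auto
    also have "\<dots> = K * mu * (real d)\<^sup>2 * (u k x / real N * ?y)"
      unfolding u_def p using N_gt_0 by (simp add: field_simps)
    also have "\<dots> \<le> K * mu * (real d)\<^sup>2 * (u k x / real N * ?y ^ 3)"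
      using K mu_pos u_nonneg y1 self_le_power[OF y1, of 3] by (intro mult_left_mono) auto
    finally have T2: "\<bar>real N ^ p * (w (x 0) * mu * D2)\<bar> \<le> K * mu * (real d)\<^sup>2 * (u k x / real N * ?y ^ 3)" .
    have "\<bar>e x\<bar> \<le> K * mu * (real d)\<^sup>2 * (u 1 x / real N * ?y ^ 3) + K * mu * (real d)\<^sup>2 * (u k x / real N * ?y ^ 3)"
      unfolding e_eq using T1 T2 by (intro order.trans[OF abs_triangle_ineq] add_mono)
    then show ?thesis by (simp add: algebra_simps add_divide_distrib)
  qed
  have "\<bar>II t e\<bar> \<le> II t (\<lambda>x. K * mu * (real d)\<^sup>2 * ((u 1 x + u k x) * (1 + real (W x)) ^ 3 / real N))"
    by (rule II_abs_le[OF e_le])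
  also have "\<dots> = K * mu * (real d)\<^sup>2 * II t (\<lambda>x. (u 1 x + u k x) * (1 + real (W x)) ^ 3 / real N)"
    by (rule I_cmult)
  also have "\<dots> \<le> K * mu * (real d)\<^sup>2 * ((2 * flow_bound ^ d + 2 * T * moment_bound (6 * d + 4)) / sqrt (real N))"
  proof (rule mult_left_mono)
    have "II t (\<lambda>x. (u 1 x + u k x) * (1 + real (W x)) ^ 3 / real N)
        \<le> (II t (\<lambda>x. u 1 x + u k x) + 2 * T * moment_bound (6 * d + 4)) / sqrt (real N)"
    proof (intro I_cubic_weight_le t)
      fix x assume "x \<in> S"
      show "0 \<le> u 1 x + u k x" using u_nonneg by (intro add_nonneg_nonneg)
      have "u 1 x \<le> real N ^ d * (1 + real (W x))" using k kd by (intro u_le) auto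
      moreover have "u k x \<le> real N ^ d * (1 + real (W x))" using k kd by (intro u_le) auto
      ultimately show "u 1 x + u k x \<le> 2 * real N ^ d * (1 + real (W x))" by linarith
    qed
    also have "\<dots> \<le> (2 * flow_bound ^ d + 2 * T * moment_bound (6 * d + 4)) / sqrt (real N)"
    proof -
      have "II t (u 1) \<le> flow_bound ^ 1" using k d_ge by (intro I_u_le[OF t(1)]) auto
      also have "\<dots> \<le> flow_bound ^ d" using d_ge by (intro power_increasing flow_bound_ge_1) auto
      finally have "II t (u 1) \<le> flow_bound ^ d" .
      moreover have "II t (u k) \<le> flow_bound ^ d"
        by (rule order.trans[OF I_u_le[OF t(1) k(1) kd(1)] power_increasing[OF _ flow_bound_ge_1]])
          (use kd in simp)
      ultimately show ?thesis unfolding II_add by (intro divide_right_mono) auto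
    qed
    finally show "II t (\<lambda>x. (u 1 x + u k x) * (1 + real (W x)) ^ 3 / real N)
        \<le> (2 * flow_bound ^ d + 2 * T * moment_bound (6 * d + 4)) / sqrt (real N)" .
  qed (use K mu_pos in auto)
  finally have I_e: "\<bar>II t e\<bar> \<le> K * mu * (real d)\<^sup>2 * ((2 * flow_bound ^ d + 2 * T * moment_bound (6 * d + 4)) / sqrt (real N))" .
  have "II t e = real N ^ p * II t (Q (corrector k w))
    - (mu * real (k + 1) * II t (\<lambda>x. w (x 0) * u (k + 1) x) - lam * II t (\<lambda>x. w (x 0) * u k x))"
    unfolding e_def II_diff I_cmult ..
  then have "\<bar>lam * II t (\<lambda>x. w (x 0) * u k x) - mu * real (k + 1) * II t (\<lambda>x. w (x 0) * u (k + 1) x)\<bar>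
     \<le> \<bar>II t e\<bar> + \<bar>real N ^ p * II t (Q (corrector k w))\<bar>" by argo
  also have "\<dots> \<le> K * mu * (real d)\<^sup>2 * ((2 * flow_bound ^ d + 2 * T * moment_bound (6 * d + 4)) / sqrt (real N))
      + K * moment_bound 2 / sqrt (real N)"
    using I_e I_Q_corrector_le[where w=w and K=K, OF t(1) k(1) kd(1) w p(3)] by (intro add_mono) auto
  also have "\<dots> = K * chain_const T / sqrt (real N)"
    by (simp add: chain_const_def algebra_simps add_divide_distrib)
  finally show ?thesis .
qed

section \<open>From class 1 to the top level, and the queue there\<close>

definition "chain_sum T k = (\<Sum>j\<in>{1..<k}. mu * fact j * (mu / lam) ^ (j - 1) / lam) * chain_const T"

text \<open>Each step trades \<open>u j\<close> for \<open>(j + 1) * mu / lam\<close> times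
  \<open>u (j + 1)\<close>, and these ratios multiply to
  \<open>fact k * (mu / lam) ^ (k - 1)\<close>. In \<open>chain_sum\<close> the error of a step is
  multiplied by the part of the product accumulated before it.\<close>

lemma chain:
  assumes t: "0 \<le> t" "t \<le> T" and k: "1 \<le> k" "k \<le> d - 1"
    and w: "\<And>i. i \<le> n \<Longrightarrow> \<bar>w i\<bar> \<le> K"
  shows "\<bar>mu * II t (\<lambda>x. w (x 0) * u 1 x)
      - mu * fact k * (mu / lam) ^ (k - 1) * II t (\<lambda>x. w (x 0) * u k x)\<bar>
    \<le> K * chain_sum T k / sqrt (real N)"
  using k
proof (induction k rule: nat_induct_at_least)
  case base
  then show ?case by (simp add: chain_sum_def)
next
  case (Suc k)
  let ?J = "\<lambda>k. II t (\<lambda>x. w (x 0) * u k x)"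
  define c where "c = mu * fact k * (mu / lam) ^ (k - 1) / lam"
  have "(mu / lam) ^ k = (mu / lam) ^ (k - 1) * (mu / lam)"
    using Suc by (cases k) auto
  then have c_Suc: "mu * fact (Suc k) * (mu / lam) ^ (Suc k - 1) = c * (mu * real (k + 1))"
    by (simp add: c_def field_simps)
  have c_k: "mu * fact k * (mu / lam) ^ (k - 1) = c * lam" using lam_pos by (simp add: c_def)
  have c0: "0 \<le> c" using lam_pos mu_pos by (simp add: c_def)
  have "\<bar>lam * ?J k - mu * real (k + 1) * ?J (k + 1)\<bar> \<le> K * chain_const T / sqrt (real N)"
    using Suc t w by (intro chain_step) auto
  then have step: "\<bar>c * (lam * ?J k - mu * real (k + 1) * ?J (k + 1))\<bar> \<le> c * (K * chain_const T / sqrt (real N))"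
    unfolding abs_mult[of c] abs_of_nonneg[OF c0] using c0 by (intro mult_left_mono)
  have IH: "\<bar>mu * ?J 1 - c * lam * ?J k\<bar> \<le> K * chain_sum T k / sqrt (real N)"
    using Suc unfolding c_k by simp
  have "mu * ?J 1 - c * (mu * real (k + 1)) * ?J (k + 1)
     = (mu * ?J 1 - c * lam * ?J k) + c * (lam * ?J k - mu * real (k + 1) * ?J (k + 1))"
    by (simp add: algebra_simps)
  then have "\<bar>mu * ?J 1 - c * (mu * real (k + 1)) * ?J (k + 1)\<bar>
     \<le> K * chain_sum T k / sqrt (real N) + c * (K * chain_const T / sqrt (real N))"
    using step IH by linarith
  also have "\<dots> = K * chain_sum T (Suc k) / sqrt (real N)"
  proof -
    have "{1..<Suc k} = insert k {1..<k}" using Suc by auto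
    then show ?thesis by (simp add: chain_sum_def c_def algebra_simps add_divide_distrib)
  qed
  finally show ?case unfolding c_Suc by simp
qed

text \<open>Arrival rate over service rate at the top level. Using \<open>n / N\<close> instead of
  \<beta> keeps the balance exact for finite \<open>N\<close>; the limit is taken in
  \<open>moment_average\<close>.\<close>

definition theta :: "nat \<Rightarrow> real" where
  "theta i = mu * real d * (real n - real i) / (lam * real N)"

text \<open>The coefficient in \<open>chain\<close> at \<open>k = d - 1\<close>; it equals
  \<open>lam * fact (d - 1) / \<rho> ^ (d - 1)\<close>.\<close>

definition drift_const :: real where
  "drift_const = mu * fact (d - 1) * (mu / lam) ^ (d - 2)"

definition "queue_const T = (3 * mu * T * moment_bound 3 + moment_bound 2) / lam"

lemma theta_bounds:
  assumes "i \<le> n" shows "0 \<le> theta i" "theta i \<le> 1"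
proof -
  show "0 \<le> theta i" using assms mu_pos lam_pos by (simp add: theta_def)
  have "mu * real d * (real n - real i) \<le> mu * real d * (b * real N)"
    using n_le mu_pos by (intro mult_left_mono) auto
  also have "\<dots> = mu * real d * b * real N" by simp
  also have "\<dots> \<le> lam * real N"
  proof (intro mult_right_mono)
    have "1 * (mu * real d * b) \<le> z * (mu * real d * b)"
      using z_gt mu_pos b_nonneg by (intro mult_right_mono) auto
    then show "mu * real d * b \<le> lam" using stable by simp
  qed auto
  finally show "theta i \<le> 1" using lam_pos N_gt_0 by (simp add: theta_def)
qed

text \<open>By \<open>loss_sum_balance\<close> the arrival rate is \<open>lam * N * theta\<close> up
  to terms of order \<open>W\<close>, so the quadratic yields
  \<open>lam * N * (theta - (1 - theta) * W)\<close>. This is the mean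
  \<open>theta / (1 - theta)\<close> of a single-server queue, stated without division.\<close>

lemma queue_average:
  assumes t: "0 \<le> t" "t \<le> T" and v: "\<And>i. i \<le> n \<Longrightarrow> \<bar>v i\<bar> \<le> K"
  shows "\<bar>II t (\<lambda>x. v (x 0) * (1 - theta (x 0)) * real (W x)) - II t (\<lambda>x. v (x 0) * theta (x 0))\<bar>
    \<le> K * queue_const T / sqrt (real N)"
proof -
  have K: "0 \<le> K" using v[of 0] by simp
  let ?L = "\<lambda>x. v (x 0) * theta (x 0)" and ?R = "\<lambda>x. v (x 0) * (1 - theta (x 0)) * real (W x)"
  define e where "e = (\<lambda>x. 1 / real N * Q (corrector (d - 1) v) x - lam * (?L x - ?R x))"
  have e_le: "\<bar>e x\<bar> \<le> 3 * K * mu / real N * (1 + real (W x)) ^ 3" if x: "x \<in> S" for x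
  proof -
    let ?u = "real (W x)" and ?a = "real (loss_sum (d - 1) x)"
    define D1 where "D1 = Q (corrector (d - 1) v) x - v (x 0) * (mu * ?a * (?u + 1) - lam * real N * ?u)"
    define D2 where "D2 = mu * (?u + real (x 1)) * (?u + 1)"
    have "real (loss_sum (d - 1) x + W x + x 1) = real (d * (n - x 0))"
      using loss_sum_balance[OF x d_ge] by simp
    then have a: "?a = real d * (real n - real (x 0)) - ?u - real (x 1)"
      using state_0_le[OF x] by (simp add: of_nat_diff)
    have th: "mu * real d * (real n - real (x 0)) = lam * real N * theta (x 0)"
      using lam_pos N_gt_0 by (simp add: theta_def)
    have "mu * ?a * (?u + 1) = mu * real d * (real n - real (x 0)) * (?u + 1) - D2"
      unfolding a D2_def by (simp add: algebra_simps)
    then have a': "mu * ?a * (?u + 1) = lam * real N * theta (x 0) * (?u + 1) - D2" unfolding th .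
    have "Q (corrector (d - 1) v) x = D1 + lam * real N * (?L x - ?R x) - v (x 0) * D2"
      unfolding D1_def a' by (simp add: algebra_simps)
    then have "e x = 1 / real N * (D1 + lam * real N * (?L x - ?R x) - v (x 0) * D2) - lam * (?L x - ?R x)"
      unfolding e_def by simp
    also have "\<dots> = (D1 - v (x 0) * D2) / real N"
      using N_gt_0 by (simp add: field_simps)
    finally have e_eq: "e x = (D1 - v (x 0) * D2) / real N" .
    have "x 1 \<le> W x" using d_ge by (intro first_le) simp
    then have x1: "real (x 1) \<le> 1 + ?u" "real (x 1) \<le> ?u" by simp_all
    have "\<bar>D1\<bar> \<le> K * mu * real (x 1) * (1 + ?u)\<^sup>2"
      unfolding D1_def using x d_ge v by (intro Q_corrector) auto
    also have "\<dots> \<le> K * mu * (1 + ?u) * (1 + ?u)\<^sup>2"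
      using K mu_pos x1 by (intro mult_right_mono mult_left_mono) auto
    finally have D1: "\<bar>D1\<bar> \<le> K * mu * (1 + ?u) ^ 3" by (simp add: power_numeral_reduce mult_ac)
    have "D2 \<le> mu * (2 * (1 + ?u)) * (1 + ?u)"
      unfolding D2_def using mu_pos x1 by (intro mult_mono mult_left_mono) auto
    also have "\<dots> = 2 * mu * (1 + ?u)\<^sup>2" by (simp add: power2_eq_square)
    also have "\<dots> \<le> 2 * mu * (1 + ?u) ^ 3"
      using mu_pos by (intro mult_left_mono power_increasing) auto
    finally have "\<bar>v (x 0) * D2\<bar> \<le> K * (2 * mu * (1 + ?u) ^ 3)"
      unfolding abs_mult using v[OF state_0_le[OF x]] K mu_pos
      by (intro mult_mono) (auto simp: D2_def)
    then have "\<bar>D1 - v (x 0) * D2\<bar> \<le> 3 * K * mu * (1 + ?u) ^ 3"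
      using D1 by (intro order.trans[OF abs_triangle_ineq4]) (simp add: mult_ac)
    then show ?thesis unfolding e_eq by (simp add: divide_right_mono)
  qed
  have "\<bar>II t e\<bar> \<le> II t (\<lambda>x. 3 * K * mu / real N * (1 + real (W x)) ^ 3)"
    by (rule II_abs_le[OF e_le])
  also have "\<dots> \<le> 3 * K * mu / real N * (T * moment_bound 3)"
    unfolding I_cmult using K mu_pos t by (intro mult_left_mono I_power_W_le) auto
  also have "\<dots> = 3 * K * mu * (T * moment_bound 3) * (1 / real N)" by simp
  also have "\<dots> \<le> 3 * K * mu * (T * moment_bound 3) * (1 / sqrt (real N))"
    using K mu_pos t moment_bound_nonneg by (intro mult_left_mono inverse_N_le mult_nonneg_nonneg) auto
  finally have I_e: "\<bar>II t e\<bar> \<le> 3 * K * mu * (T * moment_bound 3) * (1 / sqrt (real N))" .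
  have "\<bar>real N ^ 0 * II t (Q (corrector (d - 1) v))\<bar> \<le> K * moment_bound 2 / sqrt (real N)"
    using t d_ge v by (intro I_Q_corrector_le) auto
  then have "\<bar>1 / real N * II t (Q (corrector (d - 1) v))\<bar> \<le> 1 * (K * moment_bound 2 / sqrt (real N))"
    unfolding abs_mult using N_ge_1 by (intro mult_mono) auto
  moreover have "II t e = 1 / real N * II t (Q (corrector (d - 1) v)) - lam * (II t ?L - II t ?R)"
    unfolding e_def II_diff I_cmult ..
  then have "lam * (II t ?R - II t ?L) = II t e - 1 / real N * II t (Q (corrector (d - 1) v))"
    by (simp add: algebra_simps)
  ultimately have "\<bar>lam * (II t ?R - II t ?L)\<bar>
      \<le> 3 * K * mu * (T * moment_bound 3) * (1 / sqrt (real N)) + K * moment_bound 2 / sqrt (real N)"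
    using I_e by linarith
  also have "\<dots> = lam * (K * queue_const T / sqrt (real N))"
    using lam_pos by (simp add: queue_const_def algebra_simps add_divide_distrib)
  finally have "lam * \<bar>II t ?R - II t ?L\<bar> \<le> lam * (K * queue_const T / sqrt (real N))"
    using lam_pos by (simp only: abs_mult abs_of_pos)
  then show ?thesis using lam_pos by (simp only: mult_le_cancel_left_pos)
qed

definition "average_const T =
  chain_sum T (d - 1) + drift_const * queue_const T + drift_const * (T * moment_bound 1)"

lemma drift_const_pos: "0 < drift_const"
  using lam_pos mu_pos by (simp add: drift_const_def)

lemma chain_sum_nonneg: "0 \<le> T \<Longrightarrow> 0 \<le> chain_sum T k"
  unfolding chain_sum_def chain_const_def
  using lam_pos mu_pos flow_bound_ge_1 moment_bound_nonneg
  by (intro mult_nonneg_nonneg sum_nonneg add_nonneg_nonneg) auto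

text \<open>The condition on \<open>g\<close> is a discrete \<open>g' = v * (1 - \<theta>)\<close>
  with error \<eta>. \<open>chain\<close> carries the increment of \<open>g\<close> from class 1 to
  the top level, where the factor \<open>1 - theta\<close> is just what \<open>queue_average\<close>
  needs.\<close>

lemma averaging:
  assumes t: "0 \<le> t" "t \<le> T" and \<eta>: "0 \<le> \<eta>"
    and v: "\<And>i. i \<le> n \<Longrightarrow> \<bar>v i\<bar> \<le> K"
    and g: "\<And>i. i \<le> n \<Longrightarrow> \<bar>real N * (g (i + 1) - g i) - v i * (1 - theta i)\<bar> \<le> K * \<eta>"
  shows "\<bar>EE (real N ^ (d - 1) * t) (\<lambda>x. g (x 0)) - g 0
      - drift_const * II t (\<lambda>x. v (x 0) * theta (x 0))\<bar>
    \<le> K * average_const T * ((1 + \<eta>) / sqrt (real N) + \<eta>)"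
proof -
  have K: "0 \<le> K" using v[of 0] by simp
  have T: "0 \<le> T" using t by simp
  define w where "w i = real N * (g (i + 1) - g i)" for i
  let ?s = "sqrt (real N)" and ?L = "II t (\<lambda>x. v (x 0) * theta (x 0))"
    and ?R = "II t (\<lambda>x. v (x 0) * (1 - theta (x 0)) * real (W x))"
    and ?J = "II t (\<lambda>x. w (x 0) * u (d - 1) x)"
  have w: "\<bar>w i\<bar> \<le> K * (1 + \<eta>)" if "i \<le> n" for i
  proof -
    have "\<bar>v i * (1 - theta i)\<bar> \<le> K * 1"
      unfolding abs_mult using v[OF that] theta_bounds[OF that] K by (intro mult_mono) auto
    then show ?thesis using g[OF that] unfolding w_def by (simp add: distrib_left)
  qed
  have "real N ^ (d - 1) * II t (Q (\<lambda>x. g (x 0))) = EE (real N ^ (d - 1) * t) (\<lambda>x. g (x 0)) - g 0"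
    using dynkin_II[OF t(1), of "\<lambda>x. g (x 0)"] d_ge by simp
  also have "II t (Q (\<lambda>x. g (x 0))) = II t (\<lambda>x. mu / real N ^ (d - 1) * (w (x 0) * u 1 x))"
  proof (intro I_cong)
    fix x assume x: "x \<in> S"
    \<comment> \<open>One factor \<open>N\<close> turns the increment of \<open>g\<close> into
      \<open>w\<close>, the others turn \<open>x 1\<close> into \<open>u 1\<close>.\<close>
    have "real N ^ (d - 1) = real N * real N ^ (d - 1 - 1)"
      using d_ge by (simp add: power_eq_if)
    then show "Q (\<lambda>x. g (x 0)) x = mu / real N ^ (d - 1) * (w (x 0) * u 1 x)"
      unfolding Q_state_0[OF x] w_def u_def weighted_sum_1 using N_gt_0 by simp
  qed
  finally have start: "EE (real N ^ (d - 1) * t) (\<lambda>x. g (x 0)) - g 0 = mu * II t (\<lambda>x. w (x 0) * u 1 x)"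
    unfolding I_cmult using N_gt_0 by simp
  have "drift_const = mu * fact (d - 1) * (mu / lam) ^ (d - 1 - 1)"
    by (simp add: drift_const_def numeral_2_eq_2)
  then have 1: "\<bar>mu * II t (\<lambda>x. w (x 0) * u 1 x) - drift_const * ?J\<bar>
      \<le> K * (1 + \<eta>) * chain_sum T (d - 1) / ?s"
    using chain[OF t, of "d - 1" w "K * (1 + \<eta>)"] w d_ge by simp
  have "\<bar>II t (\<lambda>x. w (x 0) * u (d - 1) x - v (x 0) * (1 - theta (x 0)) * real (W x))\<bar>
      \<le> II t (\<lambda>x. K * \<eta> * (1 + real (W x)) ^ 1)"
  proof (rule II_abs_le)
    fix x assume x: "x \<in> S"
    have "\<bar>w (x 0) * u (d - 1) x - v (x 0) * (1 - theta (x 0)) * real (W x)\<bar>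
       = \<bar>w (x 0) - v (x 0) * (1 - theta (x 0))\<bar> * real (W x)"
      by (simp add: u_def abs_mult flip: left_diff_distrib)
    also have "\<dots> \<le> K * \<eta> * (1 + real (W x)) ^ 1"
      using g[OF state_0_le[OF x]] K \<eta> unfolding w_def by (intro mult_mono) auto
    finally show "\<bar>w (x 0) * u (d - 1) x - v (x 0) * (1 - theta (x 0)) * real (W x)\<bar>
      \<le> K * \<eta> * (1 + real (W x)) ^ 1" .
  qed
  also have "\<dots> \<le> K * \<eta> * (T * moment_bound 1)"
    unfolding I_cmult using K \<eta> t by (intro mult_left_mono I_power_W_le) auto
  finally have 2: "\<bar>?J - ?R\<bar> \<le> K * \<eta> * (T * moment_bound 1)" unfolding II_diff .
  have 3: "\<bar>?R - ?L\<bar> \<le> K * queue_const T / ?s"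
    by (rule queue_average[OF t v])
  have c: "0 \<le> drift_const" using drift_const_pos by simp
  have "\<bar>drift_const * (?J - ?L)\<bar> \<le> drift_const * (K * \<eta> * (T * moment_bound 1) + K * queue_const T / ?s)"
    unfolding abs_mult abs_of_nonneg[OF c] using 2 3 by (intro mult_left_mono c) linarith
  then have "\<bar>mu * II t (\<lambda>x. w (x 0) * u 1 x) - drift_const * ?L\<bar>
     \<le> K * (1 + \<eta>) * chain_sum T (d - 1) / ?s + drift_const * (K * \<eta> * (T * moment_bound 1) + K * queue_const T / ?s)"
    using 1 unfolding right_diff_distrib by linarith
  also have "\<dots> \<le> K * average_const T * ((1 + \<eta>) / ?s + \<eta>)"
  proof -
    let ?c1 = "chain_sum T (d - 1)" and ?c2 = "drift_const * queue_const T" and ?c3 = "drift_const * (T * moment_bound 1)"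
    have n: "0 \<le> ?c1" "0 \<le> ?c2" "0 \<le> ?c3"
      using T chain_sum_nonneg c lam_pos mu_pos moment_bound_nonneg by (auto simp: queue_const_def)
    have r: "0 \<le> (1 + \<eta>) / ?s" "1 / ?s \<le> (1 + \<eta>) / ?s"
      using \<eta> by (auto intro!: divide_right_mono)
    have "?c2 * (1 / ?s) \<le> ?c2 * ((1 + \<eta>) / ?s + \<eta>)" "?c3 * \<eta> \<le> ?c3 * ((1 + \<eta>) / ?s + \<eta>)"
        "?c1 * ((1 + \<eta>) / ?s) \<le> ?c1 * ((1 + \<eta>) / ?s + \<eta>)"
      using n r \<eta> by (intro mult_left_mono; linarith)+
    then have "?c1 * ((1 + \<eta>) / ?s) + ?c2 * (1 / ?s) + ?c3 * \<eta> \<le> average_const T * ((1 + \<eta>) / ?s + \<eta>)"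
      unfolding average_const_def distrib_right by linarith
    from mult_left_mono[OF this K] show ?thesis by (simp add: algebra_simps)
  qed
  finally show ?thesis unfolding start .
qed

end

section \<open>The limiting equation\<close>

text \<open>\<open>a\<close> stands for \<open>\<rho> / d\<close> and \<kappa> for the rate in the
  exponent; \<open>\<beta> < a\<close> is the stability condition.\<close>

locale fluid_limit =
  fixes \<beta> a \<kappa> :: real
  assumes \<beta>_pos: "0 < \<beta>" and \<beta>_less: "\<beta> < a" and \<kappa>_pos: "0 < \<kappa>"
begin

definition level :: "real \<Rightarrow> real" where
  "level y = (1 - y / \<beta>) powr a * exp y"

text \<open>Minus the logarithm of \<open>level\<close>: the equation becomes
  \<open>height y = \<kappa> * t\<close>, and its solution an inverse function.\<close>

definition height :: "real \<Rightarrow> real" where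
  "height y = - (a * ln (1 - y / \<beta>) + y)"

lemma a_pos: "0 < a" using \<beta>_pos \<beta>_less by simp

lemma level_eq_exp: "y < \<beta> \<Longrightarrow> level y = exp (- height y)"
  using \<beta>_pos by (simp add: level_def height_def powr_def exp_add divide_less_eq_1_pos)

text \<open>By \<open>ln r \<le> r - 1\<close> the slope is at least \<open>a / \<beta> - 1\<close>.
  Its positivity gives uniqueness and, read backwards, the Lipschitz bound for
  \<open>\<Phi>\<close>.\<close>

lemma height_increment:
  assumes "0 \<le> x" "x \<le> y" "y < \<beta>"
  shows "(a / \<beta> - 1) * (y - x) \<le> height y - height x"
proof -
  have pos: "0 < \<beta> - x" "0 < \<beta> - y" using assms by auto
  have eq: "1 - x / \<beta> = (\<beta> - x) / \<beta>" "1 - y / \<beta> = (\<beta> - y) / \<beta>"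
    using \<beta>_pos by (auto simp: field_simps)
  have "ln (1 - y / \<beta>) - ln (1 - x / \<beta>) = ln ((\<beta> - y) / (\<beta> - x))"
    unfolding eq using pos \<beta>_pos by (simp add: ln_div)
  also have "\<dots> \<le> (\<beta> - y) / (\<beta> - x) - 1"
    using pos by (intro ln_le_minus_one) simp
  also have "\<dots> = - ((y - x) / (\<beta> - x))" using pos by (simp add: field_simps)
  finally have 1: "(y - x) / (\<beta> - x) \<le> ln (1 - x / \<beta>) - ln (1 - y / \<beta>)" by simp
  have "(y - x) / \<beta> \<le> (y - x) / (\<beta> - x)"
    using assms \<beta>_pos by (intro divide_left_mono) auto
  with 1 have "(y - x) / \<beta> \<le> ln (1 - x / \<beta>) - ln (1 - y / \<beta>)" by simp
  from mult_left_mono[OF this, of a] a_pos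
  have "a * ((y - x) / \<beta>) \<le> a * (ln (1 - x / \<beta>) - ln (1 - y / \<beta>))" by simp
  moreover have "(a / \<beta> - 1) * (y - x) = a * ((y - x) / \<beta>) - (y - x)" by (simp add: left_diff_distrib)
  ultimately show ?thesis unfolding height_def by (simp add: right_diff_distrib)
qed

lemma slope_pos: "0 < a / \<beta> - 1" using \<beta>_pos \<beta>_less by simp

lemma level_strict_antimono:
  assumes "0 \<le> x" "x < y" "y \<le> \<beta>"
  shows "level y < level x"
proof (cases "y < \<beta>")
  case True
  have "0 < (a / \<beta> - 1) * (y - x)" using slope_pos assms by simp
  then have "height x < height y" using height_increment[of x y] assms True by simp
  then show ?thesis using level_eq_exp[of x] level_eq_exp[of y] assms True by simp
next
  case False
  \<comment> \<open>Here \<open>y = \<beta>\<close>, and \<open>0 powr a = 0\<close>.\<close>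
  then have "level y = 0" using assms \<beta>_pos by (simp add: level_def)
  then show ?thesis using level_eq_exp[of x] assms by simp
qed

lemma ex_level:
  assumes "0 \<le> t" shows "\<exists>y. 0 \<le> y \<and> y < \<beta> \<and> level y = exp (- \<kappa> * t)"
proof -
  have "\<exists>y\<ge>0. y \<le> \<beta> \<and> level y = exp (- \<kappa> * t)"
  proof (rule IVT2')
    show "level \<beta> \<le> exp (- \<kappa> * t)" using \<beta>_pos by (simp add: level_def)
    show "exp (- \<kappa> * t) \<le> level 0" using \<kappa>_pos assms by (simp add: level_def)
    show "continuous_on {0..\<beta>} level"
      unfolding level_def using \<beta>_pos a_pos
      by (intro continuous_intros continuous_on_powr') (auto simp: divide_le_eq_1)
  qed (use \<beta>_pos in auto)
  then obtain y where "0 \<le> y" "y \<le> \<beta>" "level y = exp (- \<kappa> * t)" by auto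
  moreover have "y \<noteq> \<beta>" using calculation \<beta>_pos by (auto simp: level_def)
  ultimately show ?thesis by force
qed

definition \<Phi> :: "real \<Rightarrow> real" where
  "\<Phi> t = (SOME y. 0 \<le> y \<and> y < \<beta> \<and> level y = exp (- \<kappa> * t))"

lemma \<Phi>_bounds: "0 \<le> t \<Longrightarrow> 0 \<le> \<Phi> t" "0 \<le> t \<Longrightarrow> \<Phi> t < \<beta>"
  and level_\<Phi>: "0 \<le> t \<Longrightarrow> level (\<Phi> t) = exp (- \<kappa> * t)"
  using someI_ex[OF ex_level, of t] unfolding \<Phi>_def by auto

lemma \<Phi>_unique:
  assumes "0 \<le> t" "0 \<le> y" "y \<le> \<beta>" "level y = exp (- \<kappa> * t)"
  shows "y = \<Phi> t"
  using level_strict_antimono[of y "\<Phi> t"] level_strict_antimono[of "\<Phi> t" y] \<Phi>_bounds[of t]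
    level_\<Phi>[of t] assms by (cases y "\<Phi> t" rule: linorder_cases) auto

lemma height_\<Phi>: "0 \<le> t \<Longrightarrow> height (\<Phi> t) = \<kappa> * t"
  using level_eq_exp[of "\<Phi> t"] level_\<Phi>[of t] \<Phi>_bounds[of t] by simp

lemma \<Phi>_0: "\<Phi> 0 = 0"
  using \<Phi>_unique[of 0 0] \<beta>_pos by (simp add: level_def)

lemma \<Phi>_mono:
  assumes "0 \<le> s" "s \<le> t" shows "\<Phi> s \<le> \<Phi> t"
proof (rule ccontr)
  assume "\<not> \<Phi> s \<le> \<Phi> t"
  then have "level (\<Phi> s) < level (\<Phi> t)"
    using assms \<Phi>_bounds[of s] \<Phi>_bounds[of t] by (intro level_strict_antimono) auto
  moreover have "\<kappa> * s \<le> \<kappa> * t" using assms \<kappa>_pos by (intro mult_left_mono) auto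
  ultimately show False using assms by (simp add: level_\<Phi>)
qed

lemma \<Phi>_lipschitz:
  assumes "0 \<le> s" "s \<le> t"
  shows "\<Phi> t - \<Phi> s \<le> \<kappa> / (a / \<beta> - 1) * (t - s)"
proof -
  have "(a / \<beta> - 1) * (\<Phi> t - \<Phi> s) \<le> height (\<Phi> t) - height (\<Phi> s)"
    using assms \<Phi>_bounds[of s] \<Phi>_bounds[of t] \<Phi>_mono by (intro height_increment) auto
  also have "\<dots> = \<kappa> * (t - s)" using assms by (simp add: height_\<Phi> right_diff_distrib)
  finally show ?thesis using slope_pos by (simp add: pos_le_divide_eq mult.commute)
qed

lemma continuous_on_\<Phi>: "continuous_on {0..} \<Phi>"
proof -
  let ?L = "\<kappa> / (a / \<beta> - 1)"
  have "?L-lipschitz_on {0..} \<Phi>"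
  proof (rule lipschitz_onI)
    fix s t :: real assume st: "s \<in> {0..}" "t \<in> {0..}"
    show "dist (\<Phi> s) (\<Phi> t) \<le> ?L * dist s t"
      using \<Phi>_lipschitz[of s t] \<Phi>_lipschitz[of t s] \<Phi>_mono[of s t] \<Phi>_mono[of t s] st
      by (cases "s \<le> t") (auto simp: dist_real_def)
  qed (use slope_pos \<kappa>_pos in simp)
  then show ?thesis by (rule lipschitz_on_continuous_on)
qed

text \<open>In the coordinate \<open>q\<close> the limiting equation reads \<open>q' = \<kappa> * \<theta>\<close>.\<close>

definition q :: "real \<Rightarrow> real" where
  "q y = (1 - \<beta> / a) * y + y\<^sup>2 / (2 * a)"

definition \<theta> :: "real \<Rightarrow> real" where
  "\<theta> y = (\<beta> - y) / a"

text \<open>\<open>\<Phi>\<close> inverts \<open>height / \<kappa>\<close>, and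
  \<open>height' = (1 - \<theta>) / \<theta>\<close>; so
  \<open>\<Phi>' = \<kappa> * \<theta> / (1 - \<theta>)\<close>, whose denominator is cancelled by
  \<open>q' = 1 - \<theta>\<close>.\<close>

lemma q_\<Phi>_has_derivative:
  assumes "0 < t"
  shows "((\<lambda>s. q (\<Phi> s)) has_real_derivative \<kappa> * \<theta> (\<Phi> t)) (at t)"
proof -
  let ?y = "\<Phi> t"
  have y: "0 \<le> ?y" "?y < \<beta>" using \<Phi>_bounds[of t] assms by auto
  have "(height has_real_derivative a / (\<beta> - ?y) - 1) (at ?y)"
    unfolding height_def using y \<beta>_pos
    by (auto intro!: derivative_eq_intros simp: field_simps)
  then have dh: "((\<lambda>y. height y / \<kappa>) has_real_derivative (a / (\<beta> - ?y) - 1) / \<kappa>) (at ?y)"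
    by (rule DERIV_cdivide)
  have ne: "(a / (\<beta> - ?y) - 1) / \<kappa> \<noteq> 0"
    using y \<beta>_less \<kappa>_pos by (auto simp: field_simps)
  have "isCont \<Phi> t"
    by (rule continuous_on_interior[OF continuous_on_\<Phi>]) (use assms in simp)
  then have "(\<Phi> has_real_derivative inverse ((a / (\<beta> - ?y) - 1) / \<kappa>)) (at t)"
    using assms height_\<Phi> \<kappa>_pos
    by (intro DERIV_inverse_function[where f = "\<lambda>y. height y / \<kappa>" and a = 0 and b = "t + 1"] dh ne) auto
  moreover have "(q has_real_derivative 1 - \<beta> / a + ?y / a) (at ?y)"
    unfolding q_def using a_pos by (auto intro!: derivative_eq_intros)
  ultimately have "((\<lambda>s. q (\<Phi> s)) has_real_derivative
      (1 - \<beta> / a + ?y / a) * inverse ((a / (\<beta> - ?y) - 1) / \<kappa>)) (at t)"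
    by (rule DERIV_chain2[rotated])
  moreover have "(1 - \<beta> / a + ?y / a) * inverse ((a / (\<beta> - ?y) - 1) / \<kappa>) = \<kappa> * \<theta> ?y"
  proof -
    have e: "a - (\<beta> - ?y) \<noteq> 0" "\<beta> - ?y \<noteq> 0" using y \<beta>_less by auto
    have "1 - \<beta> / a + ?y / a = (a - (\<beta> - ?y)) / a" using a_pos by (simp add: field_simps)
    moreover have "(a / (\<beta> - ?y) - 1) / \<kappa> = (a - (\<beta> - ?y)) / (\<kappa> * (\<beta> - ?y))"
      using e \<kappa>_pos by (simp add: field_simps)
    ultimately show ?thesis using e \<kappa>_pos a_pos by (simp add: \<theta>_def)
  qed
  ultimately show ?thesis by simp
qed

lemma q_diff: "q y - q x = (y - x) * (1 - \<beta> / a + (x + y) / (2 * a))"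
  using a_pos by (simp add: q_def power2_eq_square field_simps)

lemma gap_pos: "0 < 1 - \<beta> / a" using \<beta>_less a_pos by simp

lemma q_\<theta>_monotone:
  assumes "0 \<le> x" "0 \<le> y"
  shows "(q y - q x) * (\<theta> y - \<theta> x) \<le> 0"
proof -
  have "(q y - q x) * (\<theta> y - \<theta> x) = - ((y - x)\<^sup>2 * ((1 - \<beta> / a + (x + y) / (2 * a)) / a))"
    unfolding q_diff using a_pos by (simp add: \<theta>_def power2_eq_square diff_divide_distrib[symmetric])
      (simp add: field_simps)
  also have "\<dots> \<le> 0"
    using gap_pos a_pos assms by (auto intro!: mult_nonneg_nonneg divide_nonneg_nonneg add_nonneg_nonneg)
  finally show ?thesis .
qed

text \<open>\<open>q' \<ge> 1 - \<beta> / a\<close> on the half-line, so closeness in the coordinate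
  \<open>q\<close> gives closeness in \<open>y\<close>.\<close>

lemma q_expands:
  assumes "0 \<le> x" "0 \<le> y"
  shows "(1 - \<beta> / a)\<^sup>2 * (y - x)\<^sup>2 \<le> (q y - q x)\<^sup>2"
proof -
  have "(1 - \<beta> / a)\<^sup>2 \<le> (1 - \<beta> / a + (x + y) / (2 * a))\<^sup>2"
    using gap_pos a_pos assms by (intro power_mono) auto
  then show ?thesis
    unfolding q_diff power_mult_distrib by (subst mult.commute) (intro mult_left_mono, auto)
qed

text \<open>\<open>c\<close> is free because \<open>x 0 / N\<close> may exceed \<beta> and is only
  bounded by \<open>b\<close>.\<close>

lemma q_bounds:
  assumes "0 \<le> y" "y \<le> c" shows "0 \<le> q y" "q y \<le> c + c\<^sup>2 / a"
proof -
  show "0 \<le> q y" using assms gap_pos a_pos by (simp add: q_def)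
  have "(1 - \<beta> / a) * y \<le> 1 * c"
    using assms gap_pos \<beta>_pos a_pos by (intro mult_mono) auto
  moreover have "y\<^sup>2 / (2 * a) \<le> c\<^sup>2 / a"
    using assms a_pos by (intro frac_le power_mono) auto
  ultimately show "q y \<le> c + c\<^sup>2 / a" by (simp add: q_def)
qed

lemma q_\<Phi>_bounds:
  assumes "0 \<le> t" shows "0 \<le> q (\<Phi> t)" "q (\<Phi> t) \<le> \<beta>"
proof -
  note b = \<Phi>_bounds[OF assms]
  show "0 \<le> q (\<Phi> t)" using b by (intro q_bounds(1)[of _ \<beta>]) auto
  have "q (\<Phi> t) - q 0 = \<Phi> t * (1 - (2 * \<beta> - \<Phi> t) / (2 * a))"
    unfolding q_diff using a_pos by (simp add: field_simps)
  also have "\<dots> \<le> \<Phi> t * 1" using b a_pos by (intro mult_left_mono) auto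
  finally show "q (\<Phi> t) \<le> \<beta>" using b by (simp add: q_def)
qed

lemma \<theta>_\<Phi>_bounds: "0 \<le> t \<Longrightarrow> 0 \<le> \<theta> (\<Phi> t)" "0 \<le> t \<Longrightarrow> \<theta> (\<Phi> t) \<le> 1"
  using \<Phi>_bounds[of t] a_pos \<beta>_less by (auto simp: \<theta>_def)

end

locale storage_fluid = stable_storage lam mu d n N P b z + fluid_limit \<beta> a \<kappa>
  for lam mu :: real and d n N :: nat and P and b z and \<beta> a \<kappa> +
  assumes a_eq: "a = lam / (mu * real d)" and \<kappa>_eq: "\<kappa> = drift_const"
begin

abbreviation "lost x \<equiv> real (x (0::nat) :: nat) / real N"
abbreviation "time t \<equiv> real N ^ (d - 1) * t"

lemma time_nonneg: "0 \<le> t \<Longrightarrow> 0 \<le> time t" by simp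

text \<open>Since \<open>\<theta>\<close> decreases while \<open>q\<close> increases, the limiting equation is a contraction for the
  squared distance in the coordinate \<open>q\<close>.\<close>

lemma contraction:
  assumes T: "0 \<le> t" "t \<le> T"
    and m1: "\<And>s. 0 \<le> s \<Longrightarrow> s \<le> T \<Longrightarrow>
      \<bar>EE (time s) (\<lambda>x. q (lost x)) - \<kappa> * II s (\<lambda>x. \<theta> (lost x))\<bar> \<le> \<epsilon>"
    and m2: "\<And>s. 0 \<le> s \<Longrightarrow> s \<le> T \<Longrightarrow>
      \<bar>EE (time s) (\<lambda>x. (q (lost x))\<^sup>2) - \<kappa> * II s (\<lambda>x. 2 * q (lost x) * \<theta> (lost x))\<bar> \<le> \<epsilon>"
  shows "EE (time t) (\<lambda>x. (q (lost x) - q (\<Phi> t))\<^sup>2) \<le> (1 + 2 * \<beta> + 2 * \<kappa> * T) * \<epsilon>"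
proof -
  have \<epsilon>: "0 \<le> \<epsilon>" using m1[of 0] T by linarith
  define H where "H s = q (\<Phi> s)" for s
  let ?q = "\<lambda>x. q (lost x)" and ?\<theta> = "\<lambda>x. \<theta> (lost x)" and ?q\<theta> = "\<lambda>x. 2 * q (lost x) * \<theta> (lost x)"
  \<comment> \<open>\<open>R\<close> is the mean square of \<open>q - H\<close> with both moments
    replaced by their time integrals, lowered by \<open>2 * \<kappa> * \<epsilon> * s\<close> to
    absorb the error of the first moment in the derivative.\<close>
  define R where "R s = \<kappa> * II s ?q\<theta> - 2 * H s * (\<kappa> * II s ?\<theta>) + (H s)\<^sup>2 - 2 * \<kappa> * \<epsilon> * s" for s
  have "R t \<le> R 0"
  proof (rule DERIV_nonpos_imp_decreasing_open[where f = R and a = 0 and b = t])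
    fix s assume s: "0 < s" "s < t"
    let ?E = "EE (time s)" and ?th = "\<theta> (\<Phi> s)"
    define R' where "R' = \<kappa> * ?E ?q\<theta> - (2 * (\<kappa> * ?th) * (\<kappa> * II s ?\<theta>) + 2 * H s * (\<kappa> * ?E ?\<theta>))
       + 2 * H s * (\<kappa> * ?th) - 2 * \<kappa> * \<epsilon>"
    have dI: "((\<lambda>s. II s f) has_real_derivative ?E f) (at s)" for f
      using s by (intro I_has_derivative initial_state) auto
    have dH: "(H has_real_derivative \<kappa> * ?th) (at s)"
      unfolding H_def by (rule q_\<Phi>_has_derivative[OF s(1)])
    have "(R has_real_derivative R') (at s)"
      unfolding R_def R'_def
      by (rule derivative_eq_intros dI dH refl | simp add: algebra_simps)+
    moreover have "R' \<le> 0"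
    proof -
      let ?D = "?E (\<lambda>x. (?q x - H s) * (?\<theta> x - ?th))"
      have "?D \<le> ?E (\<lambda>x. 0 * 0)"
        using s \<Phi>_bounds[of s] unfolding H_def
        by (intro E_mono time_nonneg initial_state order.trans[OF q_\<theta>_monotone]) auto
      then have D: "?D \<le> 0" unfolding E_cmult by simp
      have "?D = ?E (\<lambda>x. 1 / 2 * ?q\<theta> x - H s * ?\<theta> x - ?th * ?q x + H s * ?th)"
        by (intro E_cong) (simp add: algebra_simps)
      also have "\<dots> = 1 / 2 * ?E ?q\<theta> - H s * ?E ?\<theta> - ?th * ?E ?q + H s * ?th"
        unfolding E_add E_diff E_cmult using s by (simp add: E_const initial_state)
      finally have D_eq: "?D = 1 / 2 * ?E ?q\<theta> - H s * ?E ?\<theta> - ?th * ?E ?q + H s * ?th" .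
      \<comment> \<open>The first term is nonpositive by \<open>q_\<theta>_monotone\<close>, the
        second by \<open>m1\<close> and \<open>\<theta> \<le> 1\<close> along the solution.\<close>
      have "R' = 2 * \<kappa> * ?D + 2 * \<kappa> * (?th * (?E ?q - \<kappa> * II s ?\<theta>) - \<epsilon>)"
        unfolding D_eq R'_def by (simp add: algebra_simps)
      moreover have "?th * (?E ?q - \<kappa> * II s ?\<theta>) \<le> 1 * \<epsilon>"
        using m1[of s] s T \<theta>_\<Phi>_bounds[of s] \<epsilon>
        by (intro order.trans[OF mult_left_mono mult_right_mono]) auto
      moreover have "2 * \<kappa> * ?D \<le> 0" using D \<kappa>_pos by (simp add: mult_nonneg_nonpos)
      ultimately show ?thesis using \<kappa>_pos by (simp add: mult_nonneg_nonpos add_nonpos_nonpos)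
    qed
    ultimately show "\<exists>y. (R has_real_derivative y) (at s) \<and> y \<le> 0" by blast
  next
    have "continuous_on {0..t} \<Phi>" by (rule continuous_on_subset[OF continuous_on_\<Phi>]) auto
    then show "continuous_on {0..t} R"
      unfolding R_def H_def q_def using a_pos
      by (intro continuous_intros continuous_on_I initial_state) auto
  qed (rule T)
  also have "R 0 = 0"
    by (simp add: R_def H_def \<Phi>_0 q_def I_def)
  finally have R: "R t \<le> 0" .
  have H: "0 \<le> H t" "H t \<le> \<beta>" unfolding H_def using q_\<Phi>_bounds T by auto
  have "EE (time t) (\<lambda>x. (?q x - H t)\<^sup>2) = EE (time t) (\<lambda>x. (?q x)\<^sup>2 - (2 * H t) * ?q x + (H t)\<^sup>2)"
    by (intro E_cong) (simp add: power2_eq_square algebra_simps)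
  also have "\<dots> = EE (time t) (\<lambda>x. (?q x)\<^sup>2) - 2 * H t * EE (time t) ?q + (H t)\<^sup>2"
    unfolding E_add E_diff E_cmult using T by (simp add: E_const initial_state)
  also have "\<dots> = R t + (EE (time t) (\<lambda>x. (?q x)\<^sup>2) - \<kappa> * II t ?q\<theta>)
      + 2 * H t * (\<kappa> * II t ?\<theta> - EE (time t) ?q) + 2 * \<kappa> * \<epsilon> * t"
    by (simp add: R_def algebra_simps)
  also have "\<dots> \<le> 0 + \<epsilon> + 2 * \<beta> * \<epsilon> + 2 * \<kappa> * \<epsilon> * T"
  proof (intro add_mono R)
    show "EE (time t) (\<lambda>x. (?q x)\<^sup>2) - \<kappa> * II t ?q\<theta> \<le> \<epsilon>" using m2[OF T] by simp
    have "2 * H t * (\<kappa> * II t ?\<theta> - EE (time t) ?q) \<le> 2 * H t * \<epsilon>"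
      using m1[OF T] H by (intro mult_left_mono) auto
    also have "\<dots> \<le> 2 * \<beta> * \<epsilon>" using H \<epsilon> by (intro mult_right_mono) auto
    finally show "2 * H t * (\<kappa> * II t ?\<theta> - EE (time t) ?q) \<le> 2 * \<beta> * \<epsilon>" .
    show "2 * \<kappa> * \<epsilon> * t \<le> 2 * \<kappa> * \<epsilon> * T" using T \<kappa>_pos \<epsilon> by (intro mult_left_mono) auto
  qed
  finally show ?thesis unfolding H_def by (simp add: algebra_simps)
qed

text \<open>The gap between \<open>n / N\<close> and \<beta>, plus the second-order term of
  \<open>q\<close> over a step \<open>1 / N\<close>. \<open>mismatch\<close> adds the squared
  increment arising from \<open>q\<^sup>2\<close>.\<close>

definition defect :: real where
  "defect = \<bar>real n / real N - \<beta>\<bar> / a + 1 / (2 * a * real N)"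

definition mismatch :: real where
  "mismatch = defect + (1 + defect)\<^sup>2 / real N"

text \<open>It covers both weights \<open>1\<close> and \<open>2 * q\<close> on the range up to
  \<open>b\<close>.\<close>

definition weight_bound :: real where
  "weight_bound = 1 + 2 * (b + b\<^sup>2 / a)"

definition moment_error :: "real \<Rightarrow> real" where
  "moment_error T = weight_bound * average_const T * ((1 + mismatch) / sqrt (real N) + mismatch)
     + \<kappa> * (T * (weight_bound * defect))"

lemma lost_bounds: "i \<le> n \<Longrightarrow> 0 \<le> real i / real N" "i \<le> n \<Longrightarrow> real i / real N \<le> b"
proof -
  assume "i \<le> n"
  then have "real i \<le> b * real N" using n_le by linarith
  then show "real i / real N \<le> b" using N_gt_0 by (simp add: pos_divide_le_eq)
qed simp

lemma q_increment:
  "real N * (q (real (i + 1) / real N) - q (real i / real N))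
    = 1 - \<beta> / a + real i / (a * real N) + 1 / (2 * a * real N)"
  unfolding q_diff using N_gt_0 a_pos by (simp add: field_simps)

lemma theta_eq: "theta i = (real n / real N - real i / real N) / a"
  unfolding theta_def a_eq using lam_pos mu_pos d_ge N_gt_0 by (simp add: field_simps)

text \<open>Replacing \<open>theta\<close> by its limit \<open>\<theta>\<close> changes the
  integrand of \<open>averaging\<close> by at most \<open>weight_bound * defect\<close>.\<close>

lemma moment_average:
  assumes t: "0 \<le> t" "t \<le> T"
    and v: "\<And>i. i \<le> n \<Longrightarrow> \<bar>v (real i / real N)\<bar> \<le> weight_bound"
    and g: "\<And>i. i \<le> n \<Longrightarrow> \<bar>real N * (g (real (i + 1) / real N) - g (real i / real N))
        - v (real i / real N) * (1 - theta i)\<bar> \<le> weight_bound * mismatch"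
    and g0: "g 0 = 0"
  shows "\<bar>EE (time t) (\<lambda>x. g (lost x)) - \<kappa> * II t (\<lambda>x. v (lost x) * \<theta> (lost x))\<bar> \<le> moment_error T"
proof -
  have T: "0 \<le> T" using t by simp
  have wb: "0 \<le> weight_bound" using b_nonneg a_pos by (simp add: weight_bound_def)
  have df: "0 \<le> defect" using a_pos by (simp add: defect_def)
  then have mm: "0 \<le> mismatch" by (simp add: mismatch_def)
  have 1: "\<bar>EE (time t) (\<lambda>x. g (lost x)) - \<kappa> * II t (\<lambda>x. v (lost x) * theta (x 0))\<bar>
      \<le> weight_bound * average_const T * ((1 + mismatch) / sqrt (real N) + mismatch)"
    using averaging[OF t mm, of "\<lambda>i. v (real i / real N)" weight_bound "\<lambda>i. g (real i / real N)"] v g g0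
    unfolding \<kappa>_eq by simp
  have "\<bar>II t (\<lambda>x. v (lost x) * theta (x 0) - v (lost x) * \<theta> (lost x))\<bar>
      \<le> II t (\<lambda>x. weight_bound * defect * (1 + real (W x)) ^ 0)"
  proof (rule II_abs_le)
    fix x assume x: "x \<in> S"
    have "theta (x 0) - \<theta> (lost x) = (real n / real N - \<beta>) / a"
      by (simp only: theta_eq \<theta>_def diff_divide_distrib)
    then have "\<bar>theta (x 0) - \<theta> (lost x)\<bar> = \<bar>real n / real N - \<beta>\<bar> / a"
      using a_pos by simp
    also have "\<dots> \<le> defect" using a_pos by (simp add: defect_def)
    finally have "\<bar>v (lost x)\<bar> * \<bar>theta (x 0) - \<theta> (lost x)\<bar> \<le> weight_bound * defect"
      using v[OF state_0_le[OF x]] wb by (intro mult_mono) auto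
    then show "\<bar>v (lost x) * theta (x 0) - v (lost x) * \<theta> (lost x)\<bar>
        \<le> weight_bound * defect * (1 + real (W x)) ^ 0"
      by (simp add: abs_mult flip: right_diff_distrib)
  qed
  also have "\<dots> \<le> weight_bound * defect * (t * 1)"
    unfolding I_cmult using t wb df
    by (intro mult_left_mono I_le_of_E_le initial_state) (auto simp: E_const initial_state)
  also have "\<dots> \<le> weight_bound * defect * T"
    using t wb df by (intro mult_left_mono) auto
  finally have "\<bar>\<kappa> * (II t (\<lambda>x. v (lost x) * theta (x 0)) - II t (\<lambda>x. v (lost x) * \<theta> (lost x)))\<bar>
      \<le> \<kappa> * (T * (weight_bound * defect))"
    unfolding II_diff abs_mult abs_of_pos[OF \<kappa>_pos]
    using \<kappa>_pos by (intro mult_left_mono) (auto simp: mult_ac)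
  with 1 show ?thesis unfolding moment_error_def right_diff_distrib by linarith
qed

text \<open>\<open>moment_average\<close> is applied to \<open>q\<close> with weight
  \<open>1\<close> and to \<open>q\<^sup>2\<close> with weight \<open>2 * q\<close>; these are the
  inputs of \<open>contraction\<close>, and \<open>q_expands\<close> returns to the original
  coordinate.\<close>

lemma mean_square_le:
  assumes t: "0 \<le> t" "t \<le> T"
  shows "EE (time t) (\<lambda>x. (lost x - \<Phi> t)\<^sup>2)
    \<le> (1 + 2 * \<beta> + 2 * \<kappa> * T) * moment_error T / (1 - \<beta> / a)\<^sup>2"
proof -
  have df: "0 \<le> defect" using a_pos by (simp add: defect_def)
  have qb: "\<bar>q (real i / real N)\<bar> \<le> b + b\<^sup>2 / a" if "i \<le> n" for i
    using q_bounds[OF lost_bounds[OF that]] by simp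
  have qb0: "0 \<le> b + b\<^sup>2 / a" using b_nonneg a_pos by simp
  then have wb1: "1 \<le> weight_bound" by (simp add: weight_bound_def)
  define \<delta> where "\<delta> = (real n / real N - \<beta>) / a + 1 / (2 * a * real N)"
  have \<delta>: "\<bar>\<delta>\<bar> \<le> defect"
    unfolding \<delta>_def defect_def using a_pos by (intro order.trans[OF abs_triangle_ineq]) simp
  have inc: "real N * (q (real (i + 1) / real N) - q (real i / real N)) = (1 - theta i) + \<delta>" for i
    unfolding q_increment theta_eq \<delta>_def using a_pos N_gt_0 by (simp add: field_simps)
  have df_mm: "defect \<le> mismatch" by (simp add: mismatch_def)
  have mm: "0 \<le> mismatch" using df df_mm by simp
  have E1: "\<bar>EE (time s) (\<lambda>x. q (lost x)) - \<kappa> * II s (\<lambda>x. \<theta> (lost x))\<bar> \<le> moment_error T"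
    if s: "0 \<le> s" "s \<le> T" for s
  proof -
    have "\<bar>EE (time s) (\<lambda>x. q (lost x)) - \<kappa> * II s (\<lambda>x. (\<lambda>_. 1) (lost x) * \<theta> (lost x))\<bar> \<le> moment_error T"
    proof (rule moment_average[OF s])
      fix i assume "i \<le> n"
      show "\<bar>real N * (q (real (i + 1) / real N) - q (real i / real N)) - 1 * (1 - theta i)\<bar>
          \<le> weight_bound * mismatch"
        unfolding inc using \<delta> df_mm mult_right_mono[OF wb1 mm] by simp
    qed (use wb1 in \<open>auto simp: q_def\<close>)
    then show ?thesis by simp
  qed
  have E2: "\<bar>EE (time s) (\<lambda>x. (q (lost x))\<^sup>2) - \<kappa> * II s (\<lambda>x. 2 * q (lost x) * \<theta> (lost x))\<bar> \<le> moment_error T"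
    if s: "0 \<le> s" "s \<le> T" for s
  proof -
    have "\<bar>EE (time s) (\<lambda>x. (\<lambda>y. (q y)\<^sup>2) (lost x)) - \<kappa> * II s (\<lambda>x. (\<lambda>y. 2 * q y) (lost x) * \<theta> (lost x))\<bar>
        \<le> moment_error T"
    proof (rule moment_average[OF s])
      fix i assume i: "i \<le> n"
      let ?x = "q (real i / real N)" and ?y = "q (real (i + 1) / real N)" and ?c = "1 - theta i"
      show "\<bar>2 * ?x\<bar> \<le> weight_bound" using qb[OF i] qb0 by (simp add: weight_bound_def)
      have "?y - ?x = (?c + \<delta>) / real N" using inc[of i] N_gt_0 by (simp add: field_simps)
      then have y: "?y = ?x + (?c + \<delta>) / real N" by simp
      have "real N * (?y\<^sup>2 - ?x\<^sup>2) - 2 * ?x * ?c = 2 * ?x * \<delta> + (?c + \<delta>)\<^sup>2 / real N"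
        unfolding y using N_gt_0 by (simp add: power2_eq_square field_simps)
      also have "\<bar>\<dots>\<bar> \<le> 2 * (b + b\<^sup>2 / a) * defect + (1 + defect)\<^sup>2 / real N"
      proof (intro order.trans[OF abs_triangle_ineq] add_mono)
        have "\<bar>2 * ?x\<bar> * \<bar>\<delta>\<bar> \<le> 2 * (b + b\<^sup>2 / a) * defect"
          using qb[OF i] \<delta> qb0 by (intro mult_mono) auto
        then show "\<bar>2 * ?x * \<delta>\<bar> \<le> 2 * (b + b\<^sup>2 / a) * defect" by (simp only: abs_mult)
        have "\<bar>?c + \<delta>\<bar> \<le> 1 + defect" using theta_bounds[OF i] \<delta> by linarith
        then have "\<bar>?c + \<delta>\<bar>\<^sup>2 \<le> (1 + defect)\<^sup>2" by (intro power_mono) auto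
        then show "\<bar>(?c + \<delta>)\<^sup>2 / real N\<bar> \<le> (1 + defect)\<^sup>2 / real N"
          by (simp add: divide_right_mono)
      qed
      also have "\<dots> \<le> weight_bound * defect + weight_bound * ((1 + defect)\<^sup>2 / real N)"
      proof (intro add_mono)
        show "2 * (b + b\<^sup>2 / a) * defect \<le> weight_bound * defect"
          using df by (intro mult_right_mono) (auto simp: weight_bound_def)
        show "(1 + defect)\<^sup>2 / real N \<le> weight_bound * ((1 + defect)\<^sup>2 / real N)"
          using mult_right_mono[OF wb1, of "(1 + defect)\<^sup>2 / real N"] by simp
      qed
      also have "\<dots> = weight_bound * mismatch" by (simp add: mismatch_def distrib_left)
      finally show "\<bar>real N * (?y\<^sup>2 - ?x\<^sup>2) - 2 * ?x * ?c\<bar> \<le> weight_bound * mismatch" .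
    qed (auto simp: q_def)
    then show ?thesis by simp
  qed
  have "(1 - \<beta> / a)\<^sup>2 * EE (time t) (\<lambda>x. (lost x - \<Phi> t)\<^sup>2)
      = EE (time t) (\<lambda>x. (1 - \<beta> / a)\<^sup>2 * (lost x - \<Phi> t)\<^sup>2)"
    by (simp add: E_cmult)
  also have "\<dots> \<le> EE (time t) (\<lambda>x. (q (lost x) - q (\<Phi> t))\<^sup>2)"
    using t \<Phi>_bounds[of t] by (intro E_mono initial_state q_expands) auto
  also have "\<dots> \<le> (1 + 2 * \<beta> + 2 * \<kappa> * T) * moment_error T"
    using E1 E2 by (intro contraction t) auto
  finally have "(1 - \<beta> / a)\<^sup>2 * EE (time t) (\<lambda>x. (lost x - \<Phi> t)\<^sup>2)
      \<le> (1 + 2 * \<beta> + 2 * \<kappa> * T) * moment_error T" .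
  moreover have "0 < (1 - \<beta> / a)\<^sup>2" by (rule zero_less_power[OF gap_pos])
  ultimately show ?thesis by (subst pos_le_divide_eq) (simp_all only: mult.commute)
qed

end

section \<open>Uniform convergence of monotone processes\<close>

lemma cadlag_restrict:
  assumes "cadlag f" shows "cadlag (\<lambda>t\<in>{0..}. f t)"
  unfolding cadlag_def
proof (intro conjI allI impI)
  fix t :: real assume t: "0 \<le> t"
  have "eventually (\<lambda>s. f s = (\<lambda>t\<in>{0..}. f t) s) (at_right t)"
    using eventually_at_right_less[of t] by eventually_elim (use t in auto)
  moreover have "(f \<longlongrightarrow> f t) (at_right t)" using assms t by (simp add: cadlag_def)
  ultimately show "((\<lambda>t\<in>{0..}. f t) \<longlongrightarrow> (\<lambda>t\<in>{0..}. f t) t) (at_right t)"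
    using t by (simp add: Lim_transform_eventually)
next
  fix t :: real assume t: "0 < t"
  have "eventually (\<lambda>s. f s = (\<lambda>t\<in>{0..}. f t) s) (at_left t)"
    using eventually_at_left_real[OF t] by eventually_elim auto
  moreover obtain l where "(f \<longlongrightarrow> l) (at_left t)" using assms t by (auto simp: cadlag_def)
  ultimately show "\<exists>l. ((\<lambda>t\<in>{0..}. f t) \<longlongrightarrow> l) (at_left t)"
    using Lim_transform_eventually by blast
qed

lemma restrict_in_cadlag_paths: "cadlag f \<Longrightarrow> (\<lambda>t\<in>{0..}. f t) \<in> cadlag_paths"
  by (simp add: cadlag_paths_def cadlag_restrict)

lemma cadlag_of_continuous_on:
  fixes f :: "real \<Rightarrow> real"
  assumes "continuous_on {0..} f" shows "cadlag f"
  unfolding cadlag_def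
proof (intro conjI allI impI)
  have lim: "(f \<longlongrightarrow> f t) (at t within {0..})" if "0 \<le> t" for t
    using assms that by (auto simp: continuous_on_def)
  show "(f \<longlongrightarrow> f t) (at_right t)" if "0 \<le> t" for t
    using that by (intro tendsto_within_subset[OF lim]) auto
  show "\<exists>l. (f \<longlongrightarrow> l) (at_left t)" if t: "0 < t" for t
  proof -
    have "at t within {0..} = at t" using t by (intro at_within_interior) simp
    then show ?thesis using lim[of t] t by (auto intro: tendsto_within_subset)
  qed
qed

lemma measurable_path:
  assumes "\<And>t. 0 \<le> t \<Longrightarrow> Y t \<in> borel_measurable M" "\<And>\<omega>. \<omega> \<in> space M \<Longrightarrow> cadlag (\<lambda>t. Y t \<omega>)"
  shows "(\<lambda>\<omega>. \<lambda>t\<in>{0..}. Y t \<omega>) \<in> M \<rightarrow>\<^sub>M cadlag_measure_space"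
  unfolding cadlag_measure_space_def
  by (intro measurable_restrict_space2 measurable_restrict)
    (use assms in \<open>auto intro!: restrict_in_cadlag_paths\<close>)

text \<open>On a grid cell both functions lie between their values at its ends. Index
  \<open>Suc m\<close> is the right end of the last cell.\<close>

lemma monotone_grid_close:
  fixes y \<phi> :: "real \<Rightarrow> real"
  assumes h: "0 < h" and y: "\<And>s t. 0 \<le> s \<Longrightarrow> s \<le> t \<Longrightarrow> y s \<le> y t"
    and \<phi>: "\<And>s t. 0 \<le> s \<Longrightarrow> s \<le> t \<Longrightarrow> \<phi> s \<le> \<phi> t"
    and osc: "\<And>i. i \<le> m \<Longrightarrow> \<phi> (real (Suc i) * h) - \<phi> (real i * h) < \<delta> / 3"
    and grid: "\<And>i. i \<le> Suc m \<Longrightarrow> \<bar>y (real i * h) - \<phi> (real i * h)\<bar> < \<delta> / 3"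
    and s: "0 \<le> s" "s \<le> real m * h"
  shows "\<bar>y s - \<phi> s\<bar> < \<delta>"
proof -
  define i where "i = nat \<lfloor>s / h\<rfloor>"
  have "0 \<le> s / h" using s h by simp
  then have i: "real i \<le> s / h" "s / h < real (Suc i)" unfolding i_def by linarith+
  then have si: "real i * h \<le> s" "s \<le> real (Suc i) * h"
    using h by (auto simp: pos_le_divide_eq pos_divide_less_eq)
  have "real i * h \<le> real m * h" using si s by linarith
  then have im: "i \<le> m" using h by simp
  have i0: "0 \<le> real i * h" using h by simp
  have "y (real i * h) \<le> y s" "y s \<le> y (real (Suc i) * h)"
      "\<phi> (real i * h) \<le> \<phi> s" "\<phi> s \<le> \<phi> (real (Suc i) * h)"
    using y[OF i0 si(1)] y[OF s(1) si(2)] \<phi>[OF i0 si(1)] \<phi>[OF s(1) si(2)] by auto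
  moreover have "\<bar>y (real i * h) - \<phi> (real i * h)\<bar> < \<delta> / 3"
      "\<bar>y (real (Suc i) * h) - \<phi> (real (Suc i) * h)\<bar> < \<delta> / 3"
    using grid[of i] grid[of "Suc i"] im by auto
  ultimately show ?thesis using osc[OF im] by linarith
qed

lemma ex_grid:
  fixes \<phi> :: "real \<Rightarrow> real"
  assumes cont: "continuous_on {0..} \<phi>" and \<delta>: "0 < \<delta>" and T: "0 \<le> T"
  obtains h m where "0 < h" "T \<le> real m * h"
    "\<And>i. i \<le> m \<Longrightarrow> \<phi> (real (Suc i) * h) - \<phi> (real i * h) < \<delta>"
proof -
  \<comment> \<open>Rounding up gives \<open>m * h \<le> T + 1\<close>, and one more step with
    \<open>h \<le> 1\<close> stays below \<open>T + 2\<close>.\<close>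
  have "uniformly_continuous_on {0..T + 2} \<phi>"
    by (intro compact_uniformly_continuous continuous_on_subset[OF cont]) auto
  then obtain \<eta> where \<eta>: "0 < \<eta>"
    "\<And>s t. s \<in> {0..T+2} \<Longrightarrow> t \<in> {0..T+2} \<Longrightarrow> dist t s < \<eta> \<Longrightarrow> dist (\<phi> t) (\<phi> s) < \<delta>"
    using \<delta> unfolding uniformly_continuous_on_def by metis
  define h where "h = min 1 (\<eta> / 2)"
  define m where "m = nat \<lceil>T / h\<rceil>"
  have h: "0 < h" "h \<le> 1" "h < \<eta>" using \<eta>(1) by (auto simp: h_def min_def)
  have m: "T / h \<le> real m" "real m \<le> T / h + 1" unfolding m_def using T h by auto
  have mh: "T \<le> real m * h" "real m * h \<le> T + 1"
    using m h by (auto simp: pos_divide_le_eq field_simps) 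
  have "\<phi> (real (Suc i) * h) - \<phi> (real i * h) < \<delta>" if "i \<le> m" for i
  proof -
    have "real i * h \<le> real m * h" using that h by (intro mult_right_mono) auto
    then have "real i * h \<le> T + 1" using mh by linarith
    then have "real i * h \<in> {0..T+2}" "real (Suc i) * h \<in> {0..T+2}"
      using h by (auto simp: distrib_right)
    moreover have "dist (real (Suc i) * h) (real i * h) < \<eta>"
      using h by (simp add: dist_real_def distrib_right)
    ultimately have "dist (\<phi> (real (Suc i) * h)) (\<phi> (real i * h)) < \<delta>" by (intro \<eta>(2))
    then show ?thesis by (simp add: dist_real_def)
  qed
  with that h mh show ?thesis by blast
qed

text \<open>The limit is a single path, so it suffices that \<open>H\<close> is close to its value
  there off an event of small probability. Monotonicity makes this event depend on finitely many
  times, so no measurability of uniform neighbourhoods has to be established.\<close>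

lemma ucc_weak_conv_of_monotone:
  fixes M :: "nat \<Rightarrow> 'a measure" and Y :: "nat \<Rightarrow> real \<Rightarrow> 'a \<Rightarrow> real" and \<phi> :: "real \<Rightarrow> real"
  assumes prob: "\<And>N. N \<ge> 1 \<Longrightarrow> prob_space (M N)"
    and meas: "\<And>N t. N \<ge> 1 \<Longrightarrow> 0 \<le> t \<Longrightarrow> Y N t \<in> borel_measurable (M N)"
    and path: "\<And>N \<omega>. N \<ge> 1 \<Longrightarrow> \<omega> \<in> space (M N) \<Longrightarrow> cadlag (\<lambda>t. Y N t \<omega>)"
    and mono: "\<And>N. N \<ge> 1 \<Longrightarrow> AE \<omega> in M N. \<forall>s t. 0 \<le> s \<longrightarrow> s \<le> t \<longrightarrow> Y N s \<omega> \<le> Y N t \<omega>"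
    and cont: "continuous_on {0..} \<phi>"
    and \<phi>_mono: "\<And>s t. 0 \<le> s \<Longrightarrow> s \<le> t \<Longrightarrow> \<phi> s \<le> \<phi> t"
    and conv: "\<And>t \<delta>. 0 \<le> t \<Longrightarrow> 0 < \<delta> \<Longrightarrow>
      (\<lambda>N. measure (M N) {\<omega> \<in> space (M N). \<delta> \<le> \<bar>Y N t \<omega> - \<phi> t\<bar>}) \<longlonglongrightarrow> 0"
  shows "ucc_weak_conv (\<lambda>N. process_law (M N) (Y N)) (return cadlag_measure_space (\<lambda>t\<in>{0..}. \<phi> t))"
  unfolding ucc_weak_conv_def
proof (intro allI impI, elim conjE)
  fix H assume H_cont: "continuous_map ucc_topology euclideanreal H"
    and H_meas: "H \<in> borel_measurable cadlag_measure_space"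
    and H_bdd: "bounded (H ` cadlag_paths)"
  let ?\<phi> = "\<lambda>t\<in>{0..}. \<phi> t" and ?L = "\<lambda>N. process_law (M N) (Y N)"
  let ?path = "\<lambda>N \<omega>. \<lambda>t\<in>{0..}. Y N t \<omega>"
  have \<phi>_path: "?\<phi> \<in> cadlag_paths"
    by (intro restrict_in_cadlag_paths cadlag_of_continuous_on cont)
  then have return: "integral\<^sup>L (return cadlag_measure_space ?\<phi>) H = H ?\<phi>"
    using H_meas by (simp add: integral_return)
  obtain B where B: "\<And>f. f \<in> cadlag_paths \<Longrightarrow> \<bar>H f\<bar> \<le> B"
    using H_bdd by (auto simp: bounded_iff)
  have B0: "0 \<le> B" using B[OF \<phi>_path] by simp
  have pm: "?path N \<in> M N \<rightarrow>\<^sub>M cadlag_measure_space" if "N \<ge> 1" for N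
    using meas path that by (intro measurable_path) auto
  have pc: "?path N \<omega> \<in> cadlag_paths" if "N \<ge> 1" "\<omega> \<in> space (M N)" for N \<omega>
    using path that by (intro restrict_in_cadlag_paths)
  show "(\<lambda>N. integral\<^sup>L (?L N) H) \<longlonglongrightarrow> integral\<^sup>L (return cadlag_measure_space ?\<phi>) H"
    unfolding return
  proof (rule LIMSEQ_I)
    fix r :: real assume r: "0 < r"
    let ?U = "{f \<in> topspace ucc_topology. H f \<in> ball (H ?\<phi>) (r / 2)}"
    have "openin ucc_topology ?U"
      using H_cont by (rule openin_continuous_map_preimage) simp
    moreover have "?\<phi> \<in> ?U" using \<phi>_path r by simp
    ultimately obtain T' \<delta> where \<delta>: "0 < \<delta>" and nbhd': "ucc_neighbourhood ?\<phi> T' \<delta> \<subseteq> ?U"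
      unfolding openin_ucc_topology by blast
    \<comment> \<open>The horizon given by the topology may be negative.\<close>
    define T where "T = max T' 0"
    have nbhd: "\<bar>H f - H ?\<phi>\<bar> < r / 2"
      if "f \<in> cadlag_paths" "\<And>s. 0 \<le> s \<Longrightarrow> s \<le> T \<Longrightarrow> \<bar>f s - \<phi> s\<bar> < \<delta>" for f
    proof -
      have "f \<in> ucc_neighbourhood ?\<phi> T' \<delta>"
        using that by (auto simp: ucc_neighbourhood_def T_def)
      then have "H f \<in> ball (H ?\<phi>) (r / 2)" using nbhd' by blast
      then show ?thesis by (simp add: dist_real_def abs_minus_commute)
    qed
    obtain h m where h: "0 < h" "T \<le> real m * h"
      and osc: "\<And>i. i \<le> m \<Longrightarrow> \<phi> (real (Suc i) * h) - \<phi> (real i * h) < \<delta> / 3"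
      using ex_grid[OF cont, of "\<delta> / 3" T] \<delta> by (auto simp: T_def)
    define A where "A N i = {\<omega> \<in> space (M N). \<delta> / 3 \<le> \<bar>Y N (real i * h) \<omega> - \<phi> (real i * h)\<bar>}" for N i
    define p where "p N = (\<Sum>i\<le>Suc m. measure (M N) (A N i))" for N
    have "p \<longlonglongrightarrow> (\<Sum>i\<le>Suc m. 0)"
      unfolding p_def A_def using h \<delta> by (intro tendsto_sum conv) auto
    then have "(\<lambda>N. 2 * B * p N) \<longlonglongrightarrow> 2 * B * 0" by (intro tendsto_intros) simp
    then have "\<forall>\<^sub>F N in sequentially. 2 * B * p N < r / 2"
      using r by (intro order_tendstoD) auto
    then obtain N0 where N0: "\<And>N. N \<ge> N0 \<Longrightarrow> 2 * B * p N < r / 2"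
      by (auto simp: eventually_sequentially)
    show "\<exists>no. \<forall>N\<ge>no. norm (integral\<^sup>L (?L N) H - H ?\<phi>) < r"
    proof (intro exI allI impI)
      fix N assume "max N0 1 \<le> N"
      then have N: "N \<ge> 1" "2 * B * p N < r / 2" using N0 by auto
      interpret prob_space "M N" by (rule prob[OF N(1)])
      have A: "A N i \<in> sets (M N)" for i
        unfolding A_def using h by (measurable, intro meas) (use N in auto)
      define bad where "bad = (\<Union>i\<le>Suc m. A N i)"
      have bad: "bad \<in> sets (M N)" unfolding bad_def using A by auto
      have "measure (M N) bad \<le> p N"
        unfolding bad_def p_def using A by (intro finite_measure_subadditive_finite) auto
      then have bad_le: "2 * B * measure (M N) bad < r / 2"
        using N(2) B0 mult_left_mono[of "measure (M N) bad" "p N" "2 * B"] by simp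
      define f where "f \<omega> = H (?path N \<omega>) - H ?\<phi>" for \<omega>
      have f_meas: "f \<in> borel_measurable (M N)"
        unfolding f_def using measurable_compose[OF pm[OF N(1)] H_meas] by measurable
      have f_bdd: "\<bar>f \<omega>\<bar> \<le> 2 * B" if "\<omega> \<in> space (M N)" for \<omega>
        unfolding f_def using B[OF pc[OF N(1) that]] B[OF \<phi>_path] by linarith
      have f_int: "integrable (M N) f"
        by (rule integrable_const_bound[of _ "2 * B"]) (use f_bdd f_meas in auto)
      have Hp_int: "integrable (M N) (\<lambda>\<omega>. H (?path N \<omega>))"
        by (rule integrable_const_bound[of _ B])
          (use B pc[OF N(1)] measurable_compose[OF pm[OF N(1)] H_meas] in auto)
      have "integral\<^sup>L (?L N) H = (\<integral>\<omega>. H (?path N \<omega>) \<partial>M N)"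
        unfolding process_law_def by (rule integral_distr[OF pm[OF N(1)] H_meas])
      then have "integral\<^sup>L (?L N) H - H ?\<phi> = integral\<^sup>L (M N) f"
        unfolding f_def using Hp_int by (simp add: prob_space)
      also have "norm \<dots> \<le> (\<integral>\<omega>. \<bar>f \<omega>\<bar> \<partial>M N)" using integral_norm_bound[of "M N" f] by simp
      \<comment> \<open>Off \<open>bad\<close> the path lies in the neighbourhood where
        \<open>H\<close> varies by less than \<open>r / 2\<close>; on \<open>bad\<close> only
        boundedness of \<open>H\<close> is used.\<close>
      also have "\<dots> \<le> (\<integral>\<omega>. r / 2 + 2 * B * indicator bad \<omega> \<partial>M N)"
      proof (rule integral_mono_AE)
        show "integrable (M N) (\<lambda>\<omega>. r / 2 + 2 * B * indicator bad \<omega>)"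
          using bad by (auto simp: emeasure_eq_measure)
        show "AE \<omega> in M N. \<bar>f \<omega>\<bar> \<le> r / 2 + 2 * B * indicator bad \<omega>"
          using mono[OF N(1)] AE_space
        proof eventually_elim
          case (elim \<omega>)
          show ?case
          proof (cases "\<omega> \<in> bad")
            case True
            then show ?thesis using f_bdd[of \<omega>] elim r by simp
          next
            case False
            have grid: "\<bar>Y N (real i * h) \<omega> - \<phi> (real i * h)\<bar> < \<delta> / 3" if "i \<le> Suc m" for i
              using False that elim unfolding bad_def A_def by force
            have "\<bar>f \<omega>\<bar> < r / 2"
              unfolding f_def
            proof (rule nbhd)
              show "?path N \<omega> \<in> cadlag_paths" using pc N elim by simp
              fix s :: real assume s: "0 \<le> s" "s \<le> T"
              have "\<bar>Y N s \<omega> - \<phi> s\<bar> < \<delta>"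
                by (rule monotone_grid_close[where h = h and m = m])
                  (use h elim \<phi>_mono osc grid s in auto)
              then show "\<bar>?path N \<omega> s - \<phi> s\<bar> < \<delta>" using s by simp
            qed
            then show ?thesis using False by simp
          qed
        qed
      qed (use f_int in auto)
      also have "\<dots> = r / 2 + 2 * B * measure (M N) bad"
        using bad by (subst Bochner_Integration.integral_add) (auto simp: emeasure_eq_measure prob_space)
      finally show "norm (integral\<^sup>L (?L N) H - H ?\<phi>) < r" using bad_le by simp
    qed
  qed
qed

section \<open>The lost copies as a monotone process\<close>

lemma tendsto_of_nat_discrete:
  fixes f :: "'b \<Rightarrow> nat"
  assumes "(f \<longlongrightarrow> l) F"
  shows "((\<lambda>x. real (f x)) \<longlongrightarrow> real l) F"
proof (rule tendsto_eventually)
  show "\<forall>\<^sub>F x in F. real (f x) = real l"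
    using assms unfolding tendsto_discrete by eventually_elim simp
qed

lemma tendsto_coordinate:
  fixes f :: "'b \<Rightarrow> nat \<Rightarrow> nat"
  assumes "(f \<longlongrightarrow> l) F"
  shows "((\<lambda>x. f x i) \<longlongrightarrow> l i) F"
  using continuous_on_tendsto_compose[OF continuous_on_product_coordinates[of i] assms] by simp

lemma cadlag_coordinate:
  fixes f :: "real \<Rightarrow> nat \<Rightarrow> nat"
  assumes f: "cadlag f" and c: "0 < c"
  shows "cadlag (\<lambda>t. real (f (c * t) 0) / r)"
  unfolding cadlag_def
proof (intro conjI allI impI)
  fix t :: real assume t: "0 \<le> t"
  have "filterlim (\<lambda>s. c * s) (at_right (c * t)) (at_right t)"
    unfolding filterlim_at
    using c by (auto intro!: tendsto_intros simp: eventually_at_filter)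
  moreover have "(f \<longlongrightarrow> f (c * t)) (at_right (c * t))" using f t c by (simp add: cadlag_def)
  ultimately have "((\<lambda>s. f (c * s)) \<longlongrightarrow> f (c * t)) (at_right t)" by (rule filterlim_compose[rotated])
  then show "((\<lambda>t. real (f (c * t) 0) / r) \<longlongrightarrow> real (f (c * t) 0) / r) (at_right t)"
    by (intro tendsto_divide_zero tendsto_of_nat_discrete tendsto_coordinate
      bounded_linear.tendsto[OF bounded_linear_divide])
next
  fix t :: real assume t: "0 < t"
  have "filterlim (\<lambda>s. c * s) (at_left (c * t)) (at_left t)"
    unfolding filterlim_at
    using c by (auto intro!: tendsto_intros simp: eventually_at_filter)
  moreover obtain l where "(f \<longlongrightarrow> l) (at_left (c * t))" using f mult_pos_pos[OF c t] unfolding cadlag_def by blast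
  ultimately have "((\<lambda>s. f (c * s)) \<longlongrightarrow> l) (at_left t)" by (metis filterlim_compose)
  then have "((\<lambda>t. real (f (c * t) 0) / r) \<longlongrightarrow> real (l 0) / r) (at_left t)"
    by (intro tendsto_of_nat_discrete tendsto_coordinate
      bounded_linear.tendsto[OF bounded_linear_divide])
  then show "\<exists>l. ((\<lambda>t. real (f (c * t) 0) / r) \<longlongrightarrow> l) (at_left t)" by blast
qed

text \<open>Only pairs of times are kept from the finite-dimensional laws: they give the law at one
  time and the almost sure order of two values of \<open>x 0\<close>.\<close>

locale storage_process = storage lam mu d n N P + prob_space M
  for lam mu :: real and d n N :: nat and P and M :: "'a measure" +
  fixes X :: "real \<Rightarrow> 'a \<Rightarrow> nat \<Rightarrow> nat"
  assumes X_measurable: "\<And>t. 0 \<le> t \<Longrightarrow> X t \<in> M \<rightarrow>\<^sub>M count_space S"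
    and X_cadlag: "\<And>\<omega>. \<omega> \<in> space M \<Longrightarrow> cadlag (\<lambda>t. X t \<omega>)"
    and X_markov: "\<And>s t x y. 0 \<le> s \<Longrightarrow> s < t \<Longrightarrow> x \<in> S \<Longrightarrow> y \<in> S \<Longrightarrow>
      prob {\<omega> \<in> space M. X s \<omega> = x \<and> X t \<omega> = y}
        = prob {\<omega> \<in> space M. X s \<omega> = x} * P (t - s) x y"
    and X_initial: "AE \<omega> in M. X 0 \<omega> = x\<^sub>0"
begin

lemma X_in_S: "0 \<le> t \<Longrightarrow> \<omega> \<in> space M \<Longrightarrow> X t \<omega> \<in> S"
  using measurable_space[OF X_measurable] by simp

lemma X_eq_sets: "0 \<le> t \<Longrightarrow> {\<omega> \<in> space M. X t \<omega> = x} \<in> sets M"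
proof -
  assume t: "0 \<le> t"
  have "X t -` ({x} \<inter> S) \<inter> space M \<in> sets M"
    by (rule measurable_sets[OF X_measurable[OF t]]) simp
  also have "X t -` ({x} \<inter> S) \<inter> space M = {\<omega> \<in> space M. X t \<omega> = x}"
    using X_in_S[OF t] by auto
  finally show ?thesis .
qed

lemma prob_X_eq:
  assumes "0 \<le> t" "y \<in> S"
  shows "prob {\<omega> \<in> space M. X t \<omega> = y} = P t x\<^sub>0 y"
proof (cases "t = 0")
  case True
  show ?thesis
  proof (cases "y = x\<^sub>0")
    case eq: True
    have "prob {\<omega> \<in> space M. X 0 \<omega> = x\<^sub>0} = 1"
      using X_initial X_eq_sets[of 0] by (subst prob_Collect_eq_1) auto
    then show ?thesis using True eq P_zero[OF initial_state initial_state] by simp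
  next
    case False
    have "AE \<omega> in M. \<not> X 0 \<omega> = y" using X_initial by eventually_elim (use False in auto)
    then have "prob {\<omega> \<in> space M. X 0 \<omega> = y} = 0"
      using X_eq_sets[of 0] by (subst prob_Collect_eq_0) auto
    then show ?thesis using True False P_zero[OF initial_state assms(2)] by auto
  qed
next
  case False
  have "prob {\<omega> \<in> space M. X t \<omega> = y} = prob {\<omega> \<in> space M. X 0 \<omega> = x\<^sub>0 \<and> X t \<omega> = y}"
  proof (rule measure_eq_AE)
    show "AE \<omega> in M. (\<omega> \<in> {\<omega> \<in> space M. X t \<omega> = y}) = (\<omega> \<in> {\<omega> \<in> space M. X 0 \<omega> = x\<^sub>0 \<and> X t \<omega> = y})"
      using X_initial by eventually_elim auto
    have "{\<omega> \<in> space M. X 0 \<omega> = x\<^sub>0 \<and> X t \<omega> = y} = {\<omega> \<in> space M. X 0 \<omega> = x\<^sub>0} \<inter> {\<omega> \<in> space M. X t \<omega> = y}"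
      by auto
    then show "{\<omega> \<in> space M. X 0 \<omega> = x\<^sub>0 \<and> X t \<omega> = y} \<in> sets M"
      using X_eq_sets[of 0] X_eq_sets[OF assms(1)] by auto
  qed (rule X_eq_sets[OF assms(1)])
  also have "\<dots> = prob {\<omega> \<in> space M. X 0 \<omega> = x\<^sub>0} * P (t - 0) x\<^sub>0 y"
    using False assms by (intro X_markov initial_state) auto
  also have "prob {\<omega> \<in> space M. X 0 \<omega> = x\<^sub>0} = 1"
    using X_initial X_eq_sets[of 0] by (subst prob_Collect_eq_1) auto
  finally show ?thesis by simp
qed

text \<open>Markov's inequality, with \<open>f\<close> dominating the indicator of
  \<open>R\<close>.\<close>

lemma prob_X_le_EE:
  assumes t: "0 \<le> t" and f: "\<And>y. y \<in> S \<Longrightarrow> 0 \<le> f y" "\<And>y. y \<in> S \<Longrightarrow> R y \<Longrightarrow> 1 \<le> f y"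
  shows "prob {\<omega> \<in> space M. R (X t \<omega>)} \<le> EE t f"
proof -
  have "{\<omega> \<in> space M. R (X t \<omega>)} = (\<Union>y\<in>{y \<in> S. R y}. {\<omega> \<in> space M. X t \<omega> = y})"
    using X_in_S[OF t] by auto
  then have "prob {\<omega> \<in> space M. R (X t \<omega>)} \<le> (\<Sum>y\<in>{y \<in> S. R y}. prob {\<omega> \<in> space M. X t \<omega> = y})"
    using finite_S X_eq_sets[OF t] by (simp only:) (intro finite_measure_subadditive_finite, auto)
  also have "\<dots> = (\<Sum>y\<in>{y \<in> S. R y}. P t x\<^sub>0 y)" using t by (intro sum.cong prob_X_eq) auto
  also have "\<dots> \<le> (\<Sum>y\<in>{y \<in> S. R y}. P t x\<^sub>0 y * f y)"
  proof (intro sum_mono)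
    fix y assume "y \<in> {y \<in> S. R y}"
    then show "P t x\<^sub>0 y \<le> P t x\<^sub>0 y * f y"
      using mult_left_mono[OF f(2) P_nonneg[OF t initial_state]] by auto
  qed
  also have "\<dots> \<le> EE t f"
    unfolding E_def using finite_S f(1) P_nonneg[OF t initial_state] by (intro sum_mono2) auto
  finally show ?thesis .
qed

text \<open>By \<open>E_state_0_less\<close> the transition probability to a state with smaller
  \<open>x 0\<close> is zero, and only finitely many pairs of states must be excluded.\<close>

lemma AE_state_0_le:
  assumes "0 \<le> s" "s < t"
  shows "AE \<omega> in M. X s \<omega> 0 \<le> X t \<omega> 0"
proof -
  have "AE \<omega> in M. \<forall>x\<in>S. \<forall>y\<in>S. y 0 < x 0 \<longrightarrow> \<not> (X s \<omega> = x \<and> X t \<omega> = y)"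
  proof (intro AE_finite_allI finite_S)
    fix x y assume xy: "x \<in> S" "y \<in> S"
    show "AE \<omega> in M. y 0 < x 0 \<longrightarrow> \<not> (X s \<omega> = x \<and> X t \<omega> = y)"
    proof (cases "y 0 < x 0")
      case True
      have "P (t - s) x y = P (t - s) x y * of_bool (y 0 < x 0)" using True by simp
      also have "\<dots> \<le> E x (t - s) (\<lambda>y. of_bool (y 0 < x 0))"
        unfolding E_def using xy assms finite_S P_nonneg
        by (intro member_le_sum[of y S "\<lambda>y. P (t - s) x y * of_bool (y 0 < x 0)"]) auto
      also have "\<dots> = 0" using xy assms by (intro E_state_0_less) auto
      finally have "P (t - s) x y = 0" using P_nonneg[of "t - s" x y] xy assms by simp
      then have 0: "prob {\<omega> \<in> space M. X s \<omega> = x \<and> X t \<omega> = y} = 0"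
        using X_markov[of s t x y] xy assms by simp
      have "{\<omega> \<in> space M. X s \<omega> = x \<and> X t \<omega> = y} = {\<omega> \<in> space M. X s \<omega> = x} \<inter> {\<omega> \<in> space M. X t \<omega> = y}"
        by auto
      then have "{\<omega> \<in> space M. X s \<omega> = x \<and> X t \<omega> = y} \<in> sets M"
        using X_eq_sets[of s] X_eq_sets[of t] assms by auto
      with 0 have "AE \<omega> in M. \<not> (X s \<omega> = x \<and> X t \<omega> = y)"
        by (subst (asm) prob_Collect_eq_0) auto
      then show ?thesis by simp
    qed simp
  qed
  with AE_space show ?thesis
  proof eventually_elim
    case (elim \<omega>)
    then show ?case using X_in_S[of s \<omega>] X_in_S[of t \<omega>] assms by force
  qed
qed

text \<open>One null set serves all rational times. An integer-valued right-continuous coordinate is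
  constant just after each time, so real times can be moved to rational ones.\<close>

lemma AE_state_0_mono: "AE \<omega> in M. \<forall>s t. 0 \<le> s \<longrightarrow> s \<le> t \<longrightarrow> X s \<omega> 0 \<le> X t \<omega> 0"
proof -
  have "AE \<omega> in M. \<forall>s\<in>{s \<in> \<rat>. 0 \<le> s}. \<forall>t\<in>{t \<in> \<rat>. s < t}. X s \<omega> 0 \<le> X t \<omega> 0"
    using countable_rat
    by (intro AE_ball_countable' AE_state_0_le) (auto intro: countable_subset[OF _ countable_rat])
  with AE_space show ?thesis
  proof eventually_elim
    case (elim \<omega>)
    have right: "\<exists>b>s. \<forall>r. s < r \<longrightarrow> r < b \<longrightarrow> X r \<omega> 0 = X s \<omega> 0" if "0 \<le> s" for s
    proof -
      have "((\<lambda>t. X t \<omega>) \<longlongrightarrow> X s \<omega>) (at_right s)"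
        using X_cadlag[of \<omega>] elim that by (simp add: cadlag_def)
      then have "((\<lambda>t. X t \<omega> 0) \<longlongrightarrow> X s \<omega> 0) (at_right s)" by (rule tendsto_coordinate)
      then have "\<forall>\<^sub>F t in at_right s. X t \<omega> 0 = X s \<omega> 0" by (simp add: tendsto_discrete)
      then show ?thesis by (auto simp: eventually_at_right_field)
    qed
    show ?case
    proof (intro allI impI)
      fix s t :: real assume st: "0 \<le> s" "s \<le> t"
      show "X s \<omega> 0 \<le> X t \<omega> 0"
      proof (cases "s = t")
        case False
        obtain b where b: "s < b" "\<And>r. s < r \<Longrightarrow> r < b \<Longrightarrow> X r \<omega> 0 = X s \<omega> 0"
          using right[OF st(1)] by blast
        obtain c where c: "t < c" "\<And>r. t < r \<Longrightarrow> r < c \<Longrightarrow> X r \<omega> 0 = X t \<omega> 0"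
          using right[of t] st by auto
        obtain r where r: "r \<in> \<rat>" "s < r" "r < min b t"
          \<comment> \<open>Keeping \<open>r\<close> below \<open>t\<close> preserves
            \<open>r < r'\<close> although both times move to the right.\<close>
          using Rats_dense_in_real[of s "min b t"] b st False by auto
        obtain r' where r': "r' \<in> \<rat>" "t < r'" "r' < c"
          using Rats_dense_in_real[of t c] c by auto
        have "X r \<omega> 0 \<le> X r' \<omega> 0" using elim r r' st by auto
        then show ?thesis using b(2)[of r] c(2)[of r'] r r' by simp
      qed simp
    qed
  qed
qed

end

lemma storage_process_of_markov_jump_process:
  assumes X: "markov_jump_process M (states d n) (jump_rate lam mu d N) X"
    and init: "AE \<omega> in M. X 0 \<omega> = (\<lambda>i. if i = d then n else 0)"
    and "0 < lam" "0 < mu" "2 \<le> d" "1 \<le> N"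
  shows "\<exists>P. storage_process lam mu d n N P M X"
proof -
  let ?S = "states d n"
  obtain P where P: "transition_semigroup ?S (jump_rate lam mu d N) P"
    and fdd: "\<And>n (\<tau>::nat \<Rightarrow> real) x. 0 \<le> \<tau> 0 \<Longrightarrow> (\<And>i. i < n \<Longrightarrow> \<tau> i < \<tau> (Suc i)) \<Longrightarrow>
        (\<And>i. i \<le> n \<Longrightarrow> x i \<in> ?S) \<Longrightarrow>
        measure M {\<omega>\<in>space M. \<forall>i\<le>n. X (\<tau> i) \<omega> = x i} =
          measure M {\<omega>\<in>space M. X (\<tau> 0) \<omega> = x 0} * (\<Prod>i<n. P (\<tau> (Suc i) - \<tau> i) (x i) (x (Suc i)))"
    using X unfolding markov_jump_process_def by blast
  interpret prob_space M using X by (simp add: markov_jump_process_def)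
  have "storage_process lam mu d n N P M X"
  proof unfold_locales
    fix s t :: real and x y assume st: "0 \<le> s" "s < t" and xy: "x \<in> ?S" "y \<in> ?S"
    have "(\<forall>i\<le>Suc 0. X (if i = 0 then s else t) \<omega> = (if i = 0 then x else y)) \<longleftrightarrow> X s \<omega> = x \<and> X t \<omega> = y" for \<omega>
      by (auto simp: le_Suc_eq)
    then show "prob {\<omega> \<in> space M. X s \<omega> = x \<and> X t \<omega> = y} = prob {\<omega> \<in> space M. X s \<omega> = x} * P (t - s) x y"
      using fdd[of "\<lambda>i. if i = 0 then s else t" "Suc 0" "\<lambda>i. if i = 0 then x else y"] st xy by simp
  qed (use X P init assms(3-) in \<open>auto simp: markov_jump_process_def\<close>)
  then show ?thesis by (rule exI[of _ P])
qed

theorem theorem2: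
  fixes lam \<mu> \<rho> \<beta> \<gamma> :: real and d :: nat and F :: "nat \<Rightarrow> nat"
    and M :: "nat \<Rightarrow> 'a measure" and X :: "nat \<Rightarrow> real \<Rightarrow> 'a \<Rightarrow> nat \<Rightarrow> nat"
  assumes "lam > 0" and "\<mu> > 0" and "\<rho> = lam / \<mu>" and "d \<ge> 2"
    and "\<beta> > 0" and "\<gamma> \<ge> 0"
    and "(\<lambda>N. (real (F N) - real N * \<beta>) / sqrt (real N)) \<longlonglongrightarrow> \<gamma>"
    and "\<And>N. N \<ge> 1 \<Longrightarrow> markov_jump_process (M N) (states d (F N)) (jump_rate lam \<mu> d N) (X N)"
    and "\<And>N. N \<ge> 1 \<Longrightarrow> AE \<omega> in M N. X N 0 \<omega> = (\<lambda>i. if i = d then F N else 0)"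
    and "real d * \<beta> * \<mu> < lam"
  shows "\<exists>\<Phi>. (\<forall>t\<ge>0. \<Phi> t \<in> {0..\<beta>} \<and> limit_equation lam \<rho> \<beta> d t (\<Phi> t) \<and>
               (\<forall>y\<in>{0..\<beta>}. limit_equation lam \<rho> \<beta> d t y \<longrightarrow> y = \<Phi> t)) \<and>
             ucc_weak_conv
               (\<lambda>N. process_law (M N) (\<lambda>t \<omega>. real (X N (real N ^ (d - 1) * t) \<omega> 0) / real N))
               (return cadlag_measure_space (\<lambda>t\<in>{0..}. \<Phi> t))"
proof -
  define a where "a = \<rho> / real d"
  define \<kappa> where "\<kappa> = lam * (fact (d - 1) / \<rho> ^ (d - 1))"
  have d_pos: "0 < real d" using \<open>d \<ge> 2\<close> by simp
  have a_eq: "a = lam / (\<mu> * real d)" by (simp add: a_def \<open>\<rho> = lam / \<mu>\<close>)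
  have \<beta>_less: "\<beta> < a"
    using assms(2,10) d_pos by (simp add: a_eq pos_less_divide_eq mult_ac)
  \<comment> \<open>Both sides agree because
    \<open>mu * (mu / lam) ^ (d - 2) = lam / \<rho> ^ (d - 1)\<close>.\<close>
  have \<kappa>_eq: "\<kappa> = stable_storage.drift_const lam \<mu> d" if "stable_storage lam \<mu> d n N P b z" for n N P b z
  proof -
    have "d - 1 = Suc (d - 2)" using \<open>d \<ge> 2\<close> by simp
    then show ?thesis
      unfolding \<kappa>_def stable_storage.drift_const_def[OF that] \<open>\<rho> = lam / \<mu>\<close>
      using \<open>lam > 0\<close> \<open>\<mu> > 0\<close> by (simp add: power_divide field_simps)
  qed
  have "fluid_limit \<beta> a \<kappa>"
    using assms(1-5) \<beta>_less by unfold_locales (auto simp: \<kappa>_def)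
  then interpret fluid_limit \<beta> a \<kappa> .
  have level: "limit_equation lam \<rho> \<beta> d t y \<longleftrightarrow> level y = exp (- \<kappa> * t)" for t y
    by (simp add: limit_equation_def level_def \<kappa>_def flip: a_def)

  have F_lim: "(\<lambda>N. real (F N) / real N) \<longlonglongrightarrow> \<beta>"
  proof -
    have "(\<lambda>N. (real (F N) - real N * \<beta>) / sqrt (real N) * inverse (sqrt (real N)) + \<beta>) \<longlonglongrightarrow> \<gamma> * 0 + \<beta>"
      by (intro tendsto_intros assms(7) tendsto_inverse_0_at_top
        filterlim_compose[OF sqrt_at_top filterlim_real_sequentially])
    moreover have "\<forall>\<^sub>F N in sequentially.
        (real (F N) - real N * \<beta>) / sqrt (real N) * inverse (sqrt (real N)) + \<beta> = real (F N) / real N"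
      using eventually_gt_at_top[of 0]
      by eventually_elim (simp add: field_simps flip: real_sqrt_mult)
    ultimately show ?thesis by (simp add: Lim_transform_eventually)
  qed
  \<comment> \<open>\<open>b\<close> and \<open>z\<close> divide the gap between \<beta> and
    \<open>a\<close>: \<open>z * b = (a + b) / 2 < a\<close> is \<open>stable\<close> up to the
    factor \<open>\<mu> * d\<close>.\<close>
  define b where "b = (\<beta> + a) / 2"
  have b: "0 < b" "\<beta> < b" "b < a" using \<beta>_less \<open>\<beta> > 0\<close> by (auto simp: b_def)
  define z where "z = (1 + a / b) / 2"
  have z: "1 < z" using b by (simp add: z_def)
  have "z * b < a" using b by (simp add: z_def field_simps)
  then have stable: "z * (\<mu> * real d * b) < lam"
    using assms(2) d_pos unfolding a_eq by (simp add: pos_less_divide_eq mult_ac)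
  have "\<forall>\<^sub>F N in sequentially. real (F N) / real N < b"
    by (rule order_tendstoD(2)[OF F_lim b(2)])
  then have F_le: "\<forall>\<^sub>F N in sequentially. N \<ge> 1 \<and> real (F N) \<le> b * real N"
    using eventually_ge_at_top[of 1] by eventually_elim (auto simp: pos_divide_less_eq)

  have process: "\<exists>P. storage_process lam \<mu> d (F N) N P (M N) (X N)" if "N \<ge> 1" for N
    using assms that by (intro storage_process_of_markov_jump_process) auto
  let ?Y = "\<lambda>N t \<omega>. real (X N (real N ^ (d - 1) * t) \<omega> 0) / real N"
  have conv: "(\<lambda>N. measure (M N) {\<omega> \<in> space (M N). \<delta> \<le> \<bar>?Y N t \<omega> - \<Phi> t\<bar>}) \<longlonglongrightarrow> 0"
    if t: "0 \<le> t" and \<delta>: "0 < \<delta>" for t \<delta>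
  proof -
    \<comment> \<open>The exported constant takes neither \<open>N\<close> nor \<open>F N\<close> as
      an argument, so it stays fixed in the limit.\<close>
    define C where "C = stable_storage.average_const lam \<mu> d b z t"
    define df where "df N = \<bar>real (F N) / real N - \<beta>\<bar> / a + 1 / (2 * a * real N)" for N
    define mm where "mm N = df N + (1 + df N)\<^sup>2 / real N" for N
    define wb where "wb = 1 + 2 * (b + b\<^sup>2 / a)"
    define err where "err N = (1 + 2 * \<beta> + 2 * \<kappa> * t)
       * (wb * C * ((1 + mm N) / sqrt (real N) + mm N) + \<kappa> * (t * (wb * df N))) / (1 - \<beta> / a)\<^sup>2" for N
    have inv: "(\<lambda>N. 1 / real N) \<longlonglongrightarrow> 0" by (rule lim_1_over_n)
    have inv_sqrt: "(\<lambda>N. inverse (sqrt (real N))) \<longlonglongrightarrow> 0"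
      by (intro tendsto_inverse_0_at_top filterlim_compose[OF sqrt_at_top filterlim_real_sequentially])
    have "(\<lambda>N. \<bar>real (F N) / real N - \<beta>\<bar> / a + 1 / (2 * a) * (1 / real N)) \<longlonglongrightarrow> \<bar>\<beta> - \<beta>\<bar> / a + 1 / (2 * a) * 0"
      using a_pos by (intro tendsto_intros F_lim inv) auto
    then have df: "df \<longlonglongrightarrow> 0" by (simp add: df_def[abs_def])
    have "(\<lambda>N. df N + (1 + df N)\<^sup>2 * (1 / real N)) \<longlonglongrightarrow> 0 + (1 + 0)\<^sup>2 * 0"
      by (intro tendsto_intros df inv)
    then have mm: "mm \<longlonglongrightarrow> 0" by (simp add: mm_def[abs_def])
    have "(\<lambda>N. (1 + 2 * \<beta> + 2 * \<kappa> * t)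
        * (wb * C * ((1 + mm N) * inverse (sqrt (real N)) + mm N) + \<kappa> * (t * (wb * df N))) / (1 - \<beta> / a)\<^sup>2)
      \<longlonglongrightarrow> (1 + 2 * \<beta> + 2 * \<kappa> * t)
        * (wb * C * ((1 + 0) * 0 + 0) + \<kappa> * (t * (wb * 0))) / (1 - \<beta> / a)\<^sup>2"
      using gap_pos by (intro tendsto_intros df mm inv_sqrt) auto
    then have err: "(\<lambda>N. err N / \<delta>\<^sup>2) \<longlonglongrightarrow> 0"
      using tendsto_divide_zero[of err sequentially "\<delta>\<^sup>2"] by (simp add: err_def[abs_def] divide_inverse)
    show ?thesis
    proof (rule tendsto_sandwich[OF _ _ tendsto_const err])
      show "\<forall>\<^sub>F N in sequentially. measure (M N) {\<omega> \<in> space (M N). \<delta> \<le> \<bar>?Y N t \<omega> - \<Phi> t\<bar>} \<le> err N / \<delta>\<^sup>2"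
        using F_le
      proof eventually_elim
        case (elim N)
        then obtain P where "storage_process lam \<mu> d (F N) N P (M N) (X N)" using process by blast
        then interpret storage_process lam \<mu> d "F N" N P "M N" "X N" .
        interpret stable_storage lam \<mu> d "F N" N P b z
          using elim z stable by unfold_locales auto
        interpret storage_fluid lam \<mu> d "F N" N P b z \<beta> a \<kappa>
          using a_eq \<kappa>_eq[OF stable_storage_axioms] by unfold_locales
        have "measure (M N) {\<omega> \<in> space (M N). \<delta> \<le> \<bar>?Y N t \<omega> - \<Phi> t\<bar>}
           \<le> EE (time t) (\<lambda>x. 1 / \<delta>\<^sup>2 * (lost x - \<Phi> t)\<^sup>2)"
        proof (rule prob_X_le_EE[where R = "\<lambda>x. \<delta> \<le> \<bar>lost x - \<Phi> t\<bar>"])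
          fix y assume "\<delta> \<le> \<bar>lost y - \<Phi> t\<bar>"
          then have "\<delta>\<^sup>2 \<le> \<bar>lost y - \<Phi> t\<bar>\<^sup>2" using \<delta> by (intro power_mono) auto
          then show "1 \<le> 1 / \<delta>\<^sup>2 * (lost y - \<Phi> t)\<^sup>2" using \<delta> by simp
        qed (use t in auto)
        also have "\<dots> \<le> 1 / \<delta>\<^sup>2 * err N"
          unfolding E_cmult
        proof (rule mult_left_mono)
          show "EE (time t) (\<lambda>x. (lost x - \<Phi> t)\<^sup>2) \<le> err N"
            using mean_square_le[OF t order.refl]
            unfolding moment_error_def mismatch_def defect_def weight_bound_def
              err_def mm_def df_def wb_def C_def .
        qed simp
        finally show ?case by simp
      qed
    qed simp
  qed

  have "ucc_weak_conv (\<lambda>N. process_law (M N) (?Y N)) (return cadlag_measure_space (\<lambda>t\<in>{0..}. \<Phi> t))"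
  proof (rule ucc_weak_conv_of_monotone)
    fix N :: nat assume N: "N \<ge> 1"
    obtain P where "storage_process lam \<mu> d (F N) N P (M N) (X N)" using process[OF N] by blast
    then interpret storage_process lam \<mu> d "F N" N P "M N" "X N" .
    have c: "0 < real N ^ (d - 1)" using N by simp
    show "prob_space (M N)" by unfold_locales
    show "?Y N t \<in> borel_measurable (M N)" if "0 \<le> t" for t
    proof -
      have "X N (real N ^ (d - 1) * t) \<in> M N \<rightarrow>\<^sub>M count_space S"
        using that by (intro X_measurable) simp
      then show ?thesis by (rule measurable_compose) simp
    qed
    show "cadlag (\<lambda>t. ?Y N t \<omega>)" if "\<omega> \<in> space (M N)" for \<omega>
      by (rule cadlag_coordinate[OF X_cadlag[OF that] c])
    show "AE \<omega> in M N. \<forall>s t. 0 \<le> s \<longrightarrow> s \<le> t \<longrightarrow> ?Y N s \<omega> \<le> ?Y N t \<omega>"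
      using AE_state_0_mono
    proof eventually_elim
      case (elim \<omega>)
      show ?case
      proof (intro allI impI)
        fix s t :: real assume "0 \<le> s" "s \<le> t"
        then show "?Y N s \<omega> \<le> ?Y N t \<omega>"
          using elim[rule_format, of "real N ^ (d - 1) * s" "real N ^ (d - 1) * t"] c
          by (intro divide_right_mono) auto
      qed
    qed
  qed (use continuous_on_\<Phi> \<Phi>_mono conv in auto)
  moreover have "\<Phi> t \<in> {0..\<beta>} \<and> limit_equation lam \<rho> \<beta> d t (\<Phi> t) \<and>
      (\<forall>y\<in>{0..\<beta>}. limit_equation lam \<rho> \<beta> d t y \<longrightarrow> y = \<Phi> t)" if "0 \<le> t" for t
    unfolding level
  proof (intro conjI ballI impI)
    show "\<Phi> t \<in> {0..\<beta>}" using \<Phi>_bounds[OF that] by simp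
    show "level (\<Phi> t) = exp (- \<kappa> * t)" by (rule level_\<Phi>[OF that])
    show "y = \<Phi> t" if "y \<in> {0..\<beta>}" "level y = exp (- \<kappa> * t)" for y
      using \<Phi>_unique[OF \<open>0 \<le> t\<close>] that by simp
  qed
  ultimately show ?thesis by blast
qed

end
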